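(* Let $0<d<n$ be integers, let $\varepsilon>0$ be small enough depending only on $n$ and $d$, let $E\subseteq B(0,1)\subset\mathbb{R}^n$ be one-sided $(\varepsilon,d)$-Reifenberg flat, with a coherent collection of balls and planes for $E$ and the associated maps $f_k$, numbers $\varepsilon_k(\cdot)$, and David--Toro map $f\colon\Sigma_0\to\Sigma=f(\Sigma_0)$. Let $\alpha\in(0,1)$ and assume that there exists $M>0$ such that $$\sum_{k=0}^{\infty}\frac{\varepsilon_k(f_k(z))^2}{r_k^{2\alpha}}\le M\qquad\text{for all }z\in\Sigma_0 .$$ Then $f\colon\Sigma_0\to\Sigma$ is invertible and differentiable, and both $f$ and its inverse have $\alpha$-Hölder directional derivatives (for the inverse: derivatives along directions tangent to $\Sigma$). In particular, $f$ is continuously differentiable. Moreover, the Hölder constants depend only on $n$, $d$ and $M$.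
   Context: Notation: $r_k=10^{-k}$; $B(x,r)$ is the ball of centre $x$ and radius $r$; "$d$-plane" means $d$-dimensional affine subspace of $\mathbb{R}^n$. Normalized Hausdorff distance: $d_{x,r}(F,G)=\frac1r\max\{\sup_{y\in F\cap B(x,r)}\operatorname{dist}(y,G),\ \sup_{y\in G\cap B(x,r)}\operatorname{dist}(y,F)\}$ for nonempty $F,G\subseteq\mathbb{R}^n$. One-sided Reifenberg flat: $E\subseteq\mathbb{R}^n$ is one-sided $(\varepsilon,d)$-Reifenberg flat if (1) for every $x\in E$, $0<r\le10$ there is a $d$-plane $P(x,r)$ through $x$ with $\operatorname{dist}(y,P(x,r))\le\varepsilon r$ for $y\in E\cap B(x,r)$; and (2) $d_{x,10^{-k}}(P(x,10^{-k}),P(x,10^{-k+1}))\le\varepsilon$ for all $x\in E$, $k\ge0$, and $d_{x,10^{-k+2}}(P(x,10^{-k}),P(y,10^{-k}))\le\varepsilon$ for all $k\ge0$ and $x,y\in E$ with $|x-y|\le10^{-k+2}$. Coherent collection of balls and planes for $E$: for each $k\ge0$ a maximal collection $\{x_{j,k}\}_{j\in J_k}\subset E$ with $|x_{i,k}-x_{j,k}|\ge r_k$ for $i\ne j$; balls $B_{j,k}=B(x_{j,k},r_k)$, $\lambda B_{j,k}=B(x_{j,k},\lambda r_k)$, $V_k^\lambda=\bigcup_{j\in J_k}\lambda B_{j,k}$; a $d$-plane $\Sigma_0$ with $\operatorname{dist}(x_{j,0},\Sigma_0)\le\varepsilon$ for $j\in J_0$; and $d$-planes $P_{j,k}\ni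 x_{j,k}$ such that $d_{x_{j,k},100r_k}(P_{i,k},P_{j,k})\le\varepsilon$ whenever $i,j\in J_k$, $|x_{i,k}-x_{j,k}|\le100r_k$; $d_{x_{i,0},100}(P_{i,0},\Sigma_0)\le\varepsilon$ for $i\in J_0$; $d_{x_{i,k},20r_k}(P_{i,k},P_{j,k+1})\le\varepsilon$ whenever $i\in J_k$, $j\in J_{k+1}$, $|x_{i,k}-x_{j,k+1}|\le2r_k$. Numbers $\varepsilon_k$: for $y\in V_k^{10}$, $\varepsilon_k(y)=\sup\{d_{x_{i,l},100r_l}(P_{j,k},P_{i,l}) : j\in J_k,\ l\in\{k-1,k\},\ i\in J_l,\ y\in10B_{j,k}\cap11B_{i,l}\}$ (for $k=0$ there is no generation $-1$, so only $l=0$ occurs), and $\varepsilon_k(y)=0$ for $y\in\mathbb{R}^n\setminus V_k^{10}$. David--Toro map: $\theta_{j,k}\ge0$ (compactly supported in $10B_{j,k}$) and $\psi_k$ are smooth functions on $\mathbb{R}^n$ with $\psi_k+\sum_{j\in J_k}\theta_{j,k}\equiv1$, $\psi_k=0$ on $V_k^8$, $|\nabla^m\theta_{j,k}|\le C_mr_k^{-m}$, $|\nabla^m\psi_k|\le C_mr_k^{-m}$. With $\pi_{j,k}$ the orthogonal projection onto $P_{j,k}$, $\sigma_k(y)=\psi_k(y)y+\sum_{j\in J_k}\theta_{j,k}(y)\pi_{j,k}(y)$, $f_0(y)=y$, $f_{k+1}=\sigma_k\circ f_k$. The $f_k$ converge uniformly to a continuous $f\colon\mathbb{R}^n\to\mathbb{R}^n$;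 its restriction to $\Sigma_0$, still denoted $f$, is the David--Toro map.
   Formalization: The Hölder constants depend on n, d, M and also on the fixed exponent α (and on the cut-off constants C_m); a bound depending only on n, d and M, uniform in α∈(0,1), is false as α→0. *)

theory Defs
  imports "HOL-Analysis.Analysis"
begin

text \<open>Balls \<open>B(x, r)\<close> are the open balls \<^const>\<open>ball\<close>.\<close>

definition rad :: "nat \<Rightarrow> real" where
  "rad k = (1 / 10) ^ k"

definition is_plane :: "nat \<Rightarrow> 'a::euclidean_space set \<Rightarrow> bool" where
  "is_plane d P \<longleftrightarrow> affine P \<and> aff_dim P = int d"

text \<open>The normalized Hausdorff distance \<open>d\<^bsub>x,r\<^esub>(F, G)\<close>. Inserting \<open>0\<close> does not change the supremum of
  a nonempty set of distances; it makes the supremum over the empty set \<open>0\<close>.\<close>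

definition hdist :: "'a::euclidean_space \<Rightarrow> real \<Rightarrow> 'a set \<Rightarrow> 'a set \<Rightarrow> real" where
  "hdist x r F G =
     (1 / r) * max (Sup (insert 0 ((\<lambda>y. infdist y G) ` (F \<inter> ball x r))))
                   (Sup (insert 0 ((\<lambda>y. infdist y F) ` (G \<inter> ball x r))))"

definition one_sided_reifenberg_flat ::
    "real \<Rightarrow> nat \<Rightarrow> 'a::euclidean_space set \<Rightarrow> bool" where
  "one_sided_reifenberg_flat \<epsilon> d E \<longleftrightarrow>
     (\<exists>P :: 'a \<Rightarrow> real \<Rightarrow> 'a set.
        (\<forall>x\<in>E. \<forall>r. 0 < r \<and> r \<le> 10 \<longrightarrow>
           is_plane d (P x r) \<and> x \<in> P x r \<and>
           (\<forall>y \<in> E \<inter> ball x r. infdist y (P x r) \<le> \<epsilon> * r)) \<and>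
        (\<forall>x\<in>E. \<forall>k. hdist x (rad k) (P x (rad k)) (P x (10 * rad k)) \<le> \<epsilon>) \<and>
        (\<forall>k. \<forall>x\<in>E. \<forall>y\<in>E. dist x y \<le> 100 * rad k \<longrightarrow>
           hdist x (100 * rad k) (P x (rad k)) (P y (rad k)) \<le> \<epsilon>))"

text \<open>The point \<open>x\<^bsub>j,k\<^esub>\<close> is \<open>x k j\<close>, and similarly for planes and cut-off functions. The index sets
  are sets of naturals: a separated collection in a bounded set is finite.\<close>

definition coherent_collection ::
    "real \<Rightarrow> nat \<Rightarrow> 'a::euclidean_space set \<Rightarrow> (nat \<Rightarrow> nat set) \<Rightarrow> (nat \<Rightarrow> nat \<Rightarrow> 'a) \<Rightarrow>
     (nat \<Rightarrow> nat \<Rightarrow> 'a set) \<Rightarrow> 'a set \<Rightarrow> bool" where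
  "coherent_collection \<epsilon> d E J x P \<Sigma>\<^sub>0 \<longleftrightarrow>
     (\<forall>k. \<forall>j\<in>J k. x k j \<in> E) \<and>
     (\<forall>k. \<forall>i\<in>J k. \<forall>j\<in>J k. i \<noteq> j \<longrightarrow> rad k \<le> dist (x k i) (x k j)) \<and>
     (\<forall>k. \<forall>z\<in>E. \<exists>j\<in>J k. dist z (x k j) < rad k) \<and>
     is_plane d \<Sigma>\<^sub>0 \<and>
     (\<forall>j\<in>J 0. infdist (x 0 j) \<Sigma>\<^sub>0 \<le> \<epsilon>) \<and>
     (\<forall>k. \<forall>j\<in>J k. is_plane d (P k j) \<and> x k j \<in> P k j) \<and>
     (\<forall>k. \<forall>i\<in>J k. \<forall>j\<in>J k. dist (x k i) (x k j) \<le> 100 * rad k \<longrightarrow>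
        hdist (x k j) (100 * rad k) (P k i) (P k j) \<le> \<epsilon>) \<and>
     (\<forall>i\<in>J 0. hdist (x 0 i) 100 (P 0 i) \<Sigma>\<^sub>0 \<le> \<epsilon>) \<and>
     (\<forall>k. \<forall>i\<in>J k. \<forall>j\<in>J (Suc k). dist (x k i) (x (Suc k) j) \<le> 2 * rad k \<longrightarrow>
        hdist (x k i) (20 * rad k) (P k i) (P (Suc k) j) \<le> \<epsilon>)"

definition V :: "(nat \<Rightarrow> nat set) \<Rightarrow> (nat \<Rightarrow> nat \<Rightarrow> 'a::euclidean_space) \<Rightarrow> nat \<Rightarrow> real \<Rightarrow> 'a set" where
  "V J x k l = (\<Union>j\<in>J k. ball (x k j) (l * rad k))"

definition eps ::
    "(nat \<Rightarrow> nat set) \<Rightarrow> (nat \<Rightarrow> nat \<Rightarrow> 'a::euclidean_space) \<Rightarrow> (nat \<Rightarrow> nat \<Rightarrow> 'a set) \<Rightarrow>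
     nat \<Rightarrow> 'a \<Rightarrow> real" where
  "eps J x P k y =
     (if y \<in> V J x k 10
      then Sup {hdist (x l i) (100 * rad l) (P k j) (P l i) | j l i.
                  j \<in> J k \<and> (l = k \<or> Suc l = k) \<and> i \<in> J l \<and>
                  y \<in> ball (x k j) (10 * rad k) \<inter> ball (x l i) (11 * rad l)}
      else 0)"

text \<open>\<open>nabla [v\<^sub>1, \<dots>, v\<^sub>m] h x\<close> is \<open>\<nabla>\<^sup>m h(x)\<close> evaluated at the directions \<open>v\<^sub>1, \<dots>, v\<^sub>m\<close>. The size of
  \<open>\<nabla>\<^sup>m h(x)\<close> is its norm as an \<open>m\<close>-linear form.\<close>

primrec nabla :: "'a::euclidean_space list \<Rightarrow> ('a \<Rightarrow> real) \<Rightarrow> 'a \<Rightarrow> real" where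
  "nabla [] h = h"
| "nabla (v # vs) h = (\<lambda>x. frechet_derivative (nabla vs h) (at x) v)"

definition smooth :: "('a::euclidean_space \<Rightarrow> real) \<Rightarrow> bool" where
  "smooth h \<longleftrightarrow> (\<forall>vs. nabla vs h differentiable_on UNIV)"

definition nabla_bound :: "nat \<Rightarrow> ('a::euclidean_space \<Rightarrow> real) \<Rightarrow> real \<Rightarrow> bool" where
  "nabla_bound m h B \<longleftrightarrow>
     (\<forall>x vs. length vs = m \<and> (\<forall>v\<in>set vs. norm v = 1) \<longrightarrow> \<bar>nabla vs h x\<bar> \<le> B)"

definition cutoffs ::
    "(nat \<Rightarrow> real) \<Rightarrow> (nat \<Rightarrow> nat set) \<Rightarrow> (nat \<Rightarrow> nat \<Rightarrow> 'a::euclidean_space) \<Rightarrow>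
     (nat \<Rightarrow> nat \<Rightarrow> 'a \<Rightarrow> real) \<Rightarrow> (nat \<Rightarrow> 'a \<Rightarrow> real) \<Rightarrow> bool" where
  "cutoffs C J x \<theta> \<psi> \<longleftrightarrow>
     (\<forall>k. \<forall>j\<in>J k.
        smooth (\<theta> k j) \<and> (\<forall>y. 0 \<le> \<theta> k j y) \<and>
        closure {y. \<theta> k j y \<noteq> 0} \<subseteq> ball (x k j) (10 * rad k) \<and>
        (\<forall>m. nabla_bound m (\<theta> k j) (C m / rad k ^ m))) \<and>
     (\<forall>k. smooth (\<psi> k) \<and> (\<forall>y \<in> V J x k 8. \<psi> k y = 0) \<and>
        (\<forall>m. nabla_bound m (\<psi> k) (C m / rad k ^ m))) \<and>
     (\<forall>k y. \<psi> k y + (\<Sum>j\<in>J k. \<theta> k j y) = 1)"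

definition sigma ::
    "(nat \<Rightarrow> nat set) \<Rightarrow> (nat \<Rightarrow> nat \<Rightarrow> 'a::euclidean_space set) \<Rightarrow> (nat \<Rightarrow> nat \<Rightarrow> 'a \<Rightarrow> real) \<Rightarrow>
     (nat \<Rightarrow> 'a \<Rightarrow> real) \<Rightarrow> nat \<Rightarrow> 'a \<Rightarrow> 'a" where
  "sigma J P \<theta> \<psi> k y = \<psi> k y *\<^sub>R y + (\<Sum>j\<in>J k. \<theta> k j y *\<^sub>R closest_point (P k j) y)"

primrec dt_iter ::
    "(nat \<Rightarrow> nat set) \<Rightarrow> (nat \<Rightarrow> nat \<Rightarrow> 'a::euclidean_space set) \<Rightarrow> (nat \<Rightarrow> nat \<Rightarrow> 'a \<Rightarrow> real) \<Rightarrow>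
     (nat \<Rightarrow> 'a \<Rightarrow> real) \<Rightarrow> nat \<Rightarrow> 'a \<Rightarrow> 'a" where
  "dt_iter J P \<theta> \<psi> 0 = id"
| "dt_iter J P \<theta> \<psi> (Suc k) = sigma J P \<theta> \<psi> k \<circ> dt_iter J P \<theta> \<psi> k"

text \<open>The limit exists, uniformly on the whole space: \<open>\<sigma>\<^sub>k\<close> moves points by \<open>O(r\<^sub>k)\<close>.\<close>

definition david_toro ::
    "(nat \<Rightarrow> nat set) \<Rightarrow> (nat \<Rightarrow> nat \<Rightarrow> 'a::euclidean_space set) \<Rightarrow> (nat \<Rightarrow> nat \<Rightarrow> 'a \<Rightarrow> real) \<Rightarrow>
     (nat \<Rightarrow> 'a \<Rightarrow> real) \<Rightarrow> 'a \<Rightarrow> 'a" where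
  "david_toro J P \<theta> \<psi> z = lim (\<lambda>k. dt_iter J P \<theta> \<psi> k z)"

definition dir_deriv :: "('a::euclidean_space \<Rightarrow> 'a) \<Rightarrow> 'a \<Rightarrow> 'a \<Rightarrow> 'a" where
  "dir_deriv h x v = vector_derivative (\<lambda>t. h (x + t *\<^sub>R v)) (at 0)"

definition plane_directions :: "'a::euclidean_space set \<Rightarrow> 'a set" where
  "plane_directions P = {a - b | a b. a \<in> P \<and> b \<in> P}"

definition holder_dir_derivs_plane ::
    "real \<Rightarrow> real \<Rightarrow> ('a::euclidean_space \<Rightarrow> 'a) \<Rightarrow> 'a set \<Rightarrow> bool" where
  "holder_dir_derivs_plane \<alpha> K h P \<longleftrightarrow>
     (\<forall>v \<in> plane_directions P. norm v = 1 \<longrightarrow>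
        (\<forall>x\<in>P. \<forall>y\<in>P. norm (dir_deriv h x v - dir_deriv h y v) \<le> K * dist x y powr \<alpha>))"

text \<open>The directions tangent to a set \<open>S\<close> at \<open>x\<close> (limits of rescaled secants).\<close>

definition tangent_directions :: "'a::euclidean_space set \<Rightarrow> 'a \<Rightarrow> 'a set" where
  "tangent_directions S x =
     {v. \<exists>y t. (\<forall>i. y i \<in> S) \<and> (\<forall>i::nat. 0 < (t i :: real)) \<and> y \<longlonglongrightarrow> x \<and>
           (\<lambda>i. t i *\<^sub>R (y i - x)) \<longlonglongrightarrow> v}"

text \<open>The derivative of \<open>h : S \<rightarrow> \<real>\<^sup>n\<close> along a direction tangent to \<open>S\<close>. The derivative within \<open>S\<close> is
  a linear map which is determined only on the directions tangent to \<open>S\<close>, so the third argument must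
  be such a direction.\<close>

definition tangent_deriv ::
    "('a::euclidean_space \<Rightarrow> 'a) \<Rightarrow> 'a set \<Rightarrow> 'a \<Rightarrow> 'a \<Rightarrow> 'a" where
  "tangent_deriv h S x v = frechet_derivative h (at x within S) v"

text \<open>Tangent directions vary with the base point. Derivatives at two points are compared through a
  common direction \<open>u\<close> of the ambient space, projected orthogonally to the two tangent spaces; that is,
  \<open>x \<mapsto> Dh(x) \<circ> \<pi>\<^bsub>T\<^sub>xS\<^esub>\<close> is Hoelder continuous in the operator norm.\<close>

definition holder_tangent_derivs ::
    "real \<Rightarrow> real \<Rightarrow> ('a::euclidean_space \<Rightarrow> 'a) \<Rightarrow> 'a set \<Rightarrow> bool" where
  "holder_tangent_derivs \<alpha> K h S \<longleftrightarrow>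
     (\<forall>u. norm u = 1 \<longrightarrow>
        (\<forall>x\<in>S. \<forall>y\<in>S.
           norm (tangent_deriv h S x (closest_point (tangent_directions S x) u)
               - tangent_deriv h S y (closest_point (tangent_directions S y) u))
             \<le> K * dist x y powr \<alpha>))"

definition C1_on :: "('a::euclidean_space \<Rightarrow> 'a) \<Rightarrow> 'a set \<Rightarrow> bool" where
  "C1_on h P \<longleftrightarrow>
     (\<exists>h' :: 'a \<Rightarrow> 'a \<Rightarrow>\<^sub>L 'a. continuous_on P h' \<and>
        (\<forall>x\<in>P. (h has_derivative blinfun_apply (h' x)) (at x within P)))"

end

theory Submission
  imports Defs
begin

text \<open>The summability hypothesis enters term by term: it gives
\<open>\<epsilon>\<^sub>k(f\<^sub>k(z)) \<le> \<surd>M r\<^sub>k\<^sup>\<alpha>\<close>, while coherence gives \<open>\<epsilon>\<^sub>k \<le> C \<epsilon>\<close>. Let \<open>\<lambda>\<^sub>k\<close> be (a constant times) the smaller of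
the two bounds. It is small, so that all constructions are stable at every scale, and it decays
geometrically, so that errors of size \<open>\<lambda>\<^sub>k\<close> can be summed with a bound that depends on \<open>M\<close>.

The main step controls secants. Suppose that \<open>f\<^sub>k(z)\<close> and \<open>f\<^sub>k(z')\<close> lie within \<open>r\<^sub>k\<close> of each other and
near a ball of generation \<open>k\<close>. Then the secant \<open>f\<^sub>k(z) - f\<^sub>k(z')\<close> makes an angle \<open>O(\<lambda>\<^sub>k)\<close>
with the plane \<open>P\<^sub>j\<^sub>,\<^sub>k\<close> of that ball (\<open>secant_near_plane\<close>). The constant does not deteriorate with
\<open>k\<close>: a point of the next generation comes from the region where the cut-off functions add up to \<open>1\<close>;
there \<open>\<sigma>\<^sub>k\<close> is the projection onto any nearby plane up to an error \<open>O(\<lambda>\<^sub>k)\<close>, so one step forgets the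
previous angle and replaces it by \<open>O(\<lambda>\<^sub>k)\<close>. Likewise \<open>f\<^sub>k(z)\<close> has distance \<open>O(\<lambda>\<^sub>k r\<^sub>k)\<close> from
\<open>P\<^sub>j\<^sub>,\<^sub>k\<close> (\<open>near_plane\<close>). Together these show that \<open>\<sigma>\<^sub>k\<close> changes a secant \<open>w\<close> shorter than \<open>r\<^sub>k\<close> by
at most \<open>O(\<lambda>\<^sub>k) |w|\<close> (\<open>increment_step\<close>).

Three consequences follow. A pair of points is followed until its distance exceeds \<open>r\<^sub>k\<close>; later steps
move both points by a small multiple of \<open>r\<^sub>k\<close>, so that \<open>|f(z) - f(z')| \<ge> c |z - z'|\<close>
(\<open>D_expanding\<close>). Passing from secants to tangents, \<open>|Df\<^sub>k\<^sub>+\<^sub>1 v - Df\<^sub>k v| \<le> O(\<lambda>\<^sub>k) |Df\<^sub>k v|\<close> for \<open>v\<close>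
tangent to \<open>\<Sigma>\<^sub>0\<close>, so \<open>Df\<^sub>k\<close> converges uniformly with error \<open>O(r\<^sub>k\<^sup>\<alpha>)\<close> and \<open>f\<close> is differentiable
(\<open>D_has_derivative\<close>). Finally, differentiating \<open>\<sigma>\<^sub>k\<close> at two points and using the same smallness,
\<open>|Df\<^sub>k(z) v - Df\<^sub>k(z') v|\<close> grows in step \<open>k\<close> by a factor \<open>1 + O(\<lambda>\<^sub>k)\<close> and a summand
\<open>O(\<lambda>\<^sub>k |z - z'| / r\<^sub>k)\<close>; since \<open>\<alpha> < 1\<close>, the summands up to generation \<open>n\<close> add up to
\<open>O(|z - z'| r\<^sub>n\<^sup>\<alpha>\<^sup>-\<^sup>1)\<close>. Choosing \<open>n\<close> with \<open>r\<^sub>n\<close> comparable to \<open>|z - z'|\<close> gives the Hoelder estimate for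
\<open>Df\<close> (\<open>G_holder\<close>).

For the inverse nothing about the construction is needed beyond these facts: the tangent directions of
\<open>f(\<Sigma>\<^sub>0)\<close> at \<open>f(z)\<close> are the image of \<open>Df(z)\<close>, and projecting an ambient vector there and pulling it
back is a least squares problem whose solution depends on \<open>Df(z)\<close> in a Lipschitz way
(\<open>holder_inverse\<close>).\<close>


section \<open>Orthogonal projections onto planes\<close>

text \<open>The linear part of the orthogonal projection onto \<open>P\<close>, that is, the projection onto the direction
space of \<open>P\<close>.\<close>

definition lproj :: "'a::euclidean_space set \<Rightarrow> 'a \<Rightarrow> 'a" where
  "lproj P = closest_point (plane_directions P)"

lemma subspace_closest_point:
  fixes S :: "'a::euclidean_space set"
  assumes "subspace S"
  shows "closest_point S u \<in> S" "v \<in> S \<Longrightarrow> (u - closest_point S u) \<bullet> v = 0"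
proof -
  have cl: "closed S" "convex S" "S \<noteq> {}"
    using assms closed_subspace subspace_imp_convex subspace_0 by blast+
  show in_S: "closest_point S u \<in> S"
    using cl closest_point_in_set by blast
  have le: "(u - closest_point S u) \<bullet> (w - closest_point S u) \<le> 0" if "w \<in> S" for w
    using closest_point_dot cl that by blast
  show "(u - closest_point S u) \<bullet> v = 0" if "v \<in> S"
    using le[of "closest_point S u + v"] le[of "closest_point S u - v"] that in_S assms
    by (simp add: subspace_add subspace_diff)
qed

lemma subspace_closest_point_unique:
  fixes S :: "'a::euclidean_space set"
  assumes S: "subspace S" and "w \<in> S" and "\<And>v. v \<in> S \<Longrightarrow> (u - w) \<bullet> v = 0"
  shows "closest_point S u = w"
proof -
  let ?d = "closest_point S u - w"
  have "?d \<in> S"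
    using S assms(2) subspace_closest_point(1) subspace_diff by blast
  then have "(u - w) \<bullet> ?d - (u - closest_point S u) \<bullet> ?d = 0"
    using assms(3) subspace_closest_point(2)[OF S] by simp
  then have "?d \<bullet> ?d = 0"
    by (simp add: inner_diff_left)
  then show ?thesis by simp
qed

lemma linear_subspace_closest_point:
  fixes S :: "'a::euclidean_space set"
  assumes S: "subspace S"
  shows "linear (closest_point S)"
proof (rule linearI)
  note cp = subspace_closest_point[OF S]
  show "closest_point S (a + b) = closest_point S a + closest_point S b" for a b
  proof (rule subspace_closest_point_unique[OF S])
    fix v assume "v \<in> S"
    have "a + b - (closest_point S a + closest_point S b)
        = (a - closest_point S a) + (b - closest_point S b)"
      by simp
    then show "(a + b - (closest_point S a + closest_point S b)) \<bullet> v = 0"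
      using cp(2)[OF \<open>v \<in> S\<close>] by (simp only: inner_add_left)
  qed (simp add: cp S subspace_add)
  show "closest_point S (r *\<^sub>R a) = r *\<^sub>R closest_point S a" for r a
  proof (rule subspace_closest_point_unique[OF S])
    fix v assume "v \<in> S"
    have "r *\<^sub>R a - r *\<^sub>R closest_point S a = r *\<^sub>R (a - closest_point S a)"
      by (simp add: algebra_simps)
    then show "(r *\<^sub>R a - r *\<^sub>R closest_point S a) \<bullet> v = 0"
      using cp(2)[OF \<open>v \<in> S\<close>] by simp
  qed (simp add: cp S subspace_scale)
qed

lemma subspace_plane_directions:
  assumes "affine P" "P \<noteq> {}"
  shows "subspace (plane_directions P)"
proof -
  obtain p where "p \<in> P" using assms by blast
  have eq: "plane_directions P = (\<lambda>a. - p + a) ` P"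
  proof safe
    fix v assume "v \<in> plane_directions P"
    then obtain a b where ab: "v = a - b" "a \<in> P" "b \<in> P"
      by (auto simp: plane_directions_def)
    have "p + 1 *\<^sub>R (a - b) \<in> P"
      using mem_affine_3_minus[OF assms(1) \<open>p \<in> P\<close> ab(2,3)] .
    then show "v \<in> (\<lambda>a. - p + a) ` P"
      using ab by (force intro: image_eqI[of _ _ "p + (a - b)"])
  next
    fix a assume "a \<in> P"
    then have "a - p \<in> plane_directions P"
      using \<open>p \<in> P\<close> by (auto simp: plane_directions_def)
    then show "- p + a \<in> plane_directions P" by simp
  qed
  show ?thesis
    unfolding eq using affine_diffs_subspace[OF assms(1) \<open>p \<in> P\<close>] by simp
qed

lemma plane_add_direction:
  assumes "affine P" "p \<in> P" "v \<in> plane_directions P"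
  shows "p + t *\<^sub>R v \<in> P"
  using assms mem_affine_3_minus by (fastforce simp: plane_directions_def)

context
  fixes P :: "'a::euclidean_space set"
  assumes P: "affine P" "P \<noteq> {}"
begin

lemma lproj_linear: "linear (lproj P)"
  unfolding lproj_def using linear_subspace_closest_point subspace_plane_directions P by blast

lemma lproj_mem: "lproj P u \<in> plane_directions P"
  unfolding lproj_def using subspace_closest_point subspace_plane_directions P by blast

lemma lproj_orth: "v \<in> plane_directions P \<Longrightarrow> (u - lproj P u) \<bullet> v = 0"
  unfolding lproj_def using subspace_closest_point subspace_plane_directions P by blast

lemma lproj_same: "v \<in> plane_directions P \<Longrightarrow> lproj P v = v"
  unfolding lproj_def by (rule closest_point_self)

lemma lproj_pythagoras: "(norm u)\<^sup>2 = (norm (lproj P u))\<^sup>2 + (norm (u - lproj P u))\<^sup>2"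
proof -
  have "(norm (lproj P u + (u - lproj P u)))\<^sup>2
      = (norm (lproj P u))\<^sup>2 + (norm (u - lproj P u))\<^sup>2"
    using lproj_orth[OF lproj_mem, of u u]
    by (intro norm_add_Pythagorean) (simp add: orthogonal_def inner_commute)
  then show ?thesis by simp
qed

lemma norm_lproj_le: "norm (lproj P u) \<le> norm u"
  using lproj_pythagoras[of u] by (metis norm_ge_zero power2_le_imp_le le_add_same_cancel1 zero_le_power2)

lemma norm_sub_lproj_le: "norm (u - lproj P u) \<le> norm u"
  using lproj_pythagoras[of u] by (metis norm_ge_zero power2_le_imp_le le_add_same_cancel2 zero_le_power2)

lemma closest_point_plane: "p \<in> P \<Longrightarrow> closest_point P y = p + lproj P (y - p)"
proof -
  assume p: "p \<in> P"
  let ?q = "p + lproj P (y - p)"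
  have q: "?q \<in> P"
    using plane_add_direction[OF P(1) p lproj_mem, of 1] by simp
  have "dist y ?q \<le> dist y z" if "z \<in> P" for z
  proof -
    have d: "?q - z \<in> plane_directions P"
      using q that by (auto simp: plane_directions_def)
    have "(norm ((y - ?q) + (?q - z)))\<^sup>2 = (norm (y - ?q))\<^sup>2 + (norm (?q - z))\<^sup>2"
      using lproj_orth[OF d, of "y - p"]
      by (intro norm_add_Pythagorean) (simp add: orthogonal_def algebra_simps)
    then have "(norm (y - ?q))\<^sup>2 \<le> (norm (y - z))\<^sup>2" by simp
    then show ?thesis
      by (simp add: dist_norm)
  qed
  then show ?thesis
    using closest_point_unique[of P ?q y] P q affine_imp_convex affine_closed by force
qed

lemma closest_point_diff: "closest_point P y - closest_point P y' = lproj P (y - y')"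
proof -
  obtain p where p: "p \<in> P" using P by blast
  show ?thesis
    unfolding closest_point_plane[OF p]
    using linear_diff[OF lproj_linear, of "y - p" "y' - p"] by simp
qed

lemma closest_point_in_plane: "closest_point P y \<in> P"
  using P affine_closed closest_point_in_set by blast

lemma norm_closest_point_le: "z \<in> P \<Longrightarrow> norm (y - closest_point P y) \<le> norm (y - z)"
  using P affine_closed closest_point_le by (metis dist_norm)

lemma closest_point_lproj_diff:
  "(closest_point P y - y) - (closest_point P y' - y') = lproj P (y - y') - (y - y')"
  using closest_point_diff[of y y'] by (simp add: algebra_simps)

end

lemma closest_point_has_derivative:
  fixes P :: "'a::euclidean_space set"
  assumes "affine P" "P \<noteq> {}"
  shows "(closest_point P has_derivative lproj P) F"
proof -
  obtain p where p: "p \<in> P" using assms by blast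
  have eq: "closest_point P = (\<lambda>y. (p - lproj P p) + lproj P y)"
    using closest_point_plane[OF assms p] linear_diff[OF lproj_linear[OF assms]] by (force simp: algebra_simps)
  have bl: "bounded_linear (lproj P)"
    using lproj_linear[OF assms] linear_conv_bounded_linear by blast
  show ?thesis
    unfolding eq by (rule derivative_eq_intros bounded_linear_imp_has_derivative bl | simp)+
qed

section \<open>Planes at small normalized distance\<close>

text \<open>Both suprema in the normalized distance are of bounded sets, so they dominate their elements.\<close>

lemma infdist_le_hdist:
  fixes F G :: "'a::euclidean_space set"
  assumes "0 < r" "F \<noteq> {}" "G \<noteq> {}"
  shows "y \<in> F \<inter> ball x r \<Longrightarrow> infdist y G \<le> r * hdist x r F G"
    and "y \<in> G \<inter> ball x r \<Longrightarrow> infdist y F \<le> r * hdist x r F G"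
proof -
  have bdd: "bdd_above (insert 0 ((\<lambda>y. infdist y G) ` (F \<inter> ball x r)))"
    if G: "G \<noteq> {}" for F G :: "'a set"
  proof -
    obtain g where "g \<in> G" using G by blast
    have "infdist y G \<le> r + dist x g" if "y \<in> F \<inter> ball x r" for y
    proof -
      have "infdist y G \<le> dist y g" using \<open>g \<in> G\<close> by (rule infdist_le)
      also have "\<dots> \<le> dist y x + dist x g" by (rule dist_triangle)
      also have "\<dots> \<le> r + dist x g" using that by (simp add: dist_commute)
      finally show ?thesis .
    qed
    then have "bdd_above ((\<lambda>y. infdist y G) ` (F \<inter> ball x r))"
      by (intro bdd_aboveI2)
    then show ?thesis by simp
  qed
  have eq: "r * hdist x r F G = max (Sup (insert 0 ((\<lambda>y. infdist y G) ` (F \<inter> ball x r))))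
                   (Sup (insert 0 ((\<lambda>y. infdist y F) ` (G \<inter> ball x r))))"
    using assms(1) by (simp add: hdist_def)
  show "infdist y G \<le> r * hdist x r F G" if "y \<in> F \<inter> ball x r"
    unfolding eq using cSup_upper[OF _ bdd[OF assms(3), of F], of "infdist y G"] that by force
  show "infdist y F \<le> r * hdist x r F G" if "y \<in> G \<inter> ball x r"
    unfolding eq using cSup_upper[OF _ bdd[OF assms(2), of G], of "infdist y F"] that by force
qed

lemma infdist_plane:
  fixes P :: "'a::euclidean_space set"
  assumes "affine P" "P \<noteq> {}"
  shows "infdist y P = norm (y - closest_point P y)"
  using closest_point_in_set[OF affine_closed[OF assms(1)] assms(2), of y]
    setdist_closest_point[OF affine_closed[OF assms(1)] assms(2), of y] assms(2)
  by (simp add: infdist_eq_setdist dist_norm)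

text \<open>If a plane \<open>P\<close> stays close to \<open>Q\<close> in a ball, then two points of \<open>P\<close> in this ball whose difference
is a long multiple of \<open>u\<close> are both close to \<open>Q\<close>; their difference shows that \<open>u\<close> is almost a
direction of \<open>Q\<close>.\<close>

lemma direction_near_plane:
  fixes P Q :: "'a::euclidean_space set"
  assumes P: "affine P" and Q: "affine Q" "Q \<noteq> {}" and p: "p \<in> P" "dist x p < R / 2"
    and near: "\<And>y. y \<in> P \<inter> ball x R \<Longrightarrow> infdist y Q \<le> R * t"
    and u: "u \<in> plane_directions P"
  shows "norm (u - lproj Q u) \<le> 4 * t * norm u"
proof (cases "u = 0")
  case True
  then show ?thesis using linear_0[OF lproj_linear[OF Q]] by simp
next
  case False
  have R: "0 < R" using p zero_le_dist[of x p] by linarith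
  define s where "s = R / (2 * norm u)"
  have s: "0 < s" using R False by (simp add: s_def)
  have ns: "norm (s *\<^sub>R u) = R / 2" using R False by (simp add: s_def)
  let ?q = "p + s *\<^sub>R u"
  have "dist x ?q \<le> dist x p + norm (s *\<^sub>R u)"
    by (metis add.commute add_diff_cancel_left' dist_norm dist_triangle norm_minus_commute)
  then have "dist x ?q < R" using ns p by linarith
  then have 1: "norm (?q - closest_point Q ?q) \<le> R * t"
    using near[of ?q] plane_add_direction[OF P p(1) u] infdist_plane[OF Q] by auto
  have 2: "norm (p - closest_point Q p) \<le> R * t"
    using near[of p] p infdist_plane[OF Q] R by auto
  have "s *\<^sub>R (u - lproj Q u) = (?q - closest_point Q ?q) - (p - closest_point Q p)"
    using closest_point_diff[OF Q, of ?q p] linear_scale[OF lproj_linear[OF Q], of s u]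
    by (simp add: algebra_simps)
  then have "norm (s *\<^sub>R (u - lproj Q u)) \<le> 2 * (R * t)"
    using 1 2 norm_triangle_ineq4[of "?q - closest_point Q ?q" "p - closest_point Q p"] by simp
  then have "s * norm (u - lproj Q u) \<le> 2 * (R * t)"
    using s by (simp del: scaleR_diff_right)
  then have "R * norm (u - lproj Q u) \<le> R * (4 * t * norm u)"
    using False by (simp add: s_def field_simps)
  then show ?thesis using R by simp
qed

text \<open>Closeness in both directions bounds the difference of the projections, because
\<open>\<pi> - \<pi>' = (1 - \<pi>') \<pi> - \<pi>' (1 - \<pi>)\<close> and the last term is the adjoint of \<open>(1 - \<pi>) \<pi>'\<close>. The base
points \<open>p\<close> and \<open>q\<close> ensure that both planes meet the inner half of the ball.\<close>

lemma planes_close: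
  fixes P Q :: "'a::euclidean_space set"
  assumes P: "affine P" and Q: "affine Q"
    and p: "p \<in> P" "dist x p < R / 2" and q: "q \<in> Q" "dist x q < R / 2"
    and h: "hdist x R P Q \<le> t"
  shows "norm (lproj P u - lproj Q u) \<le> 8 * t * norm u"
    and "norm (closest_point P y - closest_point Q y) \<le> R * t + 8 * t * norm (y - p)"
proof -
  have R: "0 < R" using p zero_le_dist[of x p] by linarith
  have ne: "P \<noteq> {}" "Q \<noteq> {}" using p q by auto
  note lP = lproj_linear[OF P ne(1)] and lQ = lproj_linear[OF Q ne(2)]
  have Rt: "R * hdist x R P Q \<le> R * t" using h R by simp
  have near1: "infdist y Q \<le> R * t" if "y \<in> P \<inter> ball x R" for y
    using infdist_le_hdist(1)[OF R ne that] Rt by linarith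
  have near2: "infdist y P \<le> R * t" if "y \<in> Q \<inter> ball x R" for y
    using infdist_le_hdist(2)[OF R ne that] Rt by linarith
  have PQ: "norm (u - lproj Q u) \<le> 4 * t * norm u" if "u \<in> plane_directions P" for u
    using direction_near_plane[OF P Q ne(2) p near1 that] by blast
  have QP: "norm (u - lproj P u) \<le> 4 * t * norm u" if "u \<in> plane_directions Q" for u
    using direction_near_plane[OF Q P ne(1) q near2 that] by blast
  have t: "0 \<le> t"
    using near1[of p] p R infdist_nonneg[of p Q] by (auto simp: zero_le_mult_iff dest: order_trans)
  show *: "norm (lproj P u - lproj Q u) \<le> 8 * t * norm u" for u
  proof -
    \<comment> \<open>\<open>v = \<pi>' (1 - \<pi>) u\<close> is estimated by duality, through \<open>(1 - \<pi>) v\<close>.\<close>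
    define v where "v = lproj Q (u - lproj P u)"
    have v: "v \<in> plane_directions Q" unfolding v_def using lproj_mem[OF Q ne(2)] .
    have "v \<bullet> v = (u - lproj P u) \<bullet> v"
      using lproj_orth[OF Q ne(2) v, of "u - lproj P u"] by (simp add: v_def inner_diff_left)
    also have "\<dots> = (u - lproj P u) \<bullet> (v - lproj P v)"
      using lproj_orth[OF P ne(1) lproj_mem[OF P ne(1)], of u v] by (simp add: inner_diff_right)
    also have "\<dots> \<le> norm (u - lproj P u) * norm (v - lproj P v)"
      by (rule norm_cauchy_schwarz)
    also have "\<dots> \<le> norm u * (4 * t * norm v)"
      using norm_sub_lproj_le[OF P ne(1)] QP[OF v] by (intro mult_mono) auto
    finally have "norm v * norm v \<le> (4 * t * norm u) * norm v"
      by (simp add: power2_norm_eq_inner[symmetric] power2_eq_square algebra_simps)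
    then have nv: "norm v \<le> 4 * t * norm u"
      using t by (cases "v = 0") auto
    have "lproj P u - lproj Q u = (lproj P u - lproj Q (lproj P u)) - v"
      unfolding v_def by (simp add: linear_diff[OF lQ])
    then have "norm (lproj P u - lproj Q u) \<le> norm (lproj P u - lproj Q (lproj P u)) + norm v"
      using norm_triangle_ineq4 by metis
    also have "\<dots> \<le> 4 * t * norm (lproj P u) + 4 * t * norm u"
      using PQ[OF lproj_mem[OF P ne(1)]] nv by (intro add_mono) auto
    also have "\<dots> \<le> 4 * t * norm u + 4 * t * norm u"
      using norm_lproj_le[OF P ne(1), of u] t by (intro add_mono mult_left_mono) auto
    finally show ?thesis by simp
  qed
  have "closest_point P p = p" using p by (simp add: closest_point_self)
  then have "closest_point P y - closest_point Q y
     = (p - closest_point Q p) + (lproj P (y - p) - lproj Q (y - p))"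
    using closest_point_diff[OF P ne(1), of y p] closest_point_diff[OF Q ne(2), of y p]
    by (simp add: algebra_simps)
  then have "norm (closest_point P y - closest_point Q y)
     \<le> norm (p - closest_point Q p) + norm (lproj P (y - p) - lproj Q (y - p))"
    using norm_triangle_ineq by metis
  also have "\<dots> \<le> R * t + 8 * t * norm (y - p)"
    using near1[of p] p R infdist_plane[OF Q ne(2), of p] *[of "y - p"] by (intro add_mono) auto
  finally show "norm (closest_point P y - closest_point Q y) \<le> R * t + 8 * t * norm (y - p)" .
qed

text \<open>The bounded overlap of the balls of one generation. By compactness a ball of radius \<open>10\<close> is covered by
finitely many balls of radius \<open>1/2\<close>, and each of these contains at most one point of a \<open>1\<close>-separated
set; scaling makes the number independent of \<open>r\<close>.\<close>

lemma separated_overlap_bound: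
  "\<exists>N\<ge>1. \<forall>(S :: 'a::euclidean_space set) y r. 0 < r \<and> S \<subseteq> ball y (10 * r)
       \<and> (\<forall>a\<in>S. \<forall>b\<in>S. a \<noteq> b \<longrightarrow> r \<le> dist a b) \<longrightarrow> finite S \<and> card S \<le> N"
proof -
  have "compact (cball (0::'a) 10)" by simp
  moreover have "cball (0::'a) 10 \<subseteq> (\<Union>z\<in>cball 0 10. ball z (1/2))" by force
  ultimately obtain Z where Z: "finite Z" "cball (0::'a) 10 \<subseteq> (\<Union>z\<in>Z. ball z (1/2))"
    by (elim compactE_image) auto
  have "finite S \<and> card S \<le> card Z"
    if r: "0 < r" and S: "S \<subseteq> ball y (10 * r)"
      and sep: "\<forall>a\<in>S. \<forall>b\<in>S. a \<noteq> b \<longrightarrow> r \<le> dist a b" for S and y :: 'a and r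
  proof -
    define c where "c a = (SOME z. z \<in> Z \<and> (1/r) *\<^sub>R (a - y) \<in> ball z (1/2))" for a
    have c: "c a \<in> Z \<and> (1/r) *\<^sub>R (a - y) \<in> ball (c a) (1/2)" if "a \<in> S" for a
    proof -
      have "norm (a - y) < 10 * r" using S that by (auto simp: dist_norm norm_minus_commute)
      then have "(1/r) *\<^sub>R (a - y) \<in> cball 0 10"
        using r by (simp add: divide_simps mult.commute del: scaleR_diff_right)
      then have "\<exists>z. z \<in> Z \<and> (1/r) *\<^sub>R (a - y) \<in> ball z (1/2)" using Z(2) by blast
      then show ?thesis unfolding c_def by (rule someI_ex)
    qed
    have "inj_on c S"
    proof
      fix a b assume ab: "a \<in> S" "b \<in> S" "c a = c b"
      have "dist (c a) ((1/r) *\<^sub>R (a - y)) < 1/2" "dist (c a) ((1/r) *\<^sub>R (b - y)) < 1/2"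
        using c ab by force+
      then have "dist ((1/r) *\<^sub>R (a - y)) ((1/r) *\<^sub>R (b - y)) < 1"
        by (rule dist_triangle_half_r)
      also have "dist ((1/r) *\<^sub>R (a - y)) ((1/r) *\<^sub>R (b - y)) = dist a b / r"
        using r by (simp add: dist_norm flip: scaleR_diff_right)
      finally show "a = b" using sep ab r by (force simp: field_simps)
    qed
    moreover have "c ` S \<subseteq> Z" using c by blast
    ultimately show ?thesis
      using Z(1) card_inj_on_le inj_on_finite by metis
  qed
  then show ?thesis
    by (intro exI[of _ "max 1 (card Z)"]) (auto simp: le_max_iff_disj)
qed

section \<open>Secants of the iterated surfaces\<close>

lemma rad_pos: "0 < rad k"
  by (simp add: rad_def)

lemma rad_nonneg [simp]: "0 \<le> rad k"
  by (simp add: rad_def)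

lemma rad_neq_0 [simp]: "rad k \<noteq> 0"
  by (simp add: rad_def)

lemma rad_Suc: "rad (Suc k) = rad k / 10"
  by (simp add: rad_def)

lemma ball_rad_mono: "y \<in> ball c (a * rad k) \<Longrightarrow> a \<le> b \<Longrightarrow> y \<in> ball c (b * rad k)"
  using mult_right_mono[OF _ rad_nonneg[of k], of a b] unfolding mem_ball by linarith

text \<open>The data of the construction, reduced to what the estimates use: the balls of a generation overlap at
most \<open>N\<close> times; \<open>A\<close> bounds the cut-off functions, their derivatives and the Lipschitz constants of these,
after rescaling \<open>r\<^sub>k\<close> to \<open>1\<close>; and \<open>lam k\<close> bounds the gaps between planes of generations \<open>k\<close> and \<open>k - 1\<close>
whose balls contain a common point \<open>f\<^sub>k(z)\<close> with \<open>z\<close> in the base plane. The gap is required in the ball of radius \<open>30 r\<^sub>k\<close>, although \<open>f\<^sub>k(z)\<close> lies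
in the ball of radius \<open>10 r\<^sub>k\<close>, so that a second point near \<open>f\<^sub>k(z)\<close> can be projected as well. The
condition \<open>lam_step\<close> says that an error made in generation \<open>k\<close> is still of the order of the gaps in
generation \<open>k + 1\<close>. Smallness of \<open>lam\<close> relative to \<open>N A\<close> absorbs all constants in the estimates below.\<close>

locale tower =
  fixes J :: "nat \<Rightarrow> nat set" and x :: "nat \<Rightarrow> nat \<Rightarrow> 'a::euclidean_space"
    and P :: "nat \<Rightarrow> nat \<Rightarrow> 'a set" and \<Sigma>\<^sub>0 :: "'a set"
    and \<theta> :: "nat \<Rightarrow> nat \<Rightarrow> 'a \<Rightarrow> real" and \<theta>' :: "nat \<Rightarrow> nat \<Rightarrow> 'a \<Rightarrow> 'a \<Rightarrow> real"
    and \<psi> :: "nat \<Rightarrow> 'a \<Rightarrow> real" and N A :: real and lam :: "nat \<Rightarrow> real"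
  assumes N_ge_1: "1 \<le> N" and A_ge_1: "1 \<le> A"
    and finite_J: "finite (J k)"
    and overlap: "real (card {j \<in> J k. y \<in> ball (x k j) (10 * rad k)}) \<le> N"
    and parent: "j \<in> J (Suc k) \<Longrightarrow> \<exists>i\<in>J k. dist (x (Suc k) j) (x k i) < rad k"
    and plane: "j \<in> J k \<Longrightarrow> affine (P k j)" "j \<in> J k \<Longrightarrow> P k j \<noteq> {}"
    and base_plane: "affine \<Sigma>\<^sub>0" "\<Sigma>\<^sub>0 \<noteq> {}"
    and theta_nonneg: "j \<in> J k \<Longrightarrow> 0 \<le> \<theta> k j y"
    and theta_le: "j \<in> J k \<Longrightarrow> \<theta> k j y \<le> A"
    and theta_outside: "j \<in> J k \<Longrightarrow> y \<notin> ball (x k j) (10 * rad k) \<Longrightarrow> \<theta> k j y = 0"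
    and theta_deriv: "j \<in> J k \<Longrightarrow> (\<theta> k j has_derivative \<theta>' k j y) (at y)"
    and theta'_le: "j \<in> J k \<Longrightarrow> \<bar>\<theta>' k j y u\<bar> \<le> A / rad k * norm u"
    and theta'_lipschitz:
      "j \<in> J k \<Longrightarrow> \<bar>\<theta>' k j y u - \<theta>' k j y' u\<bar> \<le> A / (rad k)\<^sup>2 * norm (y - y') * norm u"
    and theta'_outside: "j \<in> J k \<Longrightarrow> y \<notin> ball (x k j) (10 * rad k) \<Longrightarrow> \<theta>' k j y u = 0"
    and partition: "\<psi> k y + (\<Sum>j\<in>J k. \<theta> k j y) = 1"
    and psi_zero: "y \<in> V J x k 8 \<Longrightarrow> \<psi> k y = 0"
    and base_near:
      "j \<in> J 0 \<Longrightarrow> norm (lproj (P 0 j) u - lproj \<Sigma>\<^sub>0 u) \<le> lam 0 * norm u"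
      "j \<in> J 0 \<Longrightarrow> y \<in> ball (x 0 j) 30 \<Longrightarrow>
         norm (closest_point (P 0 j) y - closest_point \<Sigma>\<^sub>0 y) \<le> lam 0"
    and planes_near:
      "\<lbrakk>z \<in> \<Sigma>\<^sub>0; j \<in> J k; l = k \<or> Suc l = k; i \<in> J l;
        dt_iter J P \<theta> \<psi> k z \<in> ball (x k j) (10 * rad k);
        dt_iter J P \<theta> \<psi> k z \<in> ball (x l i) (11 * rad l)\<rbrakk> \<Longrightarrow>
        norm (lproj (P k j) u - lproj (P l i) u) \<le> lam k * norm u"
      "\<lbrakk>z \<in> \<Sigma>\<^sub>0; j \<in> J k; l = k \<or> Suc l = k; i \<in> J l;
        dt_iter J P \<theta> \<psi> k z \<in> ball (x k j) (10 * rad k);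
        dt_iter J P \<theta> \<psi> k z \<in> ball (x l i) (11 * rad l); y \<in> ball (x k j) (30 * rad k)\<rbrakk> \<Longrightarrow>
        norm (closest_point (P k j) y - closest_point (P l i) y) \<le> lam k * rad k"
    and lam_nonneg: "0 \<le> lam k"
    and lam_small: "8000 * (N * A)\<^sup>2 * lam k \<le> 1"
    and lam_step: "lam k \<le> 10 * lam (Suc k)"
begin

abbreviation "F \<equiv> dt_iter J P \<theta> \<psi>"
declare dt_iter.simps(2) [simp del]

abbreviation "\<pi> k j \<equiv> closest_point (P k j)"
abbreviation "L k j \<equiv> lproj (P k j)"
definition "B = N * A"

lemma NA_nonneg: "0 \<le> N" "0 \<le> A" and B_ge_1: "1 \<le> B"
  using N_ge_1 A_ge_1 mult_mono[of 1 N 1 A] by (auto simp: B_def)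

lemma B_sq: "B \<le> B\<^sup>2" "1 \<le> B\<^sup>2"
  using B_ge_1 self_le_power[of B 2] by (auto simp: one_le_power)

lemma B_lam_small: "8000 * B * lam k \<le> 1"
  using lam_small[of k] unfolding B_def[symmetric] using mult_right_mono[OF B_sq(1) lam_nonneg[of k]] by linarith

text \<open>Sums over a generation are effectively sums over the boundedly many balls that contain a given point,
or one of two given points.\<close>

lemma norm_sum_one_point:
  fixes g :: "nat \<Rightarrow> 'b::real_normed_vector"
  assumes "\<And>j. j \<in> J k \<Longrightarrow> y \<in> ball (x k j) (10 * rad k) \<Longrightarrow> norm (g j) \<le> c"
    and "\<And>j. j \<in> J k \<Longrightarrow> y \<notin> ball (x k j) (10 * rad k) \<Longrightarrow> g j = 0" and "0 \<le> c"
  shows "norm (\<Sum>j\<in>J k. g j) \<le> N * c"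
proof -
  let ?I = "{j \<in> J k. y \<in> ball (x k j) (10 * rad k)}"
  have "(\<Sum>j\<in>J k. g j) = (\<Sum>j\<in>?I. g j)"
    using assms(2) by (intro sum.mono_neutral_right finite_J) auto
  also have "norm \<dots> \<le> (\<Sum>j\<in>?I. c)"
    using assms(1) by (intro sum_norm_le) auto
  also have "\<dots> = real (card ?I) * c" by simp
  also have "\<dots> \<le> N * c"
    using overlap assms(3) by (intro mult_right_mono)
  finally show ?thesis .
qed

lemma norm_sum_two_points:
  fixes g :: "nat \<Rightarrow> 'b::real_normed_vector"
  assumes "\<And>j. j \<in> J k \<Longrightarrow> y \<in> ball (x k j) (10 * rad k) \<or> y' \<in> ball (x k j) (10 * rad k)
               \<Longrightarrow> norm (g j) \<le> c"
    and "\<And>j. j \<in> J k \<Longrightarrow> y \<notin> ball (x k j) (10 * rad k) \<Longrightarrow> y' \<notin> ball (x k j) (10 * rad k)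
               \<Longrightarrow> g j = 0" and "0 \<le> c"
  shows "norm (\<Sum>j\<in>J k. g j) \<le> 2 * N * c"
proof -
  let ?g1 = "\<lambda>j. if y \<in> ball (x k j) (10 * rad k) then g j else 0"
  let ?g2 = "\<lambda>j. if y \<in> ball (x k j) (10 * rad k) then 0 else g j"
  have "(\<Sum>j\<in>J k. g j) = (\<Sum>j\<in>J k. ?g1 j) + (\<Sum>j\<in>J k. ?g2 j)"
    unfolding sum.distrib[symmetric] by (intro sum.cong) auto
  moreover have "norm (\<Sum>j\<in>J k. ?g1 j) \<le> N * c"
    using assms by (intro norm_sum_one_point[where y = y]) auto
  moreover have "norm (\<Sum>j\<in>J k. ?g2 j) \<le> N * c"
    using assms by (intro norm_sum_one_point[where y = y']) auto
  ultimately show ?thesis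
    using norm_triangle_ineq[of "\<Sum>j\<in>J k. ?g1 j" "\<Sum>j\<in>J k. ?g2 j"] by simp
qed

lemma theta_lipschitz:
  assumes "j \<in> J k"
  shows "\<bar>\<theta> k j y - \<theta> k j y'\<bar> \<le> A / rad k * norm (y - y')"
proof -
  have "norm (\<theta> k j y - \<theta> k j y') \<le> A / rad k * norm (y - y')"
  proof (rule differentiable_bound[where S = UNIV and f' = "\<theta>' k j"])
    show "(\<theta> k j has_derivative \<theta>' k j u) (at u within UNIV)" for u
      using theta_deriv[OF assms] by simp
    show "onorm (\<theta>' k j u) \<le> A / rad k" for u
      using theta'_le[OF assms, of u] NA_nonneg by (intro onorm_le) simp
  qed auto
  then show ?thesis by simp
qed

text \<open>Eliminating \<open>\<psi>\<close> turns \<open>\<sigma>\<^sub>k\<close> into the identity plus corrections towards the planes; these are small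
near the surface.\<close>

lemma sigma_eq: "sigma J P \<theta> \<psi> k y = y + (\<Sum>j\<in>J k. \<theta> k j y *\<^sub>R (\<pi> k j y - y))"
proof -
  have "\<psi> k y = 1 - (\<Sum>j\<in>J k. \<theta> k j y)" using partition[of k y] by simp
  then show ?thesis
    by (simp add: sigma_def scaleR_diff_right sum_subtractf scaleR_diff_left scaleR_sum_left)
qed

lemma F_Suc: "F (Suc k) z = F k z + (\<Sum>j\<in>J k. \<theta> k j (F k z) *\<^sub>R (\<pi> k j (F k z) - F k z))"
  by (simp add: dt_iter.simps(2) sigma_eq)

lemma sum_theta: "y \<in> V J x k 8 \<Longrightarrow> (\<Sum>j\<in>J k. \<theta> k j y) = 1"
  using partition[of k y] psi_zero by simp

lemma mem_V8: "i \<in> J k \<Longrightarrow> y \<in> ball (x k i) (5 * rad k) \<Longrightarrow> y \<in> V J x k 8"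
  using ball_rad_mono[of y "x k i" 5 k 8] unfolding V_def by auto

lemma F_Suc_V8:
  assumes "F k z \<in> V J x k 8"
  shows "F (Suc k) z = (\<Sum>j\<in>J k. \<theta> k j (F k z) *\<^sub>R \<pi> k j (F k z))"
  using psi_zero[OF assms] by (simp add: dt_iter.simps(2) sigma_def)

text \<open>Stated under a hypothesis that \<open>near_plane\<close> establishes in general, because the inductive proof of
\<open>near_plane\<close> needs this consequence in the previous generation.\<close>

lemma move_from_near:
  assumes "\<And>j. j \<in> J k \<Longrightarrow> F k z \<in> ball (x k j) (10 * rad k)
              \<Longrightarrow> norm (\<pi> k j (F k z) - F k z) \<le> 101 * lam k * rad k"
  shows "norm (F (Suc k) z - F k z) \<le> 101 * B * lam k * rad k"
proof -
  have "norm (\<Sum>j\<in>J k. \<theta> k j (F k z) *\<^sub>R (\<pi> k j (F k z) - F k z)) \<le> N * (A * (101 * lam k * rad k))"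
  proof (rule norm_sum_one_point[where y = "F k z"])
    fix j assume j: "j \<in> J k" "F k z \<in> ball (x k j) (10 * rad k)"
    show "norm (\<theta> k j (F k z) *\<^sub>R (\<pi> k j (F k z) - F k z)) \<le> A * (101 * lam k * rad k)"
      using assms[OF j] theta_le[OF j(1)] theta_nonneg[OF j(1)] NA_nonneg
      unfolding norm_scaleR by (intro mult_mono) auto
  qed (use theta_outside lam_nonneg NA_nonneg in auto)
  then show ?thesis by (simp add: F_Suc B_def mult_ac)
qed

lemma move_bound_small: "101 * B * lam k * rad k \<le> rad k / 20"
proof -
  have "101 * B * lam k \<le> 1 / 20"
    using B_lam_small[of k] B_ge_1 lam_nonneg[of k] mult_nonneg_nonneg[of B "lam k"] by linarith
  then have "101 * B * lam k * rad k \<le> 1 / 20 * rad k"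
    by (intro mult_right_mono) auto
  then show ?thesis by simp
qed

text \<open>A point that is near a ball of generation \<open>k + 1\<close> was, one step earlier, deep inside a ball of
generation \<open>k\<close>: the centre of the small ball is a point of \<open>E\<close>, hence close to a centre of the
previous generation, and the step moves points by very little.\<close>

lemma parent_from_move:
  assumes "norm (F (Suc k) z - F k z) \<le> 101 * B * lam k * rad k"
    and j: "j \<in> J (Suc k)" "F (Suc k) z \<in> ball (x (Suc k) j) (10 * rad (Suc k))"
  obtains i where "i \<in> J k" "F (Suc k) z \<in> ball (x k i) (2 * rad k)"
    "F k z \<in> ball (x k i) (3 * rad k)"
proof -
  obtain i where i: "i \<in> J k" "dist (x (Suc k) j) (x k i) < rad k"
    using parent[OF j(1)] by blast
  have d: "dist (x (Suc k) j) (F (Suc k) z) < rad k"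
    using j(2) by (simp add: rad_Suc)
  have 1: "dist (x k i) (F (Suc k) z) < 2 * rad k"
    using dist_triangle3[of "x k i" "F (Suc k) z" "x (Suc k) j"] i d by linarith
  have "dist (F (Suc k) z) (F k z) \<le> rad k / 20"
    using order_trans[OF assms(1) move_bound_small] by (simp add: dist_norm)
  then have "dist (x k i) (F k z) < 3 * rad k"
    using 1 dist_triangle[of "x k i" "F k z" "F (Suc k) z"] rad_pos[of k] by linarith
  with i 1 show ?thesis using that by simp
qed

text \<open>A point \<open>f\<^sub>k\<^sub>+\<^sub>1(z)\<close> near a ball of its generation is a convex combination of projections of the previous point onto planes
that agree up to \<open>lam k * rad k\<close>, so it has that distance from each of them, however far the previous
point was. The constant \<open>101\<close> accounts for \<open>lam k * rad k \<le> 100 * lam (Suc k) * rad (Suc k)\<close> and for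
the gap to the plane of the new generation.\<close>

lemma near_plane:
  assumes z: "z \<in> \<Sigma>\<^sub>0"
  shows "j \<in> J k \<Longrightarrow> F k z \<in> ball (x k j) (10 * rad k) \<Longrightarrow>
    norm (\<pi> k j (F k z) - F k z) \<le> 101 * lam k * rad k"
proof (induction k arbitrary: j)
  case 0
  have "norm (\<pi> 0 j z - closest_point \<Sigma>\<^sub>0 z) \<le> lam 0"
    using 0 by (intro base_near(2)) (auto simp: rad_def)
  then show ?case
    using z lam_nonneg[of 0] by (simp add: closest_point_self rad_def)
next
  case (Suc k)
  let ?y = "F k z" and ?y1 = "F (Suc k) z"
  obtain i where i: "i \<in> J k" "?y1 \<in> ball (x k i) (2 * rad k)" "?y \<in> ball (x k i) (3 * rad k)"
    using parent_from_move[OF move_from_near[OF Suc.IH] Suc.prems] by blast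
  have y8: "?y \<in> V J x k 8" using mem_V8[OF i(1)] ball_rad_mono[OF i(3)] by simp
  have y11: "?y \<in> ball (x k i) (11 * rad k)" using ball_rad_mono[OF i(3)] by simp
  have "norm (?y1 - \<pi> k i ?y) \<le> lam k * rad k"
  proof -
    have eq: "?y1 - \<pi> k i ?y = (\<Sum>j\<in>J k. \<theta> k j ?y *\<^sub>R (\<pi> k j ?y - \<pi> k i ?y))"
      using sum_theta[OF y8] unfolding F_Suc_V8[OF y8]
      by (simp add: scaleR_diff_right sum_subtractf flip: scaleR_sum_left)
    have "norm (?y1 - \<pi> k i ?y) \<le> (\<Sum>j\<in>J k. \<theta> k j ?y * (lam k * rad k))"
      unfolding eq
    proof (rule sum_norm_le)
      fix j assume j: "j \<in> J k"
      show "norm (\<theta> k j ?y *\<^sub>R (\<pi> k j ?y - \<pi> k i ?y)) \<le> \<theta> k j ?y * (lam k * rad k)"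
      proof (cases "?y \<in> ball (x k j) (10 * rad k)")
        case True
        have "norm (\<pi> k j ?y - \<pi> k i ?y) \<le> lam k * rad k"
          using True rad_pos[of k] by (intro planes_near(2)[OF z j _ i(1) True y11]) auto
        then show ?thesis
          using theta_nonneg[OF j] by (simp add: mult_left_mono)
      qed (use theta_outside[OF j] in simp)
    qed
    also have "\<dots> = lam k * rad k"
      unfolding sum_distrib_right[symmetric] sum_theta[OF y8] by simp
    finally show ?thesis .
  qed
  moreover have "norm (?y1 - \<pi> k i ?y1) \<le> norm (?y1 - \<pi> k i ?y)"
    using norm_closest_point_le[OF plane[OF i(1)] closest_point_in_plane[OF plane[OF i(1)]]] .
  moreover have "norm (\<pi> (Suc k) j ?y1 - \<pi> k i ?y1) \<le> lam (Suc k) * rad (Suc k)"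
    using Suc.prems i(2) rad_pos[of k] rad_pos[of "Suc k"]
    by (intro planes_near(2)[OF z Suc.prems(1) _ i(1) Suc.prems(2)]) auto
  ultimately have "norm (\<pi> (Suc k) j ?y1 - ?y1) \<le> lam k * rad k + lam (Suc k) * rad (Suc k)"
    using norm_triangle_sub[of "\<pi> (Suc k) j ?y1 - ?y1" "\<pi> (Suc k) j ?y1 - \<pi> k i ?y1"]
      norm_minus_commute[of ?y1 "\<pi> k i ?y1"] by simp
  also have "\<dots> \<le> 101 * lam (Suc k) * rad (Suc k)"
    using mult_right_mono[OF lam_step[of k] rad_nonneg[of k]] by (simp add: rad_Suc algebra_simps)
  finally show ?case .
qed

lemma move: "z \<in> \<Sigma>\<^sub>0 \<Longrightarrow> norm (F (Suc k) z - F k z) \<le> 101 * B * lam k * rad k"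
  using move_from_near near_plane by blast

lemma move_small: "z \<in> \<Sigma>\<^sub>0 \<Longrightarrow> norm (F (Suc k) z - F k z) \<le> rad k / 20"
  using order_trans[OF move move_bound_small] .

lemma parent_ball:
  assumes "z \<in> \<Sigma>\<^sub>0" "j \<in> J (Suc k)" "F (Suc k) z \<in> ball (x (Suc k) j) (10 * rad (Suc k))"
  obtains i where "i \<in> J k" "F (Suc k) z \<in> ball (x k i) (2 * rad k)"
    "F k z \<in> ball (x k i) (3 * rad k)"
  using parent_from_move[OF move[OF assms(1)] assms(2,3)] by blast

text \<open>Deep inside a ball the cut-off functions add up to \<open>1\<close> at both points. Hence the differences of their
values add up to \<open>0\<close>, and the projection onto the fixed plane \<open>P k i\<close> may be subtracted from every
projection; only gaps between planes remain.\<close>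

lemma increment_almost_projection:
  assumes z: "z \<in> \<Sigma>\<^sub>0" "z' \<in> \<Sigma>\<^sub>0" and i: "i \<in> J k"
    and y: "F k z \<in> ball (x k i) (5 * rad k)" "F k z' \<in> ball (x k i) (5 * rad k)"
  shows "norm ((F (Suc k) z - F (Suc k) z') - L k i (F k z - F k z'))
           \<le> 3 * B * lam k * norm (F k z - F k z')"
proof -
  let ?y = "F k z" and ?y' = "F k z'"
  let ?w = "?y - ?y'"
  have y8: "?y \<in> V J x k 8" "?y' \<in> V J x k 8" using y by (auto intro: mem_V8[OF i])
  have y11: "?y \<in> ball (x k i) (11 * rad k)" "?y' \<in> ball (x k i) (11 * rad k)"
    using y[THEN ball_rad_mono, of 11] by auto
  have dw: "dist ?y ?y' < 10 * rad k"
    using y dist_triangle3[of ?y ?y' "x k i"] by simp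
  have sums: "(\<Sum>j\<in>J k. \<theta> k j ?y) = 1" "(\<Sum>j\<in>J k. \<theta> k j ?y') = 1"
    using sum_theta y8 by auto
  have eq: "F (Suc k) z - F (Suc k) z' - L k i ?w =
      (\<Sum>j\<in>J k. \<theta> k j ?y *\<^sub>R (L k j ?w - L k i ?w))
      + (\<Sum>j\<in>J k. (\<theta> k j ?y - \<theta> k j ?y') *\<^sub>R (\<pi> k j ?y' - \<pi> k i ?y'))"
  proof -
    have Lw: "L k j ?w = \<pi> k j ?y - \<pi> k j ?y'" if "j \<in> J k" for j
      using closest_point_diff plane that by metis
    have "(\<Sum>j\<in>J k. \<theta> k j ?y *\<^sub>R (L k j ?w - L k i ?w))
        = (\<Sum>j\<in>J k. \<theta> k j ?y *\<^sub>R \<pi> k j ?y) - (\<Sum>j\<in>J k. \<theta> k j ?y *\<^sub>R \<pi> k j ?y') - L k i ?w"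
      using sums(1)
      by (simp add: Lw scaleR_diff_right sum_subtractf flip: scaleR_sum_left cong: sum.cong)
    moreover have "(\<Sum>j\<in>J k. (\<theta> k j ?y - \<theta> k j ?y') *\<^sub>R (\<pi> k j ?y' - \<pi> k i ?y'))
        = (\<Sum>j\<in>J k. \<theta> k j ?y *\<^sub>R \<pi> k j ?y') - (\<Sum>j\<in>J k. \<theta> k j ?y' *\<^sub>R \<pi> k j ?y')"
      using sums
      by (simp add: scaleR_diff_right scaleR_diff_left sum_subtractf flip: scaleR_sum_left)
    ultimately show ?thesis
      unfolding F_Suc_V8[OF y8(1)] F_Suc_V8[OF y8(2)] by simp
  qed
  have "norm (\<Sum>j\<in>J k. \<theta> k j ?y *\<^sub>R (L k j ?w - L k i ?w)) \<le> (\<Sum>j\<in>J k. \<theta> k j ?y * (lam k * norm ?w))"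
  proof (rule sum_norm_le)
    fix j assume j: "j \<in> J k"
    show "norm (\<theta> k j ?y *\<^sub>R (L k j ?w - L k i ?w)) \<le> \<theta> k j ?y * (lam k * norm ?w)"
    proof (cases "?y \<in> ball (x k j) (10 * rad k)")
      case True
      then show ?thesis
        using planes_near(1)[OF z(1) j _ i True y11(1)] theta_nonneg[OF j] by (simp add: mult_left_mono)
    qed (use theta_outside[OF j] in simp)
  qed
  also have "\<dots> = lam k * norm ?w"
    unfolding sum_distrib_right[symmetric] sums by simp
  finally have 1: "norm (\<Sum>j\<in>J k. \<theta> k j ?y *\<^sub>R (L k j ?w - L k i ?w)) \<le> lam k * norm ?w" .
  have 2: "norm (\<Sum>j\<in>J k. (\<theta> k j ?y - \<theta> k j ?y') *\<^sub>R (\<pi> k j ?y' - \<pi> k i ?y'))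
     \<le> 2 * N * (A / rad k * norm ?w * (lam k * rad k))"
  proof (rule norm_sum_two_points[where y = ?y and y' = ?y'])
    fix j assume j: "j \<in> J k"
      and or: "?y \<in> ball (x k j) (10 * rad k) \<or> ?y' \<in> ball (x k j) (10 * rad k)"
    have y30: "?y' \<in> ball (x k j) (30 * rad k)"
      using or dw dist_triangle[of "x k j" ?y' ?y] rad_pos[of k] by auto
    have "norm (\<pi> k j ?y' - \<pi> k i ?y') \<le> lam k * rad k"
      using or
    proof
      assume "?y \<in> ball (x k j) (10 * rad k)"
      then show ?thesis by (intro planes_near(2)[OF z(1) j _ i _ y11(1) y30]) auto
    next
      assume "?y' \<in> ball (x k j) (10 * rad k)"
      then show ?thesis by (intro planes_near(2)[OF z(2) j _ i _ y11(2) y30]) auto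
    qed
    then show "norm ((\<theta> k j ?y - \<theta> k j ?y') *\<^sub>R (\<pi> k j ?y' - \<pi> k i ?y'))
       \<le> A / rad k * norm ?w * (lam k * rad k)"
      using theta_lipschitz[OF j, of ?y ?y'] NA_nonneg
      unfolding norm_scaleR real_norm_def by (intro mult_mono) auto
  qed (use theta_outside lam_nonneg NA_nonneg in auto)
  have "2 * N * (A / rad k * norm ?w * (lam k * rad k)) = 2 * B * (lam k * norm ?w)"
    by (simp add: B_def)
  then have "norm (F (Suc k) z - F (Suc k) z' - L k i ?w) \<le> lam k * norm ?w + 2 * B * (lam k * norm ?w)"
    unfolding eq using norm_triangle_mono[OF 1 2] by linarith
  also have "\<dots> \<le> B * (lam k * norm ?w) + 2 * B * (lam k * norm ?w)"
    using mult_right_mono[OF B_ge_1 mult_nonneg_nonneg[OF lam_nonneg[of k] norm_ge_zero[of ?w]]]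
    by (simp add: algebra_simps)
  finally show ?thesis by (simp add: algebra_simps)
qed

text \<open>The new secant is the projection of the old one onto \<open>P k i\<close> up to
a relative error \<open>O(lam k)\<close>, so its angle with \<open>P k i\<close> is \<open>O(lam k)\<close> with a constant that does not involve
the constant of the induction hypothesis; the latter only ensures that the projection does not shorten
the old secant by more than a fixed factor. The base point \<open>z\<^sub>0\<close> is separate from the two ends of the
secant because both ends may lie slightly outside the ball in which the gap between the planes is
controlled.\<close>

lemma secant_near_plane:
  assumes z: "z\<^sub>0 \<in> \<Sigma>\<^sub>0" "z \<in> \<Sigma>\<^sub>0" "z' \<in> \<Sigma>\<^sub>0"
  shows "j \<in> J k \<Longrightarrow> F k z\<^sub>0 \<in> ball (x k j) (10 * rad k) \<Longrightarrow>
    norm (F k z - F k z\<^sub>0) \<le> rad k \<Longrightarrow> norm (F k z' - F k z\<^sub>0) \<le> rad k \<Longrightarrow>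
    norm (L k j (F k z - F k z') - (F k z - F k z')) \<le> 61 * B * lam k * norm (F k z - F k z')"
proof (induction k arbitrary: j)
  case 0
  have "z - z' \<in> plane_directions \<Sigma>\<^sub>0" using z by (auto simp: plane_directions_def)
  then have "lproj \<Sigma>\<^sub>0 (z - z') = z - z'"
    using lproj_same base_plane by blast
  then have "norm (L 0 j (z - z') - (z - z')) \<le> 1 * (lam 0 * norm (z - z'))"
    using base_near(1)[OF 0(1), of "z - z'"] by simp
  also have "\<dots> \<le> 61 * B * (lam 0 * norm (z - z'))"
    using B_ge_1 lam_nonneg by (intro mult_right_mono) auto
  finally show ?case by (simp add: mult_ac)
next
  case (Suc k)
  let ?w = "F k z - F k z'" and ?w1 = "F (Suc k) z - F (Suc k) z'"
  obtain i where i: "i \<in> J k" "F (Suc k) z\<^sub>0 \<in> ball (x k i) (2 * rad k)"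
      "F k z\<^sub>0 \<in> ball (x k i) (3 * rad k)"
    using parent_ball[OF z(1) Suc.prems(1,2)] by blast
  have close: "norm (F k u - F k z\<^sub>0) \<le> rad k"
    if "u \<in> \<Sigma>\<^sub>0" "norm (F (Suc k) u - F (Suc k) z\<^sub>0) \<le> rad (Suc k)" for u
  proof -
    have "norm (F k u - F k z\<^sub>0) \<le> norm (F (Suc k) u - F (Suc k) z\<^sub>0)
        + norm (F (Suc k) z\<^sub>0 - F k z\<^sub>0) + norm (F (Suc k) u - F k u)"
      by norm
    then show ?thesis
      using that(2) move_small[OF that(1), of k] move_small[OF z(1), of k] rad_pos[of k]
      unfolding rad_Suc by linarith
  qed
  have cl: "norm (F k z - F k z\<^sub>0) \<le> rad k" "norm (F k z' - F k z\<^sub>0) \<le> rad k"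
    using close z Suc.prems by auto
  have ball5: "F k u \<in> ball (x k i) (5 * rad k)" if "norm (F k u - F k z\<^sub>0) \<le> rad k" for u
    using that i(3) dist_triangle[of "x k i" "F k u" "F k z\<^sub>0"] rad_pos[of k]
    by (simp add: dist_norm norm_minus_commute)
  have Li: "linear (L k i)" by (rule lproj_linear[OF plane[OF i(1)]])
  define e where "e = ?w1 - L k i ?w"
  have e: "norm e \<le> 3 * B * lam k * norm ?w"
    unfolding e_def using increment_almost_projection[OF z(2,3) i(1)] ball5 cl by blast
  \<comment> \<open>The step error \<open>e\<close> and the angle of the old secant each cost at most a quarter of its length.\<close>
  have small: "61 * B * lam k \<le> 1 / 4" "3 * B * lam k \<le> 1 / 4"
    using B_lam_small[of k] B_ge_1 lam_nonneg[of k] mult_nonneg_nonneg[of B "lam k"] by linarith+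
  have "norm e \<le> 1 / 4 * norm ?w"
    using e mult_right_mono[OF small(2) norm_ge_zero[of ?w]] by linarith
  moreover have "norm (L k i ?w - ?w) \<le> 1 / 4 * norm ?w"
    using Suc.IH[OF i(1) ball_rad_mono[OF i(3)] cl] mult_right_mono[OF small(1) norm_ge_zero[of ?w]]
    by linarith
  moreover have "norm ?w \<le> norm ?w1 + norm e + norm (L k i ?w - ?w)"
    unfolding e_def by norm
  ultimately have w: "norm ?w \<le> 2 * norm ?w1" by linarith
  have "?w1 - L k i ?w1 = e - L k i e"
  proof -
    have "L k i ?w1 = L k i (L k i ?w) + L k i e"
      unfolding linear_add[OF Li, symmetric] by (simp add: e_def)
    moreover have "L k i (L k i ?w) = L k i ?w"
      using lproj_same lproj_mem plane[OF i(1)] by metis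
    ultimately show ?thesis by (simp add: e_def)
  qed
  then have "norm (L k i ?w1 - ?w1) \<le> norm e"
    using norm_sub_lproj_le[OF plane[OF i(1)], of e] by (metis norm_minus_commute)
  also have "\<dots> \<le> 3 * B * lam k * (2 * norm ?w1)"
    using w B_ge_1 lam_nonneg[of k] by (intro order_trans[OF e] mult_left_mono) auto
  also have "\<dots> \<le> 60 * B * lam (Suc k) * norm ?w1"
  proof -
    have "B * lam k * norm ?w1 \<le> B * (10 * lam (Suc k)) * norm ?w1"
      using lam_step[of k] B_ge_1 by (intro mult_right_mono mult_left_mono) auto
    then show ?thesis by (simp add: algebra_simps)
  qed
  finally have "norm (L k i ?w1 - ?w1) \<le> 60 * B * lam (Suc k) * norm ?w1" .
  moreover have "norm (L (Suc k) j ?w1 - L k i ?w1) \<le> 1 * (lam (Suc k) * norm ?w1)"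
    using planes_near(1)[OF z(1) Suc.prems(1) _ i(1) Suc.prems(2)] i(2) rad_pos[of k] by simp
  moreover have "1 * (lam (Suc k) * norm ?w1) \<le> B * (lam (Suc k) * norm ?w1)"
    using B_ge_1 lam_nonneg by (intro mult_right_mono) auto
  moreover have "norm (L (Suc k) j ?w1 - ?w1) \<le> norm (L (Suc k) j ?w1 - L k i ?w1) + norm (L k i ?w1 - ?w1)"
    by norm
  ultimately show ?case by (simp add: algebra_simps)
qed

lemma near_plane_nearby:
  assumes z: "z\<^sub>0 \<in> \<Sigma>\<^sub>0" "z \<in> \<Sigma>\<^sub>0" and j: "j \<in> J k" "F k z\<^sub>0 \<in> ball (x k j) (10 * rad k)"
    and c: "norm (F k z - F k z\<^sub>0) \<le> rad k"
  shows "norm (\<pi> k j (F k z) - F k z) \<le> 162 * B * lam k * rad k"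
proof -
  let ?w = "F k z - F k z\<^sub>0"
  have "\<pi> k j (F k z) - F k z = (\<pi> k j (F k z\<^sub>0) - F k z\<^sub>0) + (L k j ?w - ?w)"
    using closest_point_lproj_diff[OF plane[OF j(1)], of "F k z" "F k z\<^sub>0"] by (simp add: algebra_simps)
  then have "norm (\<pi> k j (F k z) - F k z)
      \<le> norm (\<pi> k j (F k z\<^sub>0) - F k z\<^sub>0) + norm (L k j ?w - ?w)"
    using norm_triangle_ineq by metis
  also have "\<dots> \<le> 101 * lam k * rad k + 61 * B * lam k * norm ?w"
    using near_plane[OF z(1) j] secant_near_plane[OF z(1,2,1) j c] by (intro add_mono) auto
  also have "\<dots> \<le> 101 * lam k * rad k + 61 * B * lam k * rad k"
    using c B_ge_1 lam_nonneg[of k] by (intro add_left_mono mult_left_mono) auto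
  also have "\<dots> \<le> 101 * (B * lam k) * rad k + 61 * B * lam k * rad k"
    using mult_right_mono[OF B_ge_1 lam_nonneg[of k]]
    by (intro add_right_mono mult_right_mono mult_left_mono) auto
  finally show ?thesis by (simp add: algebra_simps)
qed

text \<open>One step changes a short secant by a small proportion, also where the cut-off functions do not add up to
\<open>1\<close>: corrections along the planes do not affect a secant that is almost parallel to them, and the
variation of the cut-off functions is multiplied by the distance to the planes.\<close>

lemma increment_step:
  assumes z: "z \<in> \<Sigma>\<^sub>0" "z' \<in> \<Sigma>\<^sub>0" and c: "norm (F k z - F k z') \<le> rad k"
  shows "norm ((F (Suc k) z - F (Suc k) z') - (F k z - F k z'))
           \<le> 385 * B\<^sup>2 * lam k * norm (F k z - F k z')"
proof -
  let ?y = "F k z" and ?y' = "F k z'"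
  let ?w = "?y - ?y'"
  have nn: "0 \<le> B" "0 \<le> lam k" using B_ge_1 lam_nonneg by auto
  have c': "norm (?y' - ?y) \<le> rad k" using c by (simp add: norm_minus_commute)
  have eq: "(F (Suc k) z - F (Suc k) z') - ?w =
      (\<Sum>j\<in>J k. \<theta> k j ?y *\<^sub>R (L k j ?w - ?w))
      + (\<Sum>j\<in>J k. (\<theta> k j ?y - \<theta> k j ?y') *\<^sub>R (\<pi> k j ?y' - ?y'))"
  proof -
    have Lw: "L k j ?w = \<pi> k j ?y - \<pi> k j ?y'" if "j \<in> J k" for j
      using closest_point_diff plane that by metis
    show ?thesis
      unfolding F_Suc sum.distrib[symmetric]
      by (simp add: Lw flip: sum_subtractf cong: sum.cong) (simp add: algebra_simps)
  qed
  have 1: "norm (\<Sum>j\<in>J k. \<theta> k j ?y *\<^sub>R (L k j ?w - ?w)) \<le> N * (A * (61 * B * lam k * norm ?w))"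
  proof (rule norm_sum_one_point[where y = ?y])
    fix j assume j: "j \<in> J k" "?y \<in> ball (x k j) (10 * rad k)"
    have "norm (L k j ?w - ?w) \<le> 61 * B * lam k * norm ?w"
      using c' by (intro secant_near_plane[OF z(1,1,2) j]) auto
    then show "norm (\<theta> k j ?y *\<^sub>R (L k j ?w - ?w)) \<le> A * (61 * B * lam k * norm ?w)"
      using theta_le[OF j(1)] theta_nonneg[OF j(1)] NA_nonneg
      unfolding norm_scaleR by (intro mult_mono) auto
  qed (use theta_outside nn NA_nonneg in auto)
  have 2: "norm (\<Sum>j\<in>J k. (\<theta> k j ?y - \<theta> k j ?y') *\<^sub>R (\<pi> k j ?y' - ?y'))
     \<le> 2 * N * (A / rad k * norm ?w * (162 * B * lam k * rad k))"
  proof (rule norm_sum_two_points[where y = ?y and y' = ?y'])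
    fix j assume j: "j \<in> J k"
      and or: "?y \<in> ball (x k j) (10 * rad k) \<or> ?y' \<in> ball (x k j) (10 * rad k)"
    have "norm (\<pi> k j ?y' - ?y') \<le> 162 * B * lam k * rad k"
      using or near_plane_nearby[OF z(1,2) j _ c'] near_plane_nearby[OF z(2,2) j] by fastforce
    then show "norm ((\<theta> k j ?y - \<theta> k j ?y') *\<^sub>R (\<pi> k j ?y' - ?y'))
       \<le> A / rad k * norm ?w * (162 * B * lam k * rad k)"
      using theta_lipschitz[OF j, of ?y ?y'] NA_nonneg
      unfolding norm_scaleR real_norm_def by (intro mult_mono) auto
  qed (use theta_outside nn NA_nonneg in auto)
  have "N * (A * (61 * B * lam k * norm ?w)) + 2 * N * (A / rad k * norm ?w * (162 * B * lam k * rad k))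
     = 385 * B\<^sup>2 * lam k * norm ?w"
    by (simp add: B_def power2_eq_square algebra_simps)
  then show ?thesis
    unfolding eq using norm_triangle_mono[OF 1 2] by linarith
qed

end

section \<open>Growth of sequences with small relative increments\<close>

lemma exp_le_one_minus: "0 \<le> s \<Longrightarrow> s \<le> 1 / 2 \<Longrightarrow> exp (- 2 * s) \<le> 1 - (s::real)"
proof -
  assume s: "0 \<le> s" "s \<le> 1 / 2"
  have "2 * s\<^sup>2 \<le> s" using mult_left_mono[OF s(2) s(1)] by (simp add: power2_eq_square)
  then have "- 2 * s \<le> ln (1 - s)"
    using ln_one_minus_pos_lower_bound[OF s] by linarith
  then show ?thesis using s by (simp add: ln_ge_iff)
qed

lemma multiplicative_growth:
  fixes a s :: "nat \<Rightarrow> real"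
  assumes "\<And>k. k < n \<Longrightarrow> \<bar>a (Suc k) - a k\<bar> \<le> s k * a k"
    and s: "\<And>k. 0 \<le> s k" "\<And>k. s k \<le> 1 / 2" and "0 \<le> a 0"
  shows "a n \<le> exp (\<Sum>k<n. s k) * a 0" "exp (- 2 * (\<Sum>k<n. s k)) * a 0 \<le> a n"
proof -
  have "0 \<le> a n \<and> a n \<le> exp (\<Sum>k<n. s k) * a 0 \<and> exp (- 2 * (\<Sum>k<n. s k)) * a 0 \<le> a n"
    using assms(1)
  proof (induction n)
    case (Suc n)
    have IH: "0 \<le> a n" "a n \<le> exp (\<Sum>k<n. s k) * a 0" "exp (- 2 * (\<Sum>k<n. s k)) * a 0 \<le> a n"
      using Suc by auto
    have st: "\<bar>a (Suc n) - a n\<bar> \<le> s n * a n" using Suc.prems by blast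
    have "a (Suc n) \<le> (1 + s n) * a n" using st by (simp add: algebra_simps)
    also have "\<dots> \<le> exp (s n) * (exp (\<Sum>k<n. s k) * a 0)"
      using IH s by (intro mult_mono exp_ge_add_one_self) auto
    finally have 1: "a (Suc n) \<le> exp (\<Sum>k<Suc n. s k) * a 0"
      by (simp add: exp_add algebra_simps)
    have "0 \<le> 1 - s n" using s(2)[of n] by linarith
    then have "exp (- 2 * s n) * (exp (- 2 * (\<Sum>k<n. s k)) * a 0) \<le> (1 - s n) * a n"
      using assms(4) by (intro mult_mono[OF exp_le_one_minus[OF s] IH(3)]) auto
    also have "\<dots> \<le> a (Suc n)" using st by (simp add: algebra_simps abs_le_iff)
    finally have 2: "exp (- 2 * (\<Sum>k<Suc n. s k)) * a 0 \<le> a (Suc n)"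
      by (simp add: exp_add[symmetric] distrib_left mult.assoc[symmetric] add.commute)
    have "0 \<le> exp (- 2 * (\<Sum>k<Suc n. s k)) * a 0" using assms(4) by simp
    then have "0 \<le> a (Suc n)" using 2 by linarith
    with 1 2 show ?case by blast
  qed (use assms(4) in auto)
  then show "a n \<le> exp (\<Sum>k<n. s k) * a 0" "exp (- 2 * (\<Sum>k<n. s k)) * a 0 \<le> a n" by auto
qed

lemma discrete_gronwall:
  fixes a s b :: "nat \<Rightarrow> real"
  assumes "\<And>k. k < n \<Longrightarrow> a (Suc k) \<le> (1 + s k) * a k + b k"
    and s: "\<And>k. 0 \<le> s k" and a: "\<And>k. 0 \<le> a k" and b: "\<And>k. 0 \<le> b k"
  shows "a n \<le> exp (\<Sum>k<n. s k) * (a 0 + (\<Sum>k<n. b k))"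
  using assms(1)
proof (induction n)
  case (Suc n)
  have "a (Suc n) \<le> (1 + s n) * a n + b n" using Suc.prems by blast
  also have "\<dots> \<le> exp (s n) * (exp (\<Sum>k<n. s k) * (a 0 + (\<Sum>k<n. b k)))
      + exp (\<Sum>k<Suc n. s k) * b n"
  proof (rule add_mono)
    show "(1 + s n) * a n \<le> exp (s n) * (exp (\<Sum>k<n. s k) * (a 0 + (\<Sum>k<n. b k)))"
      using Suc s a b by (intro mult_mono exp_ge_add_one_self) auto
    have "1 * b n \<le> exp (\<Sum>k<Suc n. s k) * b n"
      using s b by (intro mult_right_mono) (auto simp: sum_nonneg simp del: sum.lessThan_Suc)
    then show "b n \<le> exp (\<Sum>k<Suc n. s k) * b n" by simp
  qed
  also have "\<dots> = exp (\<Sum>k<Suc n. s k) * (a 0 + (\<Sum>k<Suc n. b k))"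
    by (simp add: exp_add algebra_simps)
  finally show ?case .
qed simp

text \<open>The factor by which \<open>r\<^sub>k\<^sup>\<alpha>\<close> decreases from one generation to the next.\<close>

definition ratio :: "real \<Rightarrow> real" where
  "ratio \<alpha> = (1 / 10) powr \<alpha>"

lemma rad_powr: "rad k powr \<alpha> = ratio \<alpha> ^ k"
proof -
  have "rad k powr \<alpha> = ((1 / 10) powr real k) powr \<alpha>"
    by (simp add: rad_def powr_realpow)
  also have "\<dots> = ((1 / 10) powr \<alpha>) powr real k"
    by (simp add: powr_powr mult.commute)
  also have "\<dots> = ratio \<alpha> ^ k"
    by (simp add: ratio_def powr_realpow)
  finally show ?thesis .
qed

lemma ratio_bounds:
  assumes "0 < \<alpha>" "\<alpha> < 1"
  shows "0 < ratio \<alpha>" "ratio \<alpha> < 1" "1 < 10 * ratio \<alpha>"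
proof -
  show "0 < ratio \<alpha>" by (simp add: ratio_def)
  have "(1 / 10 :: real) powr \<alpha> < (1 / 10) powr 0"
    using assms by (intro powr_less_mono') auto
  then show "ratio \<alpha> < 1" by (simp add: ratio_def)
  have "(1 / 10) powr 1 < (1 / 10 :: real) powr \<alpha>"
    using assms by (intro powr_less_mono') auto
  then show "1 < 10 * ratio \<alpha>" by (simp add: ratio_def)
qed

text \<open>The constants depend only on \<open>B = N A\<close>, on the factor \<open>Q\<close> in \<open>lam k \<le> Q r\<^sub>k\<^sup>\<alpha>\<close>, and on \<open>\<alpha>\<close>. The
exponents bound the sum of the relative changes \<open>385 B\<^sup>2 lam k\<close> over all generations. The factor \<open>1/2\<close> in
\<open>expansion\<close> allows for the steps after a pair of points has separated.\<close>

definition stretch :: "real \<Rightarrow> real \<Rightarrow> real \<Rightarrow> real" where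
  "stretch B Q \<alpha> = exp (385 * B\<^sup>2 * Q / (1 - ratio \<alpha>))"

definition expansion :: "real \<Rightarrow> real \<Rightarrow> real \<Rightarrow> real" where
  "expansion B Q \<alpha> = exp (- 2 * (385 * B\<^sup>2 * Q / (1 - ratio \<alpha>))) / 2"

text \<open>The factor of \<open>r\<^sub>n\<^sup>\<alpha>\<close> in the distance between \<open>Df\<^sub>n\<close> and its limit.\<close>

definition tail :: "real \<Rightarrow> real \<Rightarrow> real \<Rightarrow> real" where
  "tail B Q \<alpha> = 385 * B\<^sup>2 * Q * stretch B Q \<alpha> / (1 - ratio \<alpha>)"

lemma line_has_vector_derivative:
  fixes f :: "'a::real_normed_vector \<Rightarrow> 'b::real_normed_vector"
  assumes f: "(f has_derivative G) (at z within S)" and S: "\<And>t. z + t *\<^sub>R v \<in> S"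
  shows "((\<lambda>t. f (z + t *\<^sub>R v)) has_vector_derivative G v) (at 0)"
proof -
  have "((\<lambda>t. z + t *\<^sub>R v) has_derivative (\<lambda>t. t *\<^sub>R v)) (at 0)"
    by (auto intro!: derivative_eq_intros)
  moreover have "(f has_derivative G) (at (z + 0 *\<^sub>R v) within range (\<lambda>t. z + t *\<^sub>R v))"
    using S by (auto intro: has_derivative_subset[OF f])
  ultimately have "((\<lambda>t. f (z + t *\<^sub>R v)) has_derivative (\<lambda>t. G (t *\<^sub>R v))) (at 0)"
    by (rule has_derivative_in_compose)
  then show ?thesis
    by (simp add: has_vector_derivative_def linear_scale[OF has_derivative_linear[OF f]])
qed

lemma has_derivative_secant:
  fixes f :: "'a::real_normed_vector \<Rightarrow> 'b::real_normed_vector"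
  assumes f: "(f has_derivative G) (at z within S)" and S: "\<And>t. z + t *\<^sub>R v \<in> S"
  shows "((\<lambda>t. (1 / t) *\<^sub>R (f (z + t *\<^sub>R v) - f z)) \<longlongrightarrow> G v) (at_right 0)"
proof -
  let ?\<phi> = "\<lambda>t. f (z + t *\<^sub>R v)"
  have "(\<lambda>h. norm (?\<phi> (0 + h) - ?\<phi> 0 - h *\<^sub>R G v) / norm h) \<midarrow>0\<rightarrow> 0"
    using line_has_vector_derivative[OF assms] unfolding has_vector_derivative_def has_derivative_at by blast
  then have "((\<lambda>h. norm (?\<phi> h - f z - h *\<^sub>R G v) / norm h) \<longlongrightarrow> 0) (at_right 0)"
    by (simp add: filterlim_at_split)
  moreover have "\<forall>\<^sub>F h in at_right (0::real). norm (?\<phi> h - f z - h *\<^sub>R G v) / norm h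
      = norm ((1 / h) *\<^sub>R (?\<phi> h - f z) - G v)"
    using eventually_at_right_less[of "0::real"]
  proof eventually_elim
    fix h :: real assume h: "0 < h"
    then have "(1 / h) *\<^sub>R (?\<phi> h - f z) - G v = (1 / h) *\<^sub>R (?\<phi> h - f z - h *\<^sub>R G v)"
      by (simp add: scaleR_diff_right)
    then show "norm (?\<phi> h - f z - h *\<^sub>R G v) / norm h = norm ((1 / h) *\<^sub>R (?\<phi> h - f z) - G v)"
      using h by (simp only: norm_scaleR) simp
  qed
  ultimately have "((\<lambda>h. norm ((1 / h) *\<^sub>R (?\<phi> h - f z) - G v)) \<longlongrightarrow> 0) (at_right 0)"
    by (rule Lim_transform_eventually)
  then show ?thesis
    by (rule LIM_zero_cancel[OF tendsto_norm_zero_cancel])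
qed

section \<open>The limit map\<close>

locale holder_tower = tower +
  fixes \<alpha> Q :: real
  assumes alpha: "0 < \<alpha>" "\<alpha> < 1" and Q_nonneg: "0 \<le> Q"
    and lam_decay: "lam k \<le> Q * rad k powr \<alpha>"
begin

abbreviation "q \<equiv> ratio \<alpha>"
abbreviation "S \<equiv> stretch B Q \<alpha>"
abbreviation "D \<equiv> david_toro J P \<theta> \<psi>"

lemmas q_bounds = ratio_bounds[OF alpha]

lemma step_small: "0 \<le> 385 * B\<^sup>2 * lam k" "385 * B\<^sup>2 * lam k \<le> 1 / 2"
proof -
  show "0 \<le> 385 * B\<^sup>2 * lam k" using lam_nonneg[of k] by simp
  then show "385 * B\<^sup>2 * lam k \<le> 1 / 2"
    using lam_small[of k] unfolding B_def[symmetric] by linarith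
qed

lemma sum_steps_le: "(\<Sum>k<n. 385 * B\<^sup>2 * lam k) \<le> 385 * B\<^sup>2 * Q / (1 - q)"
proof -
  have "(\<Sum>k<n. lam k) \<le> (\<Sum>k<n. Q * q ^ k)"
    using lam_decay by (intro sum_mono) (simp add: rad_powr)
  also have "\<dots> = Q * ((1 - q ^ n) / (1 - q))"
    using q_bounds by (simp add: sum_distrib_left[symmetric] sum_gp_strict)
  also have "\<dots> \<le> Q * (1 / (1 - q))"
    using q_bounds Q_nonneg by (intro mult_left_mono divide_right_mono) auto
  finally have "385 * B\<^sup>2 * (\<Sum>k<n. lam k) \<le> 385 * B\<^sup>2 * (Q * (1 / (1 - q)))"
    by (intro mult_left_mono) auto
  then show ?thesis by (simp add: sum_distrib_left)
qed

lemma exp_steps_le: "exp (\<Sum>k<n. 385 * B\<^sup>2 * lam k) \<le> S"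
  and exp_steps_ge: "2 * expansion B Q \<alpha> \<le> exp (- 2 * (\<Sum>k<n. 385 * B\<^sup>2 * lam k))"
proof -
  show "exp (\<Sum>k<n. 385 * B\<^sup>2 * lam k) \<le> S"
    unfolding stretch_def exp_le_cancel_iff by (rule sum_steps_le)
  have "2 * expansion B Q \<alpha> = exp (- 2 * (385 * B\<^sup>2 * Q / (1 - q)))"
    by (simp only: expansion_def)
  then show "2 * expansion B Q \<alpha> \<le> exp (- 2 * (\<Sum>k<n. 385 * B\<^sup>2 * lam k))"
    using sum_steps_le[of n] by (simp only: exp_le_cancel_iff)
qed

lemma S_ge_1: "1 \<le> S"
proof -
  have "0 \<le> 385 * B\<^sup>2 * Q / (1 - q)"
    using q_bounds Q_nonneg by (intro divide_nonneg_pos mult_nonneg_nonneg) auto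
  then show ?thesis unfolding stretch_def one_le_exp_iff .
qed

lemma expansion_pos: "0 < expansion B Q \<alpha>"
  by (simp add: expansion_def)

lemma increment_growth:
  assumes z: "z \<in> \<Sigma>\<^sub>0" "z' \<in> \<Sigma>\<^sub>0" and c: "\<And>k. k < n \<Longrightarrow> norm (F k z - F k z') \<le> rad k"
  shows "norm (F n z - F n z') \<le> S * norm (z - z')"
    and "2 * expansion B Q \<alpha> * norm (z - z') \<le> norm (F n z - F n z')"
proof -
  have "\<bar>norm (F (Suc k) z - F (Suc k) z') - norm (F k z - F k z')\<bar>
      \<le> 385 * B\<^sup>2 * lam k * norm (F k z - F k z')" if "k < n" for k
    using increment_step[OF z c[OF that]] norm_triangle_ineq3 order_trans by blast
  then have "norm (F n z - F n z') \<le> exp (\<Sum>k<n. 385 * B\<^sup>2 * lam k) * norm (F 0 z - F 0 z') \<and>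
      exp (- 2 * (\<Sum>k<n. 385 * B\<^sup>2 * lam k)) * norm (F 0 z - F 0 z') \<le> norm (F n z - F n z')"
    using step_small by (intro conjI multiplicative_growth[where a = "\<lambda>k. norm (F k z - F k z')"]) auto
  then show "norm (F n z - F n z') \<le> S * norm (z - z')"
    and "2 * expansion B Q \<alpha> * norm (z - z') \<le> norm (F n z - F n z')"
    using mult_right_mono[OF exp_steps_le[of n], of "norm (z - z')"]
      mult_right_mono[OF exp_steps_ge[of n], of "norm (z - z')"] by auto
qed

text \<open>The steps after generation \<open>k\<close> have length at most \<open>rad l / 20\<close>, and \<open>1/20 + 1/200 + \<dots> = 1/18\<close>.\<close>

lemma iterates_close:
  assumes z: "z \<in> \<Sigma>\<^sub>0"
  shows "norm (F (k + i) z - F k z) \<le> (rad k - rad (k + i)) / 18"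
proof (induction i)
  case (Suc i)
  have "norm (F (k + Suc i) z - F k z)
      \<le> norm (F (Suc (k + i)) z - F (k + i) z) + norm (F (k + i) z - F k z)"
    by (simp, norm)
  then show ?case
    using Suc move_small[OF z, of "k + i"] by (simp add: rad_Suc field_simps)
qed simp

lemma rad_tendsto_0: "rad \<longlonglongrightarrow> 0"
  unfolding rad_def by (intro LIMSEQ_power_zero) auto

lemma F_tendsto:
  assumes z: "z \<in> \<Sigma>\<^sub>0"
  shows "(\<lambda>k. F k z) \<longlonglongrightarrow> D z"
proof -
  have "Cauchy (\<lambda>k. F k z)"
  proof (rule CauchyI')
    fix e :: real assume "0 < e"
    then obtain k where k: "rad k < e"
      using order_tendstoD(2)[OF rad_tendsto_0] by (metis eventually_sequentially order_refl)
    have "norm (F m z - F n z) < e" if "m \<ge> k" "n > m" for m n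
    proof -
      obtain i where "n = m + i" using \<open>n > m\<close> less_imp_add_positive by blast
      moreover have "rad m \<le> rad k" unfolding rad_def using that by (intro power_decreasing) auto
      ultimately show ?thesis
        using iterates_close[OF z, of m i] k rad_pos[of m] rad_pos[of "m + i"]
        by (simp add: norm_minus_commute)
    qed
    then show "\<exists>M. \<forall>m\<ge>M. \<forall>n>m. dist (F m z) (F n z) < e" unfolding dist_norm by blast
  qed
  then show ?thesis
    unfolding david_toro_def using Cauchy_convergent convergent_LIMSEQ_iff[THEN iffD1] by blast
qed

lemma D_close: 
  assumes z: "z \<in> \<Sigma>\<^sub>0"
  shows "norm (D z - F k z) \<le> rad k / 18"
proof -
  have lim: "(\<lambda>i. norm (F (i + k) z - F k z)) \<longlonglongrightarrow> norm (D z - F k z)"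
    by (intro tendsto_intros LIMSEQ_ignore_initial_segment F_tendsto z)
  moreover have "norm (F (i + k) z - F k z) \<le> rad k / 18" for i
    using iterates_close[OF z, of k i] rad_pos[of "k + i"] by (simp add: add.commute)
  ultimately show ?thesis
    using LIMSEQ_le_const2[OF lim] by blast
qed

text \<open>A pair is followed up to the first generation \<open>n\<close> in which its distance exceeds \<open>rad n\<close>. Until then its
distance has changed by a bounded factor, and afterwards it changes by at most \<open>rad n / 9\<close>. Such an \<open>n\<close>
exists since otherwise the distances would tend to \<open>0\<close> and yet be bounded below.\<close>

lemma D_expanding:
  assumes z: "z \<in> \<Sigma>\<^sub>0" "z' \<in> \<Sigma>\<^sub>0"
  shows "expansion B Q \<alpha> * norm (z - z') \<le> norm (D z - D z')"
proof (cases "z = z'")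
  case False
  have "\<exists>n. rad n < norm (F n z - F n z')"
  proof (rule ccontr)
    assume "\<not> ?thesis"
    then have le: "norm (F n z - F n z') \<le> rad n" for n by (simp add: not_less)
    have "2 * expansion B Q \<alpha> * norm (z - z') \<le> rad n" for n
      using increment_growth(2)[OF z le, of n] le[of n] by linarith
    then have "2 * expansion B Q \<alpha> * norm (z - z') \<le> 0"
      using LIMSEQ_le_const[OF rad_tendsto_0] by blast
    then show False
      using False expansion_pos by (simp add: mult_le_0_iff)
  qed
  then obtain n where n: "rad n < norm (F n z - F n z')" "\<And>k. k < n \<Longrightarrow> norm (F k z - F k z') \<le> rad k"
    using exists_least_iff[of "\<lambda>n. rad n < norm (F n z - F n z')"] not_less by blast
  have "norm (F n z - F n z') \<le> norm (D z - D z') + norm (D z - F n z) + norm (D z' - F n z')"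
    by norm
  then have "norm (F n z - F n z') \<le> 2 * norm (D z - D z')"
    using D_close[OF z(1), of n] D_close[OF z(2), of n] n(1) norm_ge_zero[of "D z - D z'"]
    by linarith
  then show ?thesis
    using increment_growth(2)[OF z n(2), of n] by simp
qed simp

section \<open>Differentials of the iterates\<close>

definition \<sigma>' :: "nat \<Rightarrow> 'a \<Rightarrow> 'a \<Rightarrow> 'a" where
  "\<sigma>' k y u = u + ((\<Sum>j\<in>J k. \<theta> k j y *\<^sub>R (L k j u - u)) + (\<Sum>j\<in>J k. \<theta>' k j y u *\<^sub>R (\<pi> k j y - y)))"

primrec F' :: "nat \<Rightarrow> 'a \<Rightarrow> 'a \<Rightarrow> 'a" where
  "F' 0 z = (\<lambda>u. u)"
| "F' (Suc k) z = (\<lambda>u. \<sigma>' k (F k z) (F' k z u))"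

lemma sigma_has_derivative: "(sigma J P \<theta> \<psi> k has_derivative \<sigma>' k y) (at y)"
proof -
  have "((\<lambda>y. \<theta> k j y *\<^sub>R (\<pi> k j y - y)) has_derivative
      (\<lambda>u. \<theta> k j y *\<^sub>R (L k j u - u) + \<theta>' k j y u *\<^sub>R (\<pi> k j y - y))) (at y)"
    if j: "j \<in> J k" for j
    by (intro has_derivative_scaleR has_derivative_diff theta_deriv[OF j]
        closest_point_has_derivative plane[OF j] has_derivative_ident)
  then have "((\<lambda>y. y + (\<Sum>j\<in>J k. \<theta> k j y *\<^sub>R (\<pi> k j y - y))) has_derivative
      (\<lambda>u. u + (\<Sum>j\<in>J k. \<theta> k j y *\<^sub>R (L k j u - u) + \<theta>' k j y u *\<^sub>R (\<pi> k j y - y)))) (at y)"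
    by (intro has_derivative_add has_derivative_sum has_derivative_ident)
  moreover have "sigma J P \<theta> \<psi> k = (\<lambda>y. y + (\<Sum>j\<in>J k. \<theta> k j y *\<^sub>R (\<pi> k j y - y)))"
    using sigma_eq by blast
  moreover have "\<sigma>' k y = (\<lambda>u. u + (\<Sum>j\<in>J k. \<theta> k j y *\<^sub>R (L k j u - u) + \<theta>' k j y u *\<^sub>R (\<pi> k j y - y)))"
    by (simp add: \<sigma>'_def fun_eq_iff sum.distrib)
  ultimately show ?thesis by (simp only:)
qed

lemma F_has_derivative: "(F k has_derivative F' k z) (at z)"
proof (induction k)
  case 0
  have "F 0 = (\<lambda>u. u)" "F' 0 z = (\<lambda>u. u)" by auto
  then show ?case by (simp only: has_derivative_ident)
next
  case (Suc k)
  have "(sigma J P \<theta> \<psi> k \<circ> F k has_derivative \<sigma>' k (F k z) \<circ> F' k z) (at z)"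
    by (rule diff_chain_at[OF Suc sigma_has_derivative])
  then show ?case by (simp add: dt_iter.simps(2) comp_def)
qed

lemma sigma'_linear: "linear (\<sigma>' k y)"
  by (rule has_derivative_linear[OF sigma_has_derivative])

lemma secant_tendsto:
  "((\<lambda>t. (1 / t) *\<^sub>R (F k (z + t *\<^sub>R v) - F k z)) \<longlongrightarrow> F' k z v) (at_right 0)"
  by (rule has_derivative_secant[OF F_has_derivative]) (rule UNIV_I)

lemma eventually_close:
  assumes "0 < e"
  shows "\<forall>\<^sub>F t in at_right 0. norm (F k (z + t *\<^sub>R v) - F k z) < e"
proof -
  have "isCont (F k) z"
    by (rule has_derivative_continuous[OF F_has_derivative])
  then have "((\<lambda>t. F k (z + t *\<^sub>R v)) \<longlongrightarrow> F k z) (at_right 0)"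
  proof (rule isCont_tendsto_compose)
    have "((\<lambda>t. z + t *\<^sub>R v) \<longlongrightarrow> z + 0 *\<^sub>R v) (at_right 0)"
      by (intro tendsto_intros)
    then show "((\<lambda>t. z + t *\<^sub>R v) \<longlongrightarrow> z) (at_right 0)" by simp
  qed
  then show ?thesis
    using assms by (simp add: tendsto_iff dist_norm)
qed

lemma plane_line: "z \<in> \<Sigma>\<^sub>0 \<Longrightarrow> v \<in> plane_directions \<Sigma>\<^sub>0 \<Longrightarrow> z + t *\<^sub>R v \<in> \<Sigma>\<^sub>0"
  using plane_add_direction base_plane by blast

text \<open>Tangent vectors inherit the estimates for secants by a limit. The strict inequality leaves room for the
second end of the secant.\<close>

lemma tangent_near_plane:
  assumes z: "z\<^sub>0 \<in> \<Sigma>\<^sub>0" "z \<in> \<Sigma>\<^sub>0" and j: "j \<in> J k" "F k z\<^sub>0 \<in> ball (x k j) (10 * rad k)"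
    and c: "norm (F k z - F k z\<^sub>0) < rad k" and v: "v \<in> plane_directions \<Sigma>\<^sub>0"
  shows "norm (L k j (F' k z v) - F' k z v) \<le> 61 * B * lam k * norm (F' k z v)"
proof -
  let ?s = "\<lambda>t. (1 / t) *\<^sub>R (F k (z + t *\<^sub>R v) - F k z)"
  note Lj = lproj_linear[OF plane[OF j(1)]]
  have Ls: "((\<lambda>t. L k j (?s t)) \<longlongrightarrow> L k j (F' k z v)) (at_right 0)"
    using Lj unfolding linear_conv_bounded_linear by (rule bounded_linear.tendsto[OF _ secant_tendsto])
  have gap: "0 < rad k - norm (F k z - F k z\<^sub>0)" using c by simp
  have ev: "\<forall>\<^sub>F t in at_right 0. norm (L k j (?s t) - ?s t) \<le> 61 * B * lam k * norm (?s t)"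
    using eventually_close[OF gap, of k z v] eventually_at_right_less[of "0::real"]
  proof eventually_elim
    fix t :: real
    let ?w = "F k (z + t *\<^sub>R v) - F k z"
    assume t: "norm ?w < rad k - norm (F k z - F k z\<^sub>0)" "0 < t"
    have "norm (F k (z + t *\<^sub>R v) - F k z\<^sub>0) \<le> norm ?w + norm (F k z - F k z\<^sub>0)" by norm
    then have "norm (L k j ?w - ?w) \<le> 61 * B * lam k * norm ?w"
      using t c by (intro secant_near_plane[OF z(1) plane_line[OF z(2) v] z(2) j]) auto
    moreover have "L k j (?s t) - ?s t = (1 / t) *\<^sub>R (L k j ?w - ?w)"
      by (simp only: linear_scale[OF Lj] scaleR_diff_right[of _ "L k j ?w"])
    ultimately show "norm (L k j (?s t) - ?s t) \<le> 61 * B * lam k * norm (?s t)"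
      using t(2) by (simp add: divide_right_mono del: scaleR_diff_right)
  qed
  show ?thesis
    by (rule tendsto_le[OF _ _ _ ev]) (intro tendsto_intros Ls secant_tendsto trivial_limit_at_right_real)+
qed

lemma tangent_step:
  assumes z: "z \<in> \<Sigma>\<^sub>0" and v: "v \<in> plane_directions \<Sigma>\<^sub>0"
  shows "norm (F' (Suc k) z v - F' k z v) \<le> 385 * B\<^sup>2 * lam k * norm (F' k z v)"
proof -
  let ?s = "\<lambda>k t. (1 / t) *\<^sub>R (F k (z + t *\<^sub>R v) - F k z)"
  have ev: "\<forall>\<^sub>F t in at_right 0. norm (?s (Suc k) t - ?s k t) \<le> 385 * B\<^sup>2 * lam k * norm (?s k t)"
    using eventually_close[OF rad_pos[of k], of k z v] eventually_at_right_less[of "0::real"]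
  proof eventually_elim
    fix t :: real
    assume t: "norm (F k (z + t *\<^sub>R v) - F k z) < rad k" "0 < t"
    have "?s (Suc k) t - ?s k t = (1 / t) *\<^sub>R ((F (Suc k) (z + t *\<^sub>R v) - F (Suc k) z) - (F k (z + t *\<^sub>R v) - F k z))"
      by (simp only: scaleR_diff_right)
    then show "norm (?s (Suc k) t - ?s k t) \<le> 385 * B\<^sup>2 * lam k * norm (?s k t)"
      using increment_step[OF plane_line[OF z v] z less_imp_le[OF t(1)]] t(2)
      by (simp add: divide_right_mono del: scaleR_diff_right)
  qed
  show ?thesis
    by (rule tendsto_le[OF _ _ _ ev]) (intro tendsto_intros secant_tendsto trivial_limit_at_right_real)+
qed

lemma tangent_norm_le:
  assumes z: "z \<in> \<Sigma>\<^sub>0" and v: "v \<in> plane_directions \<Sigma>\<^sub>0"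
  shows "norm (F' n z v) \<le> S * norm v"
proof -
  have "\<bar>norm (F' (Suc k) z v) - norm (F' k z v)\<bar> \<le> 385 * B\<^sup>2 * lam k * norm (F' k z v)" for k
    using tangent_step[OF z v] norm_triangle_ineq3 order_trans by blast
  then have "norm (F' n z v) \<le> exp (\<Sum>k<n. 385 * B\<^sup>2 * lam k) * norm (F' 0 z v)"
    using step_small by (intro multiplicative_growth[where a = "\<lambda>k. norm (F' k z v)"]) auto
  also have "\<dots> \<le> S * norm v"
    using exp_steps_le by (simp add: mult_right_mono)
  finally show ?thesis .
qed

lemma tangent_tail:
  assumes z: "z \<in> \<Sigma>\<^sub>0" and v: "v \<in> plane_directions \<Sigma>\<^sub>0"
  shows "norm (F' (n + i) z v - F' n z v) \<le> tail B Q \<alpha> * (q ^ n - q ^ (n + i)) * norm v"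
proof (induction i)
  case (Suc i)
  let ?m = "n + i"
  have "norm (F' (Suc ?m) z v - F' ?m z v) \<le> 385 * B\<^sup>2 * lam ?m * norm (F' ?m z v)"
    by (rule tangent_step[OF z v])
  also have "\<dots> \<le> 385 * B\<^sup>2 * (Q * q ^ ?m) * (S * norm v)"
    using lam_decay[of ?m] tangent_norm_le[OF z v, of ?m] lam_nonneg[of ?m] Q_nonneg q_bounds
    by (intro mult_mono) (auto simp: rad_powr)
  also have "\<dots> = tail B Q \<alpha> * (q ^ ?m - q ^ Suc ?m) * norm v"
    using q_bounds by (simp add: tail_def field_simps)
  finally have "norm (F' (Suc ?m) z v - F' ?m z v) \<le> tail B Q \<alpha> * (q ^ ?m - q ^ Suc ?m) * norm v" .
  moreover have "norm (F' (Suc ?m) z v - F' n z v) \<le> norm (F' (Suc ?m) z v - F' ?m z v) + norm (F' ?m z v - F' n z v)"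
    by norm
  ultimately show ?case
    using Suc by (simp add: algebra_simps)
qed simp

lemma tail_nonneg: "0 \<le> tail B Q \<alpha>"
  using q_bounds Q_nonneg S_ge_1 by (simp add: tail_def)

text \<open>The differential of the limit map. The differentials of the iterates are compared on directions of
\<open>\<Sigma>\<^sub>0\<close>, so their limit is composed with the projection onto these.\<close>

definition G :: "'a \<Rightarrow> 'a \<Rightarrow> 'a" where
  "G z u = lim (\<lambda>n. F' n z (lproj \<Sigma>\<^sub>0 u))"

lemma lproj_base: "lproj \<Sigma>\<^sub>0 u \<in> plane_directions \<Sigma>\<^sub>0"
  by (rule lproj_mem[OF base_plane])

lemma F'_tendsto:
  assumes z: "z \<in> \<Sigma>\<^sub>0"
  shows "(\<lambda>n. F' n z (lproj \<Sigma>\<^sub>0 u)) \<longlonglongrightarrow> G z u"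
proof -
  let ?v = "lproj \<Sigma>\<^sub>0 u"
  have q0: "(\<lambda>n. tail B Q \<alpha> * q ^ n * norm ?v) \<longlonglongrightarrow> 0"
    using q_bounds by (intro tendsto_mult_left_zero tendsto_mult_right_zero LIMSEQ_power_zero) auto
  have "Cauchy (\<lambda>n. F' n z ?v)"
  proof (rule CauchyI')
    fix e :: real assume "0 < e"
    then obtain M where M: "\<And>n. n \<ge> M \<Longrightarrow> tail B Q \<alpha> * q ^ n * norm ?v < e"
      using order_tendstoD(2)[OF q0] by (metis eventually_sequentially)
    have "norm (F' m z ?v - F' n z ?v) < e" if mn: "m \<ge> M" "n > m" for m n
    proof -
      obtain i where i: "n = m + i" using \<open>n > m\<close> less_imp_add_positive by blast
      have "tail B Q \<alpha> * (q ^ m - q ^ (m + i)) * norm ?v \<le> tail B Q \<alpha> * q ^ m * norm ?v"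
        using q_bounds tail_nonneg by (intro mult_right_mono mult_left_mono) auto
      then show ?thesis
        using tangent_tail[OF z lproj_base, of m i u] M[OF mn(1)] unfolding i
        by (simp add: norm_minus_commute)
    qed
    then show "\<exists>M. \<forall>m\<ge>M. \<forall>n>m. dist (F' m z ?v) (F' n z ?v) < e" unfolding dist_norm by blast
  qed
  then show ?thesis
    unfolding G_def using Cauchy_convergent convergent_LIMSEQ_iff[THEN iffD1] by blast
qed

lemma G_close:
  assumes z: "z \<in> \<Sigma>\<^sub>0"
  shows "norm (F' n z (lproj \<Sigma>\<^sub>0 u) - G z u) \<le> tail B Q \<alpha> * q ^ n * norm u"
proof -
  let ?v = "lproj \<Sigma>\<^sub>0 u"
  have lim: "(\<lambda>i. norm (F' n z ?v - F' (i + n) z ?v)) \<longlonglongrightarrow> norm (F' n z ?v - G z u)"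
    by (intro tendsto_intros LIMSEQ_ignore_initial_segment F'_tendsto z)
  moreover have "norm (F' n z ?v - F' (i + n) z ?v) \<le> tail B Q \<alpha> * q ^ n * norm u" for i
  proof -
    have "tail B Q \<alpha> * (q ^ n - q ^ (n + i)) * norm ?v \<le> tail B Q \<alpha> * q ^ n * norm u"
      using q_bounds tail_nonneg norm_lproj_le[OF base_plane, of u]
      by (intro mult_mono) (auto intro!: mult_nonneg_nonneg power_decreasing)
    then show ?thesis
      using tangent_tail[OF z lproj_base, of n i u] by (simp add: norm_minus_commute add.commute)
  qed
  ultimately show ?thesis
    using LIMSEQ_le_const2[OF lim] by blast
qed

text \<open>The theorem on uniform limits of differentials asks for linear maps on the whole space; composing the iterates with
the projection onto \<open>\<Sigma>\<^sub>0\<close> provides them without changing the iterates on \<open>\<Sigma>\<^sub>0\<close>.\<close>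

lemma D_has_derivative:
  assumes z: "z \<in> \<Sigma>\<^sub>0"
  shows "(D has_derivative G z) (at z within \<Sigma>\<^sub>0)"
proof -
  have der: "(F n has_derivative (\<lambda>u. F' n z (lproj \<Sigma>\<^sub>0 u))) (at z within \<Sigma>\<^sub>0)" if z: "z \<in> \<Sigma>\<^sub>0" for n z
  proof -
    have zz: "closest_point \<Sigma>\<^sub>0 z = z" using z by (rule closest_point_self)
    have "(F n has_derivative F' n z) (at (closest_point \<Sigma>\<^sub>0 z))"
      using F_has_derivative zz by simp
    then have "((\<lambda>z. F n (closest_point \<Sigma>\<^sub>0 z)) has_derivative (\<lambda>u. F' n z (lproj \<Sigma>\<^sub>0 u))) (at z within \<Sigma>\<^sub>0)"
      by (rule has_derivative_compose[OF closest_point_has_derivative[OF base_plane]])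
    then show ?thesis
      by (rule has_derivative_transform[OF z, rotated]) (simp add: closest_point_self)
  qed
  have "\<exists>g. \<forall>z\<in>\<Sigma>\<^sub>0. (\<lambda>n. F n z) \<longlonglongrightarrow> g z \<and> (g has_derivative G z) (at z within \<Sigma>\<^sub>0)"
  proof (rule has_derivative_sequence[OF affine_imp_convex[OF base_plane(1)] der _ z F_tendsto[OF z]])
    fix e :: real assume "0 < e"
    have "(\<lambda>n. tail B Q \<alpha> * q ^ n) \<longlonglongrightarrow> 0"
      using q_bounds by (intro tendsto_mult_right_zero LIMSEQ_power_zero) auto
    then have "\<forall>\<^sub>F n in sequentially. tail B Q \<alpha> * q ^ n < e"
      using \<open>0 < e\<close> order_tendstoD(2) by blast
    then show "\<forall>\<^sub>F n in sequentially. \<forall>z\<in>\<Sigma>\<^sub>0. \<forall>h. norm (F' n z (lproj \<Sigma>\<^sub>0 h) - G z h) \<le> e * norm h"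
    proof eventually_elim
      case (elim n)
      then show ?case
        using G_close[of _ n] mult_right_mono[OF less_imp_le[OF elim] norm_ge_zero] order_trans by blast
    qed
  qed
  then obtain g where g: "\<And>z. z \<in> \<Sigma>\<^sub>0 \<Longrightarrow> (\<lambda>n. F n z) \<longlonglongrightarrow> g z"
      "\<And>z. z \<in> \<Sigma>\<^sub>0 \<Longrightarrow> (g has_derivative G z) (at z within \<Sigma>\<^sub>0)"
    by blast
  have "D z = g z" if "z \<in> \<Sigma>\<^sub>0" for z
    using LIMSEQ_unique[OF F_tendsto[OF that] g(1)[OF that]] .
  then show ?thesis
    using has_derivative_transform[OF z _ g(2)[OF z]] by blast
qed

end

section \<open>Hoelder continuity of the differential\<close>

text \<open>Here \<open>1521 = 3 * 507\<close>: the factor \<open>3 B\<close> comes from a single step in which the cut-off functions do not add up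
to \<open>1\<close>, and \<open>507 B\<^sup>2\<close> from the variation of one differential. The stretch factor enters through the secant,
the tangent vector and the Gronwall inequality.\<close>

definition variation :: "real \<Rightarrow> real \<Rightarrow> real \<Rightarrow> real" where
  "variation B Q \<alpha> = 1521 * B ^ 3 * (stretch B Q \<alpha>) ^ 3 * Q / (10 * ratio \<alpha> - 1)"

text \<open>The factor \<open>20\<close> relates the distance of two points to the generation at which they are compared.\<close>

definition holder_const :: "real \<Rightarrow> real \<Rightarrow> real \<Rightarrow> real" where
  "holder_const B Q \<alpha> =
     (2 * tail B Q \<alpha> + variation B Q \<alpha> + 2 * stretch B Q \<alpha>) * (20 * stretch B Q \<alpha>) powr \<alpha>"

context holder_tower
begin

text \<open>In each of the three terms of the difference, one factor is the variation of a cut-off function or of its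
derivative, or a derivative itself, and the other is small by nearness to the planes: of the tangent
vector, of the point, and of the secant, respectively.\<close>

lemma sigma'_variation:
  assumes z: "z \<in> \<Sigma>\<^sub>0" "z' \<in> \<Sigma>\<^sub>0" and c: "norm (F k z - F k z') < rad k"
    and v: "v \<in> plane_directions \<Sigma>\<^sub>0"
  shows "norm (\<sigma>' k (F k z) (F' k z' v) - \<sigma>' k (F k z') (F' k z' v))
    \<le> 507 * B\<^sup>2 * (lam k / rad k) * norm (F k z - F k z') * norm (F' k z' v)"
proof -
  let ?y = "F k z" and ?y' = "F k z'" and ?u = "F' k z' v"
  let ?w = "?y - ?y'"
  have nn: "0 \<le> B" "0 \<le> lam k" using B_ge_1 lam_nonneg by auto
  have c': "norm (?y' - ?y) < rad k" using c by (simp add: norm_minus_commute)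
  have eq: "\<sigma>' k ?y ?u - \<sigma>' k ?y' ?u =
      (\<Sum>j\<in>J k. (\<theta> k j ?y - \<theta> k j ?y') *\<^sub>R (L k j ?u - ?u))
    + (\<Sum>j\<in>J k. (\<theta>' k j ?y ?u - \<theta>' k j ?y' ?u) *\<^sub>R (\<pi> k j ?y - ?y))
    + (\<Sum>j\<in>J k. \<theta>' k j ?y' ?u *\<^sub>R (L k j ?w - ?w))"
  proof -
    have Lw: "L k j ?w - ?w = (\<pi> k j ?y - ?y) - (\<pi> k j ?y' - ?y')" if "j \<in> J k" for j
      using closest_point_lproj_diff[OF plane[OF that], of ?y ?y'] by simp
    show ?thesis
      unfolding \<sigma>'_def sum.distrib[symmetric]
      by (simp add: Lw flip: sum_subtractf sum.distrib cong: sum.cong) (simp add: algebra_simps)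
  qed
  have 1: "norm (\<Sum>j\<in>J k. (\<theta> k j ?y - \<theta> k j ?y') *\<^sub>R (L k j ?u - ?u))
     \<le> 2 * N * (A / rad k * norm ?w * (61 * B * lam k * norm ?u))"
  proof (rule norm_sum_two_points[where y = ?y and y' = ?y'])
    fix j assume j: "j \<in> J k"
      and or: "?y \<in> ball (x k j) (10 * rad k) \<or> ?y' \<in> ball (x k j) (10 * rad k)"
    have "norm (L k j ?u - ?u) \<le> 61 * B * lam k * norm ?u"
      using or tangent_near_plane[OF z(1,2) j _ c' v] tangent_near_plane[OF z(2,2) j _ _ v] rad_pos[of k]
      by fastforce
    then show "norm ((\<theta> k j ?y - \<theta> k j ?y') *\<^sub>R (L k j ?u - ?u))
       \<le> A / rad k * norm ?w * (61 * B * lam k * norm ?u)"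
      using theta_lipschitz[OF j, of ?y ?y'] NA_nonneg
      unfolding norm_scaleR real_norm_def by (intro mult_mono) auto
  qed (use theta_outside nn NA_nonneg in auto)
  have 2: "norm (\<Sum>j\<in>J k. (\<theta>' k j ?y ?u - \<theta>' k j ?y' ?u) *\<^sub>R (\<pi> k j ?y - ?y))
     \<le> 2 * N * (A / (rad k)\<^sup>2 * norm ?w * norm ?u * (162 * B * lam k * rad k))"
  proof (rule norm_sum_two_points[where y = ?y and y' = ?y'])
    fix j assume j: "j \<in> J k"
      and or: "?y \<in> ball (x k j) (10 * rad k) \<or> ?y' \<in> ball (x k j) (10 * rad k)"
    have "norm (\<pi> k j ?y - ?y) \<le> 162 * B * lam k * rad k"
      using or near_plane_nearby[OF z(2,1) j] near_plane_nearby[OF z(1,1) j] c by fastforce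
    then show "norm ((\<theta>' k j ?y ?u - \<theta>' k j ?y' ?u) *\<^sub>R (\<pi> k j ?y - ?y))
       \<le> A / (rad k)\<^sup>2 * norm ?w * norm ?u * (162 * B * lam k * rad k)"
      using theta'_lipschitz[OF j, of ?y ?u ?y'] NA_nonneg
      unfolding norm_scaleR real_norm_def by (intro mult_mono) auto
  qed (use theta'_outside nn NA_nonneg in auto)
  have 3: "norm (\<Sum>j\<in>J k. \<theta>' k j ?y' ?u *\<^sub>R (L k j ?w - ?w))
     \<le> N * (A / rad k * norm ?u * (61 * B * lam k * norm ?w))"
  proof (rule norm_sum_one_point[where y = ?y'])
    fix j assume j: "j \<in> J k" "?y' \<in> ball (x k j) (10 * rad k)"
    have "norm (L k j ?w - ?w) \<le> 61 * B * lam k * norm ?w"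
      using c by (intro secant_near_plane[OF z(2,1,2) j]) auto
    then show "norm (\<theta>' k j ?y' ?u *\<^sub>R (L k j ?w - ?w)) \<le> A / rad k * norm ?u * (61 * B * lam k * norm ?w)"
      using theta'_le[OF j(1), of ?y' ?u] NA_nonneg
      unfolding norm_scaleR real_norm_def by (intro mult_mono) auto
  qed (use theta'_outside nn NA_nonneg in auto)
  have "2 * N * (A / rad k * norm ?w * (61 * B * lam k * norm ?u))
      + 2 * N * (A / (rad k)\<^sup>2 * norm ?w * norm ?u * (162 * B * lam k * rad k))
      + N * (A / rad k * norm ?u * (61 * B * lam k * norm ?w))
     = 507 * B\<^sup>2 * (lam k / rad k) * norm ?w * norm ?u"
    by (simp add: B_def power2_eq_square field_simps)
  then show ?thesis
    unfolding eq using norm_triangle_mono[OF norm_triangle_mono[OF 1 2] 3] by linarith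
qed

lemma gradient_term_le:
  assumes z: "z \<in> \<Sigma>\<^sub>0"
  shows "norm (\<Sum>j\<in>J k. \<theta>' k j (F k z) w *\<^sub>R (\<pi> k j (F k z) - F k z)) \<le> 101 * B * lam k * norm w"
proof -
  have "norm (\<Sum>j\<in>J k. \<theta>' k j (F k z) w *\<^sub>R (\<pi> k j (F k z) - F k z))
      \<le> N * (A / rad k * norm w * (101 * lam k * rad k))"
  proof (rule norm_sum_one_point[where y = "F k z"])
    fix j assume j: "j \<in> J k" "F k z \<in> ball (x k j) (10 * rad k)"
    show "norm (\<theta>' k j (F k z) w *\<^sub>R (\<pi> k j (F k z) - F k z)) \<le> A / rad k * norm w * (101 * lam k * rad k)"
      using theta'_le[OF j(1), of "F k z" w] near_plane[OF z j] NA_nonneg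
      unfolding norm_scaleR real_norm_def by (intro mult_mono) auto
  qed (use theta'_outside lam_nonneg NA_nonneg in auto)
  then show ?thesis by (simp add: B_def algebra_simps)
qed

text \<open>Where the cut-off functions add up to \<open>1\<close>, the leading part of the differential is an average of
projections and does not increase norms. Elsewhere \<open>\<psi>\<close> may be negative, and only a fixed factor is
available (\<open>sigma'_norm\<close>); but outside the balls of radius \<open>10 r\<^sub>k\<close> the map is the identity.\<close>

lemma sigma'_norm_inside:
  assumes z: "z \<in> \<Sigma>\<^sub>0" and y8: "F k z \<in> V J x k 8"
  shows "norm (\<sigma>' k (F k z) w) \<le> (1 + 385 * B\<^sup>2 * lam k) * norm w"
proof -
  let ?y = "F k z"
  have "w + (\<Sum>j\<in>J k. \<theta> k j ?y *\<^sub>R (L k j w - w)) = (\<Sum>j\<in>J k. \<theta> k j ?y *\<^sub>R L k j w)"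
    using sum_theta[OF y8] by (simp add: scaleR_diff_right sum_subtractf flip: scaleR_sum_left)
  then have eq: "\<sigma>' k ?y w = (\<Sum>j\<in>J k. \<theta> k j ?y *\<^sub>R L k j w) + (\<Sum>j\<in>J k. \<theta>' k j ?y w *\<^sub>R (\<pi> k j ?y - ?y))"
    unfolding \<sigma>'_def by (simp add: add.assoc[symmetric])
  have "norm (\<Sum>j\<in>J k. \<theta> k j ?y *\<^sub>R L k j w) \<le> (\<Sum>j\<in>J k. \<theta> k j ?y * norm w)"
  proof (rule sum_norm_le)
    fix j assume "j \<in> J k"
    then show "norm (\<theta> k j ?y *\<^sub>R L k j w) \<le> \<theta> k j ?y * norm w"
      using norm_lproj_le[OF plane, of j k w] theta_nonneg by (simp add: mult_left_mono)
  qed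
  also have "\<dots> = norm w"
    unfolding sum_distrib_right[symmetric] sum_theta[OF y8] by simp
  finally have "norm (\<sigma>' k ?y w) \<le> norm w + 101 * B * lam k * norm w"
    unfolding eq by (rule norm_triangle_mono[OF _ gradient_term_le[OF z]])
  also have "101 * B * lam k * norm w \<le> 385 * B\<^sup>2 * lam k * norm w"
    using B_sq B_ge_1 lam_nonneg[of k] by (intro mult_right_mono) auto
  finally show ?thesis by (simp add: algebra_simps)
qed

lemma sigma'_norm:
  assumes z: "z \<in> \<Sigma>\<^sub>0"
  shows "norm (\<sigma>' k (F k z) w) \<le> 3 * B * norm w"
proof -
  let ?y = "F k z"
  have "norm (\<Sum>j\<in>J k. \<theta> k j ?y *\<^sub>R (L k j w - w)) \<le> N * (A * norm w)"
  proof (rule norm_sum_one_point[where y = ?y])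
    fix j assume j: "j \<in> J k" "?y \<in> ball (x k j) (10 * rad k)"
    have "norm (L k j w - w) \<le> norm w"
      using norm_sub_lproj_le[OF plane[OF j(1)], of w] by (simp add: norm_minus_commute)
    then show "norm (\<theta> k j ?y *\<^sub>R (L k j w - w)) \<le> A * norm w"
      using theta_le[OF j(1)] theta_nonneg[OF j(1)] NA_nonneg
      unfolding norm_scaleR by (intro mult_mono) auto
  qed (use theta_outside NA_nonneg in auto)
  then have "norm (\<sigma>' k ?y w) \<le> norm w + (B * norm w + 101 * B * lam k * norm w)"
    unfolding \<sigma>'_def using gradient_term_le[OF z, of k w]
    by (intro norm_triangle_mono) (auto simp: B_def algebra_simps)
  also have "\<dots> \<le> B * norm w + (B * norm w + B * norm w)"
  proof -
    have "101 * B * lam k \<le> B" using B_lam_small[of k] B_ge_1 lam_nonneg[of k]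
        mult_nonneg_nonneg[of B "lam k"] by linarith
    moreover have "1 * norm w \<le> B * norm w" using B_ge_1 by (intro mult_right_mono) auto
    ultimately show ?thesis using mult_right_mono[OF _ norm_ge_zero[of w], of "101 * B * lam k" B] by linarith
  qed
  finally show ?thesis by (simp add: algebra_simps)
qed

lemma sigma'_outside:
  assumes "y \<notin> V J x k 10"
  shows "\<sigma>' k y w = w"
proof -
  have "y \<notin> ball (x k j) (10 * rad k)" if "j \<in> J k" for j
    using assms that by (auto simp: V_def)
  then show ?thesis
    using theta_outside theta'_outside by (simp add: \<sigma>'_def)
qed

text \<open>Read backwards: once a point leaves the region where the cut-off functions add up to \<open>1\<close>, it stays
outside the balls of all later generations. Hence the fixed factor of \<open>sigma'_norm\<close> occurs in at most one
step.\<close>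

lemma V10_parent: 
  assumes "z \<in> \<Sigma>\<^sub>0" "F (Suc k) z \<in> V J x (Suc k) 10"
  shows "F k z \<in> V J x k 8" "F k z \<in> V J x k 10"
proof -
  obtain j where j: "j \<in> J (Suc k)" "F (Suc k) z \<in> ball (x (Suc k) j) (10 * rad (Suc k))"
    using assms(2) by (auto simp: V_def)
  obtain i where i: "i \<in> J k" "F k z \<in> ball (x k i) (3 * rad k)"
    using parent_ball[OF assms(1) j] by blast
  show "F k z \<in> V J x k 8" "F k z \<in> V J x k 10"
    using i(1) ball_rad_mono[OF i(2), of 8] ball_rad_mono[OF i(2), of 10] by (auto simp: V_def)
qed

text \<open>The weight \<open>h k\<close> becomes \<open>3 * B\<close> when the point \<open>f\<^sub>k(z)\<close> leaves the balls, which pays for the one step in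
which the differential is only bounded by \<open>3 * B\<close>. With this weight the difference of the differentials
satisfies a discrete Gronwall inequality with factors \<open>1 + O(lam k)\<close>. The geometric sum of
\<open>lam k / rad k\<close> has ratio \<open>10 * q = 10 powr (1 - \<alpha>) > 1\<close> and is dominated by its last term.\<close>

lemma tangent_variation:
  assumes z: "z \<in> \<Sigma>\<^sub>0" "z' \<in> \<Sigma>\<^sub>0" and v: "v \<in> plane_directions \<Sigma>\<^sub>0"
    and c: "\<And>k. k < n \<Longrightarrow> norm (F k z - F k z') < rad k"
  shows "norm (F' n z v - F' n z' v) \<le> variation B Q \<alpha> * norm (z - z') * (10 * q) ^ n * norm v"
proof -
  define \<delta> where "\<delta> k = norm (F' k z v - F' k z' v)" for k
  \<comment> \<open>Dividing by \<open>h\<close> removes the factor \<open>3 * B\<close> of the step in which the point leaves the balls.\<close>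
  define h where "h k = (if F k z \<in> V J x k 10 then 1 else 3 * B)" for k
  define b where "b k = 507 * B\<^sup>2 * (lam k / rad k) * (S * norm (z - z')) * (S * norm v)" for k
  have b0: "0 \<le> b k" for k
    unfolding b_def using lam_nonneg S_ge_1 by (intro mult_nonneg_nonneg divide_nonneg_pos) (auto simp: rad_pos)
  have h1: "1 \<le> h k" for k using B_ge_1 by (simp add: h_def)
  have \<delta>0: "0 \<le> \<delta> k" for k by (simp add: \<delta>_def)
  have step: "\<delta> (Suc k) \<le> norm (\<sigma>' k (F k z) (F' k z v - F' k z' v)) + b k" if "k < n" for k
  proof -
    have "norm (F k z - F k z') \<le> S * norm (z - z')"
      using c that by (intro increment_growth(1)[OF z]) (simp add: less_imp_le)
    then have "507 * B\<^sup>2 * (lam k / rad k) * norm (F k z - F k z') * norm (F' k z' v) \<le> b k"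
      unfolding b_def using tangent_norm_le[OF z(2) v, of k] lam_nonneg[of k] S_ge_1
      by (intro mult_mono mult_left_mono mult_nonneg_nonneg) (auto simp: rad_pos)
    moreover have "F' (Suc k) z v - F' (Suc k) z' v = \<sigma>' k (F k z) (F' k z v - F' k z' v)
        + (\<sigma>' k (F k z) (F' k z' v) - \<sigma>' k (F k z') (F' k z' v))"
      by (simp add: linear_diff[OF sigma'_linear])
    then have "\<delta> (Suc k) \<le> norm (\<sigma>' k (F k z) (F' k z v - F' k z' v))
        + norm (\<sigma>' k (F k z) (F' k z' v) - \<sigma>' k (F k z') (F' k z' v))"
      unfolding \<delta>_def using norm_triangle_ineq by metis
    ultimately show ?thesis
      using sigma'_variation[OF z c[OF that] v] by linarith
  qed
  have "\<delta> (Suc k) / h (Suc k) \<le> (1 + 385 * B\<^sup>2 * lam k) * (\<delta> k / h k) + b k" if k: "k < n" for k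
  proof (cases "F (Suc k) z \<in> V J x (Suc k) 10")
    case True
    then have "h (Suc k) = 1" "h k = 1" "F k z \<in> V J x k 8"
      using V10_parent[OF z(1) True] by (auto simp: h_def)
    then show ?thesis
      using step[OF k] sigma'_norm_inside[OF z(1), of k "F' k z v - F' k z' v"] by (simp add: \<delta>_def)
  next
    case False
    then have hS: "h (Suc k) = 3 * B" by (simp add: h_def)
    have "norm (\<sigma>' k (F k z) (F' k z v - F' k z' v)) \<le> h (Suc k) * (\<delta> k / h k)"
    proof (cases "F k z \<in> V J x k 10")
      case True
      then show ?thesis
        using sigma'_norm[OF z(1), of k "F' k z v - F' k z' v"] by (simp add: hS \<delta>_def) (simp add: h_def)
    next
      case False
      then have "h k = h (Suc k)" using hS by (simp add: h_def)
      then show ?thesis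
        using sigma'_outside[OF False] h1[of k] by (simp add: \<delta>_def)
    qed
    then have "\<delta> (Suc k) / h (Suc k) \<le> (h (Suc k) * (\<delta> k / h k) + b k) / h (Suc k)"
      using step[OF k] h1[of "Suc k"] by (intro divide_right_mono) auto
    also have "\<dots> = \<delta> k / h k + b k / h (Suc k)"
      using h1[of "Suc k"] by (simp add: add_divide_distrib)
    also have "b k / h (Suc k) \<le> b k / 1"
      using h1[of "Suc k"] b0[of k] by (intro divide_left_mono) auto
    finally have "\<delta> (Suc k) / h (Suc k) \<le> \<delta> k / h k + b k" by simp
    moreover have "1 * (\<delta> k / h k) \<le> (1 + 385 * B\<^sup>2 * lam k) * (\<delta> k / h k)"
      using \<delta>0[of k] h1[of k] lam_nonneg[of k] by (intro mult_right_mono divide_nonneg_pos) auto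
    ultimately show ?thesis by linarith
  qed
  then have "\<delta> n / h n \<le> exp (\<Sum>k<n. 385 * B\<^sup>2 * lam k) * (\<delta> 0 / h 0 + (\<Sum>k<n. b k))"
    using step_small \<delta>0 h1 b0 order_trans[OF zero_le_one h1]
    by (intro discrete_gronwall[where a = "\<lambda>k. \<delta> k / h k"]) auto
  also have "\<dots> \<le> S * (\<Sum>k<n. b k)"
    using exp_steps_le[of n] b0 by (simp add: \<delta>_def sum_nonneg mult_right_mono)
  also have "(\<Sum>k<n. b k) \<le> (\<Sum>k<n. 507 * B\<^sup>2 * (Q * (10 * q) ^ k) * (S * norm (z - z')) * (S * norm v))"
  proof (rule sum_mono)
    fix k
    have "lam k / rad k \<le> Q * q ^ k / rad k"
      using lam_decay[of k] by (intro divide_right_mono) (auto simp: rad_powr)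
    also have "\<dots> = Q * (10 * q) ^ k"
      by (simp add: rad_def power_divide power_mult_distrib)
    finally show "b k \<le> 507 * B\<^sup>2 * (Q * (10 * q) ^ k) * (S * norm (z - z')) * (S * norm v)"
      unfolding b_def using S_ge_1 by (intro mult_right_mono mult_left_mono mult_nonneg_nonneg) auto
  qed
  also have "\<dots> = 507 * B\<^sup>2 * Q * (S * norm (z - z')) * (S * norm v) * (\<Sum>k<n. (10 * q) ^ k)"
    by (simp add: sum_distrib_left algebra_simps)
  also have "(\<Sum>k<n. (10 * q) ^ k) \<le> (10 * q) ^ n / (10 * q - 1)"
    using q_bounds geometric_sum[of "10 * q" n] by (simp add: divide_right_mono)
  finally have "\<delta> n / h n \<le> S * (507 * B\<^sup>2 * Q * (S * norm (z - z')) * (S * norm v) * ((10 * q) ^ n / (10 * q - 1)))"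
    (is "_ \<le> ?R") using S_ge_1 Q_nonneg by (simp add: mult_left_mono)
  then have "\<delta> n \<le> h n * ?R"
    using h1[of n] by (simp add: divide_le_eq mult.commute)
  also have "\<dots> \<le> 3 * B * ?R"
    using B_ge_1 S_ge_1 Q_nonneg q_bounds
    by (intro mult_right_mono mult_nonneg_nonneg divide_nonneg_nonneg) (auto simp: h_def)
  also have "\<dots> = variation B Q \<alpha> * norm (z - z') * (10 * q) ^ n * norm v"
    by (simp add: variation_def power2_eq_square power3_eq_cube)
  finally show ?thesis by (simp add: \<delta>_def)
qed

lemma variation_nonneg: "0 \<le> variation B Q \<alpha>"
  unfolding variation_def using q_bounds Q_nonneg S_ge_1 B_ge_1
  by (intro divide_nonneg_nonneg mult_nonneg_nonneg) auto

lemma G_norm_le: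
  assumes "z \<in> \<Sigma>\<^sub>0"
  shows "norm (G z u) \<le> S * norm u"
proof -
  have lim: "(\<lambda>n. norm (F' n z (lproj \<Sigma>\<^sub>0 u))) \<longlonglongrightarrow> norm (G z u)"
    by (intro tendsto_intros F'_tendsto assms)
  have "norm (F' n z (lproj \<Sigma>\<^sub>0 u)) \<le> S * norm u" for n
    using tangent_norm_le[OF assms lproj_base, of n u] S_ge_1
      mult_left_mono[OF norm_lproj_le[OF base_plane, of u], of S] by linarith
  then show ?thesis using LIMSEQ_le_const2[OF lim] by blast
qed

text \<open>The generation \<open>n\<close> is chosen so that \<open>rad n\<close> is comparable to \<open>2 * S * norm (z - z')\<close>: the two points are
then closer than \<open>rad k\<close> in all generations \<open>k \<le> n\<close>, and both the variation up to \<open>n\<close> and the tail after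
\<open>n\<close> are \<open>O(rad n powr \<alpha>)\<close>.\<close>

lemma G_holder:
  assumes z: "z \<in> \<Sigma>\<^sub>0" "z' \<in> \<Sigma>\<^sub>0"
  shows "norm (G z u - G z' u) \<le> holder_const B Q \<alpha> * norm (z - z') powr \<alpha> * norm u"
proof (cases "z = z'")
  case False
  let ?\<rho> = "norm (z - z')" and ?v = "lproj \<Sigma>\<^sub>0 u"
  have \<rho>: "0 < ?\<rho>" using False by simp
  have c0: "0 \<le> 2 * tail B Q \<alpha> + variation B Q \<alpha>" "0 < S"
    using tail_nonneg variation_nonneg S_ge_1 by auto
  have final: "norm (G z u - G z' u) \<le> holder_const B Q \<alpha> * ?\<rho> powr \<alpha> * norm u"
    if "norm (G z u - G z' u) \<le> (2 * tail B Q \<alpha> + variation B Q \<alpha> + 2 * S) * r powr \<alpha> * norm u"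
      and r: "0 \<le> r" "r \<le> 20 * S * ?\<rho>" for r
  proof -
    have "r powr \<alpha> \<le> (20 * S * ?\<rho>) powr \<alpha>"
      using r alpha by (intro powr_mono2) auto
    also have "\<dots> = (20 * S) powr \<alpha> * ?\<rho> powr \<alpha>"
      using c0 by (simp add: powr_mult)
    finally have "(2 * tail B Q \<alpha> + variation B Q \<alpha> + 2 * S) * r powr \<alpha> * norm u
        \<le> (2 * tail B Q \<alpha> + variation B Q \<alpha> + 2 * S) * ((20 * S) powr \<alpha> * ?\<rho> powr \<alpha>) * norm u"
      using c0 by (intro mult_right_mono mult_left_mono) auto
    with that(1) show ?thesis by (simp add: holder_const_def mult.assoc)
  qed
  show ?thesis
  proof (cases "1 \<le> 2 * S * ?\<rho>")
    case True
    have "norm (G z u - G z' u) \<le> 2 * S * norm u"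
      using G_norm_le[OF z(1), of u] G_norm_le[OF z(2), of u] norm_triangle_ineq4[of "G z u" "G z' u"]
      by linarith
    also have "\<dots> \<le> (2 * tail B Q \<alpha> + variation B Q \<alpha> + 2 * S) * 1 powr \<alpha> * norm u"
      using c0 by (intro mult_right_mono) auto
    finally show ?thesis
      using True c0 \<rho> by (intro final[of 1]) auto
  next
    case False
    obtain m where "rad m < 2 * S * ?\<rho>"
      using order_tendstoD(2)[OF rad_tendsto_0, of "2 * S * ?\<rho>"] \<rho> c0
      by (auto simp: eventually_sequentially)
    moreover have "rad (Suc m) \<le> rad m" by (simp add: rad_def)
    ultimately have ex: "rad (Suc m) \<le> 2 * S * ?\<rho>" by linarith
    define n where "n = (LEAST n. rad (Suc n) \<le> 2 * S * ?\<rho>)"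
    have n: "rad (Suc n) \<le> 2 * S * ?\<rho>"
      unfolding n_def using ex by (rule LeastI)
    have big: "2 * S * ?\<rho> < rad k" if "k \<le> n" for k
    proof (cases k)
      case 0
      then show ?thesis using False by (simp add: rad_def)
    next
      case (Suc l)
      then have "l < n" using that by simp
      then show ?thesis
        unfolding n_def Suc using not_less_Least by (metis not_le)
    qed
    have close: "norm (F k z - F k z') < rad k" if "k \<le> n" for k
      using that
    proof (induction k rule: less_induct)
      case (less k)
      then have "norm (F k z - F k z') \<le> S * ?\<rho>"
        by (intro increment_growth(1)[OF z]) (simp add: less_imp_le)
      moreover have "0 < S * ?\<rho>" using c0 \<rho> by simp
      ultimately show ?case using big[OF less.prems] by linarith
    qed
    have "norm (F' n z ?v - F' n z' ?v) \<le> variation B Q \<alpha> * ?\<rho> * (10 * q) ^ n * norm ?v"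
      using close by (intro tangent_variation[OF z lproj_base]) simp
    also have "\<dots> \<le> variation B Q \<alpha> * q ^ n * norm u"
    proof -
      have "?\<rho> \<le> rad n"
        using big[of n] mult_right_mono[OF S_ge_1 norm_ge_zero[of "z - z'"]] \<rho> by linarith
      then have "?\<rho> * (10 * q) ^ n \<le> rad n * (10 * q) ^ n"
        using q_bounds by (intro mult_right_mono) auto
      also have "\<dots> = q ^ n" by (simp add: rad_def power_mult_distrib power_divide)
      finally have "variation B Q \<alpha> * (?\<rho> * (10 * q) ^ n) * norm ?v \<le> variation B Q \<alpha> * q ^ n * norm u"
        using variation_nonneg q_bounds norm_lproj_le[OF base_plane, of u]
        by (intro mult_mono mult_left_mono mult_nonneg_nonneg) auto
      then show ?thesis by (simp add: mult.assoc)
    qed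
    finally have mid: "norm (F' n z ?v - F' n z' ?v) \<le> variation B Q \<alpha> * q ^ n * norm u" .
    have "norm (G z u - G z' u) \<le> norm (F' n z ?v - F' n z' ?v)
        + norm (F' n z ?v - G z u) + norm (F' n z' ?v - G z' u)"
      by norm
    also have "\<dots> \<le> variation B Q \<alpha> * q ^ n * norm u + tail B Q \<alpha> * q ^ n * norm u + tail B Q \<alpha> * q ^ n * norm u"
      by (intro add_mono mid G_close z)
    also have "\<dots> = (2 * tail B Q \<alpha> + variation B Q \<alpha>) * rad n powr \<alpha> * norm u"
      by (simp add: rad_powr algebra_simps)
    also have "\<dots> \<le> (2 * tail B Q \<alpha> + variation B Q \<alpha> + 2 * S) * rad n powr \<alpha> * norm u"
      using c0 by (intro mult_right_mono) auto
    finally show ?thesis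
      using n by (intro final[of "rad n"]) (auto simp: rad_Suc)
  qed
qed simp

end

section \<open>Inverses of expanding embeddings of a plane\<close>

locale expanding_embedding =
  fixes f :: "'a::euclidean_space \<Rightarrow> 'a" and P :: "'a set" and G :: "'a \<Rightarrow> 'a \<Rightarrow> 'a" and c :: real
  assumes P: "affine P" "P \<noteq> {}"
    and deriv: "z \<in> P \<Longrightarrow> (f has_derivative G z) (at z within P)"
    and c_pos: "0 < c" and expanding: "z \<in> P \<Longrightarrow> z' \<in> P \<Longrightarrow> c * norm (z - z') \<le> norm (f z - f z')"
begin

abbreviation "T \<equiv> plane_directions P"
abbreviation "g \<equiv> inv_into P f"

lemma inj: "inj_on f P"
proof
  fix z z' assume "z \<in> P" "z' \<in> P" "f z = f z'"
  then have "c * norm (z - z') \<le> 0" using expanding by fastforce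
  then show "z = z'" using c_pos by (simp add: mult_le_0_iff)
qed

lemma g_f: "z \<in> P \<Longrightarrow> g (f z) = z"
  by (rule inv_into_f_f[OF inj])

lemma line_in_P: "z \<in> P \<Longrightarrow> v \<in> T \<Longrightarrow> z + t *\<^sub>R v \<in> P"
  using plane_add_direction P by blast

lemma diff_in_T: "z \<in> P \<Longrightarrow> z' \<in> P \<Longrightarrow> z - z' \<in> T"
  by (auto simp: plane_directions_def)

lemma subspace_T: "subspace T"
  using subspace_plane_directions P by blast

lemma linear_G: "z \<in> P \<Longrightarrow> linear (G z)"
  by (rule has_derivative_linear[OF deriv])

lemma secant_lim:
  assumes "z \<in> P" "v \<in> T"
  shows "((\<lambda>t. (1 / t) *\<^sub>R (f (z + t *\<^sub>R v) - f z)) \<longlongrightarrow> G z v) (at_right 0)"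
  by (rule has_derivative_secant[OF deriv[OF assms(1)] line_in_P[OF assms]])

lemma G_expanding:
  assumes z: "z \<in> P" and v: "v \<in> T"
  shows "c * norm v \<le> norm (G z v)"
proof -
  have "\<forall>\<^sub>F t in at_right 0. c * norm v \<le> norm ((1 / t) *\<^sub>R (f (z + t *\<^sub>R v) - f z))"
    using eventually_at_right_less[of "0::real"]
  proof eventually_elim
    fix t :: real assume t: "0 < t"
    then have "t * (c * norm v) \<le> norm (f (z + t *\<^sub>R v) - f z)"
      using expanding[OF line_in_P[OF z v] z, of t] by (simp add: algebra_simps)
    then show "c * norm v \<le> norm ((1 / t) *\<^sub>R (f (z + t *\<^sub>R v) - f z))"
      using t by (simp add: pos_le_divide_eq mult_ac del: scaleR_diff_right)
  qed
  then show ?thesis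
    using tendsto_lowerbound[OF tendsto_norm[OF secant_lim[OF z v]]] by simp
qed

lemma subspace_image: "z \<in> P \<Longrightarrow> subspace (G z ` T)"
  using linear_G subspace_T linear_subspace_image by blast

text \<open>As \<open>f\<close> is expanding, an error that is small relative to \<open>z' - z\<close> is small relative to \<open>f z' - f z\<close>.\<close>

lemma expansion_in_image:
  assumes z: "z \<in> P" and e: "0 < e"
  shows "\<exists>d>0. \<forall>z'\<in>P. norm (f z' - f z) < d \<longrightarrow>
     norm (f z' - f z - G z (z' - z)) \<le> e * norm (f z' - f z)"
proof -
  have ec: "0 < e * c" using e c_pos by simp
  obtain d where d: "0 < d"
    "\<And>z'. z' \<in> P \<Longrightarrow> norm (z' - z) < d \<Longrightarrow> norm (f z' - f z - G z (z' - z)) \<le> e * c * norm (z' - z)"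
    using deriv[OF z] ec unfolding has_derivative_within_alt by blast
  have "norm (f z' - f z - G z (z' - z)) \<le> e * norm (f z' - f z)"
    if z': "z' \<in> P" "norm (f z' - f z) < c * d" for z'
  proof -
    have "c * norm (z' - z) \<le> norm (f z' - f z)" by (rule expanding[OF z'(1) z])
    then have "norm (z' - z) < d" "e * (c * norm (z' - z)) \<le> e * norm (f z' - f z)"
      using z'(2) c_pos e by (auto intro!: mult_left_mono) (metis le_less_trans mult_less_cancel_left_pos)
    then show ?thesis using d(2)[OF z'(1)] by (simp add: mult.assoc)
  qed
  then show ?thesis using d(1) c_pos by (intro exI[of _ "c * d"]) simp
qed

text \<open>A linear left inverse of \<open>G z\<close> on the directions of \<open>P\<close> serves as derivative of the inverse. Its values on
vectors that are not tangent to the image are irrelevant.\<close>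

lemma inverse_differentiable: "g differentiable_on (f ` P)"
  unfolding differentiable_on_def
proof
  fix y assume "y \<in> f ` P"
  then obtain z where z: "z \<in> P" and y: "y = f z" by blast
  obtain h where h: "linear h" "\<And>v. v \<in> T \<Longrightarrow> h (G z v) = v"
  proof -
    have "inj_on (G z) T"
    proof (rule linear_inj_on_iff_eq_0[OF linear_G[OF z] subspace_T, THEN iffD2], intro ballI impI)
      fix v assume "v \<in> T" "G z v = 0"
      then show "v = 0" using G_expanding[OF z] c_pos by (fastforce simp: mult_le_0_iff)
    qed
    then show ?thesis
      using linear_exists_left_inverse_on[OF linear_G[OF z] subspace_T] that by blast
  qed
  then obtain b where b: "0 < b" "\<And>u. norm (h u) \<le> b * norm u"
    using linear_bounded_pos by blast
  have "(g has_derivative h) (at y within f ` P)"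
    unfolding has_derivative_within_alt
  proof (intro conjI allI impI)
    show "bounded_linear h" using h(1) linear_conv_bounded_linear by blast
    fix e :: real assume e: "0 < e"
    then have "0 < e / b" using b by simp
    then obtain d where d: "0 < d" "\<And>z'. z' \<in> P \<Longrightarrow> norm (f z' - f z) < d \<Longrightarrow>
        norm (f z' - f z - G z (z' - z)) \<le> e / b * norm (f z' - f z)"
      using expansion_in_image[OF z] by blast
    have "norm (g y' - g y - h (y' - y)) \<le> e * norm (y' - y)"
      if y': "y' \<in> f ` P" "norm (y' - y) < d" for y'
    proof -
      obtain z' where z': "z' \<in> P" "y' = f z'" using y'(1) by blast
      have "g y' - g y - h (y' - y) = - h (f z' - f z - G z (z' - z))"
        using g_f[OF z] g_f[OF z'(1)] h(2)[OF diff_in_T[OF z'(1) z]] 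
        by (simp add: y z'(2) linear_diff[OF h(1)])
      then have "norm (g y' - g y - h (y' - y)) \<le> b * norm (f z' - f z - G z (z' - z))"
        using b(2)[of "f z' - f z - G z (z' - z)"] by simp
      also have "\<dots> \<le> b * (e / b * norm (f z' - f z))"
        using d(2)[OF z'(1)] y'(2) b(1) by (intro mult_left_mono) (auto simp: y z'(2))
      finally show ?thesis using b(1) by (simp add: y z'(2))
    qed
    then show "\<exists>d>0. \<forall>y'\<in>f ` P. norm (y' - y) < d \<longrightarrow> norm (g y' - g y - h (y' - y)) \<le> e * norm (y' - y)"
      using d(1) by blast
  qed
  then show "g differentiable at y within f ` P"
    unfolding differentiable_def by blast
qed

text \<open>For the inclusion from left to right: as \<open>f\<close> is expanding, the preimages of the points \<open>y i\<close> approach \<open>z\<close>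
at a comparable rate, so the rescaled secants differ from vectors in the image of \<open>G z\<close> by a null sequence,
and this image is closed.\<close>

lemma tangent_directions_image:
  assumes z: "z \<in> P"
  shows "tangent_directions (f ` P) (f z) = G z ` T"
proof (intro equalityI subsetI)
  fix w assume "w \<in> G z ` T"
  then obtain v where v: "v \<in> T" "w = G z v" by blast
  let ?t = "\<lambda>i. 1 / real (Suc i)"
  have t: "filterlim ?t (at_right 0) sequentially"
    by (rule tendsto_imp_filterlim_at_right[OF LIMSEQ_Suc[OF lim_1_over_n]]) simp
  have 1: "(\<lambda>i. real (Suc i) *\<^sub>R (f (z + ?t i *\<^sub>R v) - f z)) \<longlonglongrightarrow> w"
    using filterlim_compose[OF secant_lim[OF z v(1)] t] v(2) by simp
  have "continuous (at z within P) f"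
    by (rule has_derivative_continuous[OF deriv[OF z]])
  moreover have "(\<lambda>i. z + ?t i *\<^sub>R v) \<longlonglongrightarrow> z + 0 *\<^sub>R v"
    by (intro tendsto_intros LIMSEQ_Suc[OF lim_1_over_n])
  ultimately have 2: "(\<lambda>i. f (z + ?t i *\<^sub>R v)) \<longlonglongrightarrow> f z"
    using line_in_P[OF z v(1)] unfolding continuous_within_sequentially comp_def by simp
  show "w \<in> tangent_directions (f ` P) (f z)"
    unfolding tangent_directions_def
    using 1 2 line_in_P[OF z v(1)]
    by (intro CollectI exI[of _ "\<lambda>i. f (z + ?t i *\<^sub>R v)"] exI[of _ "\<lambda>i. real (Suc i)"]) auto
next
  fix w assume "w \<in> tangent_directions (f ` P) (f z)"
  then obtain y t where y: "\<And>i. y i \<in> f ` P" and t: "\<And>i::nat. 0 < (t i :: real)"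
    and lim: "y \<longlonglongrightarrow> f z" "(\<lambda>i. t i *\<^sub>R (y i - f z)) \<longlonglongrightarrow> w"
    unfolding tangent_directions_def by blast
  define \<zeta> where "\<zeta> i = g (y i)" for i
  have \<zeta>: "\<zeta> i \<in> P" "y i = f (\<zeta> i)" for i
    unfolding \<zeta>_def using inv_into_into[OF y] f_inv_into_f[OF y] by auto
  let ?v = "\<lambda>i. t i *\<^sub>R (\<zeta> i - z)"
  have vT: "?v i \<in> T" for i
    using diff_in_T[OF \<zeta>(1) z] subspace_T subspace_scale by blast
  have "(\<lambda>i. t i *\<^sub>R (y i - f z) - G z (?v i)) \<longlonglongrightarrow> 0"
  proof (rule LIMSEQ_I)
    fix r :: real assume r: "0 < r"
    have pos: "0 < r / (norm w + 1)" using r by (simp add: add_nonneg_pos)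
    obtain d where d: "0 < d" "\<And>z'. z' \<in> P \<Longrightarrow> norm (f z' - f z) < d \<Longrightarrow>
        norm (f z' - f z - G z (z' - z)) \<le> r / (norm w + 1) * norm (f z' - f z)"
      using expansion_in_image[OF z pos] by blast
    have ev1: "\<forall>\<^sub>F i in sequentially. norm (y i - f z) < d"
      using lim(1) d(1) by (simp add: tendsto_iff dist_norm)
    have ev2: "\<forall>\<^sub>F i in sequentially. norm (t i *\<^sub>R (y i - f z)) < norm w + 1"
      using order_tendstoD(2)[OF tendsto_norm[OF lim(2)]] by simp
    have "\<forall>\<^sub>F i in sequentially. norm (t i *\<^sub>R (y i - f z) - G z (?v i) - 0) < r"
      using ev1 ev2
    proof eventually_elim
      case (elim i)
      have eq: "t i *\<^sub>R (y i - f z) - G z (?v i) - 0 = t i *\<^sub>R (f (\<zeta> i) - f z - G z (\<zeta> i - z))"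
        unfolding \<zeta>(2) linear_scale[OF linear_G[OF z]] by (simp add: algebra_simps)
      have "norm (t i *\<^sub>R (y i - f z) - G z (?v i) - 0) = t i * norm (f (\<zeta> i) - f z - G z (\<zeta> i - z))"
        unfolding eq using t[of i] by simp
      also have "\<dots> \<le> t i * (r / (norm w + 1) * norm (f (\<zeta> i) - f z))"
        using d(2)[OF \<zeta>(1), of i] elim(1) t[of i] by (intro mult_left_mono) (auto simp: \<zeta>(2))
      also have "\<dots> = r / (norm w + 1) * norm (t i *\<^sub>R (y i - f z))"
        using t[of i] by (simp add: \<zeta>(2))
      also have "\<dots> < r / (norm w + 1) * (norm w + 1)"
        using pos elim(2) by (intro mult_strict_left_mono)
      also have "\<dots> = r" using norm_ge_zero[of w] by (simp add: add_nonneg_eq_0_iff)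
      finally show ?case .
    qed
    then show "\<exists>no. \<forall>n\<ge>no. norm (t n *\<^sub>R (y n - f z) - G z (?v n) - 0) < r"
      by (simp add: eventually_sequentially)
  qed
  then have "(\<lambda>i. t i *\<^sub>R (y i - f z) - (t i *\<^sub>R (y i - f z) - G z (?v i))) \<longlonglongrightarrow> w - 0"
    by (intro tendsto_diff lim)
  then have "(\<lambda>i. G z (?v i)) \<longlonglongrightarrow> w" by simp
  then show "w \<in> G z ` T"
    by (rule closed_sequentially[OF closed_subspace[OF subspace_image[OF z]], rotated])
      (intro imageI vT)
qed

text \<open>Any derivative of the inverse within the image undoes \<open>G z\<close> by the chain rule, so the choice made by
\<^const>\<open>frechet_derivative\<close> is immaterial on tangent directions.\<close>

lemma tangent_deriv_inverse:
  assumes z: "z \<in> P" and v: "v \<in> T"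
  shows "tangent_deriv g (f ` P) (f z) (G z v) = v"
proof -
  let ?h = "frechet_derivative g (at (f z) within f ` P)"
  have "(g has_derivative ?h) (at (f z) within f ` P)"
    using inverse_differentiable z by (auto simp: differentiable_on_def frechet_derivative_works)
  then have "((\<lambda>z. g (f z)) has_derivative (\<lambda>u. ?h (G z u))) (at z within P)"
    by (rule has_derivative_in_compose[OF deriv[OF z]])
  then have "((\<lambda>z. z) has_derivative (\<lambda>u. ?h (G z u))) (at z within P)"
    by (rule has_derivative_transform[OF z, rotated]) (simp add: g_f)
  then have "((\<lambda>t. (1 / t) *\<^sub>R ((z + t *\<^sub>R v) - z)) \<longlongrightarrow> ?h (G z v)) (at_right 0)"
    by (rule has_derivative_secant[OF _ line_in_P[OF z v]])
  moreover have "((\<lambda>t. (1 / t) *\<^sub>R ((z + t *\<^sub>R v) - z)) \<longlongrightarrow> v) (at_right 0)"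
  proof (rule Lim_transform_eventually[OF tendsto_const])
    show "\<forall>\<^sub>F t in at_right 0. v = (1 / t) *\<^sub>R ((z + t *\<^sub>R v) - z)"
      using eventually_at_right_less[of "0::real"] by eventually_elim simp
  qed
  ultimately show ?thesis
    unfolding tangent_deriv_def using tendsto_unique[OF trivial_limit_at_right_real] by blast
qed

text \<open>The preimage \<open>w\<close> of the projection of \<open>u\<close> onto the image of \<open>G z\<close> is characterised by the normal
equations \<open>(u - G z w) \<bullet> G z v = 0\<close>. Subtracting those for \<open>z'\<close> and testing with \<open>h = w - w'\<close> bounds
\<open>(norm (G z h))\<^sup>2\<close> by the distance \<open>\<eta>\<close> of \<open>G z\<close> and \<open>G z'\<close> times \<open>norm (G z h)\<close>.\<close>

lemma holder_inverse:
  assumes K: "0 \<le> K" and a: "0 \<le> a"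
    and hold: "\<And>z z' u. z \<in> P \<Longrightarrow> z' \<in> P \<Longrightarrow> norm (G z u - G z' u) \<le> K * norm (z - z') powr a * norm u"
  shows "holder_tangent_derivs a (2 * K / c\<^sup>2 / c powr a) g (f ` P)"
  unfolding holder_tangent_derivs_def
proof (intro allI impI ballI)
  fix u y y' :: 'a assume u: "norm u = 1" and "y \<in> f ` P" "y' \<in> f ` P"
  then obtain z z' where z: "z \<in> P" "y = f z" and z': "z' \<in> P" "y' = f z'" by blast
  have ex: "\<exists>w\<in>T. closest_point (G z ` T) u = G z w" if "z \<in> P" for z
    using subspace_closest_point(1)[OF subspace_image[OF that], of u] by blast
  obtain w where w: "w \<in> T" "closest_point (G z ` T) u = G z w" using ex[OF z(1)] by blast
  obtain w' where w': "w' \<in> T" "closest_point (G z' ` T) u = G z' w'" using ex[OF z'(1)] by blast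
  define \<eta> where "\<eta> = K * norm (z - z') powr a"
  have \<eta>: "0 \<le> \<eta>" "norm (G z v - G z' v) \<le> \<eta> * norm v" for v
    using K hold[OF z(1) z'(1), of v] by (auto simp: \<eta>_def)
  have orth: "(u - G z w) \<bullet> G z v = 0" "(u - G z' w') \<bullet> G z' v = 0" if "v \<in> T" for v
    using subspace_closest_point(2)[OF subspace_image[OF z(1)], of "G z v" u]
      subspace_closest_point(2)[OF subspace_image[OF z'(1)], of "G z' v" u] that w(2) w'(2) by auto
  define h where "h = w - w'"
  have h: "h \<in> T" unfolding h_def using w(1) w'(1) subspace_T subspace_diff by blast
  have Gh: "G z h = G z w - G z w'" unfolding h_def by (rule linear_diff[OF linear_G[OF z(1)]])
  have nu: "norm (G z' w') \<le> 1" "norm (u - G z' w') \<le> 1"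
  proof -
    have "orthogonal (G z' w') (u - G z' w')"
      using orth(2)[OF w'(1)] by (simp add: orthogonal_def inner_commute)
    then have "(norm (G z' w' + (u - G z' w')))\<^sup>2 = (norm (G z' w'))\<^sup>2 + (norm (u - G z' w'))\<^sup>2"
      by (rule norm_add_Pythagorean)
    then have "(norm (G z' w'))\<^sup>2 + (norm (u - G z' w'))\<^sup>2 = 1\<^sup>2" using u by simp
    then have "(norm (G z' w'))\<^sup>2 \<le> 1\<^sup>2" "(norm (u - G z' w'))\<^sup>2 \<le> 1\<^sup>2"
      using zero_le_power2[of "norm (G z' w')"] zero_le_power2[of "norm (u - G z' w')"] by linarith+
    then show "norm (G z' w') \<le> 1" "norm (u - G z' w') \<le> 1"
      using power2_le_imp_le[OF _ zero_le_one] by blast+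
  qed
  have nw: "norm w' \<le> 1 / c"
    using G_expanding[OF z'(1) w'(1)] nu(1) c_pos by (simp add: field_simps)
  have hG: "norm h \<le> norm (G z h) / c"
    using G_expanding[OF z(1) h] c_pos by (simp add: field_simps)
  have "(norm (G z h))\<^sup>2 = (u - G z w') \<bullet> G z h - (u - G z w) \<bullet> G z h"
    unfolding power2_norm_eq_inner by (subst (1) Gh) (simp add: inner_diff_left)
  also have "\<dots> = (u - G z' w') \<bullet> (G z h - G z' h) + (G z' w' - G z w') \<bullet> G z h"
    using orth(1)[OF h] orth(2)[OF h] by (simp add: inner_diff_left inner_diff_right)
  also have "\<dots> \<le> norm (u - G z' w') * norm (G z h - G z' h) + norm (G z' w' - G z w') * norm (G z h)"
    by (intro add_mono norm_cauchy_schwarz)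
  also have "\<dots> \<le> 1 * (\<eta> * (norm (G z h) / c)) + (\<eta> * (1 / c)) * norm (G z h)"
  proof (intro add_mono mult_mono mult_right_mono)
    show "norm (G z h - G z' h) \<le> \<eta> * (norm (G z h) / c)"
      using \<eta>(2)[of h] mult_left_mono[OF hG \<eta>(1)] by linarith
    show "norm (G z' w' - G z w') \<le> \<eta> * (1 / c)"
      using \<eta>(2)[of w'] mult_left_mono[OF nw \<eta>(1)] by (simp add: norm_minus_commute)
  qed (use nu \<eta>(1) c_pos in auto)
  finally have sq: "norm (G z h) * norm (G z h) \<le> (2 * \<eta> / c) * norm (G z h)"
    by (simp add: power2_eq_square)
  have "norm (G z h) \<le> 2 * \<eta> / c"
  proof (cases "G z h = 0")
    case False
    then show ?thesis using mult_right_le_imp_le[OF sq] by simp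
  qed (use \<eta>(1) c_pos in simp)
  then have "norm (G z h) / c \<le> (2 * \<eta> / c) / c"
    using c_pos by (intro divide_right_mono) auto
  then have hb: "norm h \<le> 2 * \<eta> / c\<^sup>2"
    using hG by (simp add: power2_eq_square)
  have "norm (z - z') \<le> dist y y' / c"
    using expanding[OF z(1) z'(1)] c_pos by (simp add: z z' dist_norm field_simps)
  then have "norm (z - z') powr a \<le> (dist y y' / c) powr a"
    using a by (intro powr_mono2) auto
  then have "\<eta> \<le> K * (dist y y' powr a / c powr a)"
    unfolding \<eta>_def using K c_pos by (intro mult_left_mono) (auto simp: powr_divide)
  then have "2 * \<eta> / c\<^sup>2 \<le> 2 * (K * (dist y y' powr a / c powr a)) / c\<^sup>2"
    by (intro divide_right_mono mult_left_mono) auto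
  moreover have "tangent_deriv g (f ` P) y (closest_point (tangent_directions (f ` P) y) u) = w"
    "tangent_deriv g (f ` P) y' (closest_point (tangent_directions (f ` P) y') u) = w'"
    using tangent_directions_image tangent_deriv_inverse z z' w w' by auto
  ultimately show "norm (tangent_deriv g (f ` P) y (closest_point (tangent_directions (f ` P) y) u)
      - tangent_deriv g (f ` P) y' (closest_point (tangent_directions (f ` P) y') u))
      \<le> 2 * K / c\<^sup>2 / c powr a * dist y y' powr a"
    using hb by (simp add: h_def mult_ac)
qed

lemma holder_derivs:
  assumes hold: "\<And>z z' u. z \<in> P \<Longrightarrow> z' \<in> P \<Longrightarrow> norm (G z u - G z' u) \<le> K * norm (z - z') powr a * norm u"
  shows "holder_dir_derivs_plane a K f P"
  unfolding holder_dir_derivs_plane_def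
proof (intro ballI impI)
  fix v z z' assume v: "v \<in> T" "norm v = 1" and z: "z \<in> P" "z' \<in> P"
  have "dir_deriv f z v = G z v" if "z \<in> P" for z
    unfolding dir_deriv_def
    by (rule vector_derivative_at[OF line_has_vector_derivative[OF deriv[OF that] line_in_P[OF that v(1)]]])
  then show "norm (dir_deriv f z v - dir_deriv f z' v) \<le> K * dist z z' powr a"
    using hold[OF z, of v] z v(2) by (simp add: dist_norm)
qed

lemma C1:
  assumes K: "0 \<le> K" and a: "0 < a"
    and hold: "\<And>z z' u. z \<in> P \<Longrightarrow> z' \<in> P \<Longrightarrow> norm (G z u - G z' u) \<le> K * norm (z - z') powr a * norm u"
  shows "C1_on f P"
proof -
  define H where "H z = Blinfun (G z)" for z
  have H: "blinfun_apply (H z) = G z" if "z \<in> P" for z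
    unfolding H_def by (rule bounded_linear_Blinfun_apply[OF has_derivative_bounded_linear[OF deriv[OF that]]])
  have le: "norm (H z - H z') \<le> K * norm (z - z') powr a" if "z \<in> P" "z' \<in> P" for z z'
    using hold[OF that] K that by (intro norm_blinfun_bound) (auto simp: H blinfun.diff_left)
  have "continuous_on P H"
    unfolding continuous_on_def
  proof
    fix z assume z: "z \<in> P"
    have "((\<lambda>z'. norm (z' - z)) \<longlongrightarrow> norm (z - z)) (at z within P)"
      by (intro tendsto_intros)
    then have "((\<lambda>z'. norm (z' - z) powr a) \<longlongrightarrow> norm (z - z) powr a) (at z within P)"
      using a by (intro tendsto_powr') auto
    then have "((\<lambda>z'. K * norm (z' - z) powr a) \<longlongrightarrow> K * 0) (at z within P)"
      by (intro tendsto_mult) (use a in auto)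
    then have lim: "((\<lambda>z'. K * norm (z' - z) powr a) \<longlongrightarrow> 0) (at z within P)" by simp
    have "((\<lambda>z'. H z' - H z) \<longlongrightarrow> 0) (at z within P)"
      by (rule Lim_null_comparison[OF _ lim]) (auto simp: eventually_at_filter le z)
    then show "(H \<longlongrightarrow> H z) (at z within P)"
      by (rule LIM_zero_cancel)
  qed
  then show ?thesis
    unfolding C1_on_def using deriv H by (intro exI[of _ H]) simp
qed

end

section \<open>Coherent collections and cut-off functions\<close>

lemma linear_le_from_unit:
  fixes h :: "'a::real_normed_vector \<Rightarrow> real"
  assumes h: "linear h" and unit: "\<And>v. norm v = 1 \<Longrightarrow> \<bar>h v\<bar> \<le> b"
  shows "\<bar>h u\<bar> \<le> b * norm u"
proof (cases "u = 0")
  case False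
  have "\<bar>h ((1 / norm u) *\<^sub>R u)\<bar> \<le> b"
    using False by (intro unit) simp
  then show ?thesis
    using False by (simp add: linear_scale[OF h] abs_mult pos_divide_le_eq)
qed (simp add: linear_0[OF h])

lemma smooth_has_derivative:
  "smooth h \<Longrightarrow> (nabla vs h has_derivative frechet_derivative (nabla vs h) (at y)) (at y)"
  by (simp add: smooth_def differentiable_on_def frechet_derivative_works[symmetric])

lemma nabla_bound_first:
  assumes h: "smooth h" and b: "nabla_bound 1 h b"
  shows "\<bar>frechet_derivative h (at y) u\<bar> \<le> b * norm u"
proof (rule linear_le_from_unit)
  show "linear (frechet_derivative h (at y))"
    using has_derivative_linear[OF smooth_has_derivative[OF h, of "[]"]] by simp
  show "\<bar>frechet_derivative h (at y) v\<bar> \<le> b" if "norm v = 1" for v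
    using b[unfolded nabla_bound_def, rule_format, of "[v]" y] that by simp
qed

lemma nabla_bound_second:
  assumes h: "smooth h" and b: "nabla_bound 2 h b"
  shows "\<bar>frechet_derivative h (at y) u - frechet_derivative h (at y') u\<bar> \<le> b * norm (y - y') * norm u"
proof (rule linear_le_from_unit)
  have "linear (frechet_derivative h (at y))" for y
    using has_derivative_linear[OF smooth_has_derivative[OF h, of "[]"]] by simp
  then show "linear (\<lambda>u. frechet_derivative h (at y) u - frechet_derivative h (at y') u)"
    by (intro linear_compose_sub)
  fix v :: 'a assume v: "norm v = 1"
  have "norm (nabla [v] h y - nabla [v] h y') \<le> b * norm (y - y')"
  proof (rule differentiable_bound[where S = UNIV and f' = "\<lambda>y. frechet_derivative (nabla [v] h) (at y)"])
    show "(nabla [v] h has_derivative frechet_derivative (nabla [v] h) (at y)) (at y within UNIV)" for y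
      by (rule smooth_has_derivative[OF h])
    show "onorm (frechet_derivative (nabla [v] h) (at y)) \<le> b" for y
    proof (rule onorm_le)
      have lin: "linear (frechet_derivative (nabla [v] h) (at y))"
        by (rule has_derivative_linear[OF smooth_has_derivative[OF h]])
      have "\<bar>frechet_derivative (nabla [v] h) (at y) w\<bar> \<le> b * norm w" for w
      proof (rule linear_le_from_unit[OF lin])
        fix w :: 'a assume "norm w = 1"
        then show "\<bar>frechet_derivative (nabla [v] h) (at y) w\<bar> \<le> b"
          using b[unfolded nabla_bound_def, rule_format, of "[w, v]" y] v by simp
      qed
      then show "norm (frechet_derivative (nabla [v] h) (at y) w) \<le> b * norm w" for w by simp
    qed
  qed auto
  then show "\<bar>frechet_derivative h (at y) v - frechet_derivative h (at y') v\<bar> \<le> b * norm (y - y')"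
    by simp
qed

lemma outside_support:
  fixes h :: "'a::euclidean_space \<Rightarrow> real"
  assumes "closure {y. h y \<noteq> 0} \<subseteq> S" "y \<notin> S"
  shows "h y = 0" "frechet_derivative h (at y) u = 0"
proof -
  let ?U = "- closure {y. h y \<noteq> 0}"
  have y: "y \<in> ?U" using assms by auto
  have U: "0 = h z" if "z \<in> ?U" for z
    using that closure_subset[of "{y. h y \<noteq> 0}"] by auto
  show "h y = 0" using U[OF y] by simp
  have "(h has_derivative (\<lambda>u. 0)) (at y)"
    by (rule has_derivative_transform_within_open[OF has_derivative_const _ y U]) auto
  then show "frechet_derivative h (at y) u = 0"
    using frechet_derivative_at[of h "\<lambda>u. 0" y] by metis
qed

lemma separated_points:
  fixes X :: "'i \<Rightarrow> 'a::euclidean_space"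
  assumes r: "0 < r" and sep: "\<And>i j. i \<in> I \<Longrightarrow> j \<in> I \<Longrightarrow> i \<noteq> j \<Longrightarrow> r \<le> dist (X i) (X j)"
  shows "inj_on X I" "bounded (X ` I) \<Longrightarrow> finite I"
proof -
  show inj: "inj_on X I"
  proof
    fix i j assume "i \<in> I" "j \<in> I" "X i = X j"
    then show "i = j" using sep[of i j] r by force
  qed
  have "uniform_discrete (X ` I)"
    unfolding uniform_discrete_def
  proof (intro exI[of _ r] conjI r ballI impI)
    fix a b assume "a \<in> X ` I" "b \<in> X ` I" "dist a b < r"
    then show "a = b" using sep by (metis imageE not_le)
  qed
  then show "finite I" if "bounded (X ` I)"
    using that uniform_discrete_finite_iff finite_imageD[OF _ inj] by blast
qed

lemma eps_upper:
  assumes fin: "\<And>k. finite (J k)" and j: "j \<in> J k" and l: "l = k \<or> Suc l = k" and i: "i \<in> J l"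
    and y: "y \<in> ball (x k j) (10 * rad k)" "y \<in> ball (x l i) (11 * rad l)"
  shows "hdist (x l i) (100 * rad l) (P k j) (P l i) \<le> eps J x P k y"
proof -
  let ?X = "{hdist (x l i) (100 * rad l) (P k j) (P l i) | j l i.
                  j \<in> J k \<and> (l = k \<or> Suc l = k) \<and> i \<in> J l \<and>
                  y \<in> ball (x k j) (10 * rad k) \<inter> ball (x l i) (11 * rad l)}"
  have "?X \<subseteq> (\<lambda>(j, l, i). hdist (x l i) (100 * rad l) (P k j) (P l i))
      ` (J k \<times> {l. l = k \<or> Suc l = k} \<times> (J k \<union> J (k - 1)))"
    by force
  moreover have "{l. l = k \<or> Suc l = k} \<subseteq> {..k}" by auto
  then have "finite {l. l = k \<or> Suc l = k}" using finite_subset by blast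
  ultimately have "finite ?X"
    using fin by (auto intro!: finite_imageI finite_cartesian_product elim: finite_subset)
  then have "bdd_above ?X" by (rule bdd_above_finite)
  moreover have "hdist (x l i) (100 * rad l) (P k j) (P l i) \<in> ?X"
    using j l i y by blast
  moreover have "y \<in> V J x k 10" using j y(1) by (auto simp: V_def)
  ultimately show ?thesis
    unfolding eps_def by (simp only: if_True) (rule cSup_upper)
qed

text \<open>The summability hypothesis enters through this bound on single summands. Adding \<open>1\<close> to \<open>sqrt M\<close> makes the factor at least \<open>1\<close>, so that
at scale \<open>1\<close> the bound is no smaller than \<open>\<epsilon>\<close>.\<close>

lemma summand_le_imp:
  assumes sm: "summable (\<lambda>k. (e k)\<^sup>2 / rad k powr (2 * \<alpha>))"
    and le: "(\<Sum>k. (e k)\<^sup>2 / rad k powr (2 * \<alpha>)) \<le> M"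
  shows "e k \<le> (sqrt M + 1) * rad k powr \<alpha>"
proof -
  have "(\<Sum>k\<in>{k}. (e k)\<^sup>2 / rad k powr (2 * \<alpha>)) \<le> (\<Sum>k. (e k)\<^sup>2 / rad k powr (2 * \<alpha>))"
    by (intro sum_le_suminf sm) auto
  then have "(e k)\<^sup>2 / rad k powr (2 * \<alpha>) \<le> M" using le by simp
  moreover have r: "0 < rad k powr \<alpha>" using rad_pos[of k] by simp
  have "rad k powr (2 * \<alpha>) = (rad k powr \<alpha>)\<^sup>2"
    by (simp add: power2_eq_square flip: powr_add)
  ultimately have "(e k / rad k powr \<alpha>)\<^sup>2 \<le> M"
    by (simp add: power_divide)
  then have "e k / rad k powr \<alpha> \<le> sqrt M" by (rule real_le_rsqrt)
  then have "e k \<le> sqrt M * rad k powr \<alpha>" using r by (simp add: pos_divide_le_eq)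
  then show ?thesis using r unfolding distrib_right by linarith
qed

text \<open>The form in which the distance of planes enters \<^locale>\<open>tower\<close>.\<close>

definition plane_gap :: "real \<Rightarrow> 'a::euclidean_space \<Rightarrow> real \<Rightarrow> 'a set \<Rightarrow> 'a set \<Rightarrow> bool" where
  "plane_gap t a r P P' \<longleftrightarrow>
     (\<forall>u. norm (lproj P u - lproj P' u) \<le> t * norm u) \<and>
     (\<forall>y\<in>ball a (30 * r). norm (closest_point P y - closest_point P' y) \<le> t * r)"

context
  fixes \<epsilon> :: real and d :: nat and E :: "'a::euclidean_space set" and J x P \<Sigma>\<^sub>0
  assumes coll: "coherent_collection \<epsilon> d E J x P \<Sigma>\<^sub>0" and eps: "0 < \<epsilon>" "\<epsilon> \<le> 1"
begin

lemma coll_plane: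
  "j \<in> J k \<Longrightarrow> affine (P k j)" "j \<in> J k \<Longrightarrow> P k j \<noteq> {}" "j \<in> J k \<Longrightarrow> x k j \<in> P k j"
  using coll unfolding coherent_collection_def is_plane_def by blast+

lemma coll_base: "affine \<Sigma>\<^sub>0" "\<Sigma>\<^sub>0 \<noteq> {}"
proof -
  have "is_plane d \<Sigma>\<^sub>0" using coll unfolding coherent_collection_def by blast
  then show "affine \<Sigma>\<^sub>0" "\<Sigma>\<^sub>0 \<noteq> {}"
    by (auto simp: is_plane_def)
qed

lemma coll_parent: "j \<in> J (Suc k) \<Longrightarrow> \<exists>i\<in>J k. dist (x (Suc k) j) (x k i) < rad k"
  using coll unfolding coherent_collection_def by blast

lemma same_generation_gap:
  assumes j: "j \<in> J k" and i: "i \<in> J k" and dist: "dist (x k j) (x k i) < 30 * rad k"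
  shows "hdist (x k i) (100 * rad k) (P k j) (P k i) \<le> \<epsilon>"
proof -
  have "dist (x k j) (x k i) \<le> 100 * rad k" using dist rad_pos[of k] by linarith
  then show ?thesis using coll j i unfolding coherent_collection_def by blast
qed

lemma base_gap:
  assumes j: "j \<in> J 0"
  shows "plane_gap (2000 * \<epsilon>) (x 0 j) 1 (P 0 j) \<Sigma>\<^sub>0"
proof -
  have h: "hdist (x 0 j) 100 (P 0 j) \<Sigma>\<^sub>0 \<le> \<epsilon>" and i: "infdist (x 0 j) \<Sigma>\<^sub>0 \<le> \<epsilon>"
    using coll j unfolding coherent_collection_def by blast+
  let ?q = "closest_point \<Sigma>\<^sub>0 (x 0 j)"
  have "dist (x 0 j) ?q \<le> 1"
    using i infdist_plane[OF coll_base] eps by (simp add: dist_norm)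
  then have near: "dist (x 0 j) ?q < 100 / 2" "dist (x 0 j) (x 0 j) < 100 / 2" by auto
  note cl = planes_close[OF coll_plane(1)[OF j] coll_base(1) coll_plane(3)[OF j] near(2)
      closest_point_in_plane[OF coll_base] near(1) h]
  have "norm (lproj (P 0 j) u - lproj \<Sigma>\<^sub>0 u) \<le> 2000 * \<epsilon> * norm u" for u
    using cl(1)[of u] mult_right_mono[OF _ norm_ge_zero[of u], of "8 * \<epsilon>" "2000 * \<epsilon>"] eps
    by linarith
  moreover have "norm (closest_point (P 0 j) y - closest_point \<Sigma>\<^sub>0 y) \<le> 2000 * \<epsilon> * 1"
    if "y \<in> ball (x 0 j) (30 * 1)" for y
  proof -
    have "norm (y - x 0 j) \<le> 30" using that by (simp add: dist_norm norm_minus_commute)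
    then have "8 * \<epsilon> * norm (y - x 0 j) \<le> 8 * \<epsilon> * 30" using eps by (intro mult_left_mono) auto
    then show ?thesis using cl(2)[of y] eps by linarith
  qed
  ultimately show ?thesis by (simp add: plane_gap_def)
qed

text \<open>The radius \<open>100 r\<^sub>l\<close> of the normalized distance is at most \<open>1000 r\<^sub>k\<close>, and \<open>1000 + 8 * 30 \<le> 2000\<close>.\<close>

lemma gap_from_hdist:
  assumes j: "j \<in> J k" and l: "l = k \<or> Suc l = k" and i: "i \<in> J l"
    and y: "y \<in> ball (x k j) (10 * rad k)" "y \<in> ball (x l i) (11 * rad l)"
    and h: "hdist (x l i) (100 * rad l) (P k j) (P l i) \<le> t" and t: "0 \<le> t"
  shows "plane_gap (2000 * t) (x k j) (rad k) (P k j) (P l i)"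
proof -
  have rl: "rad k \<le> rad l" "rad l \<le> 10 * rad k"
    using l rad_pos[of k] by (auto simp: rad_Suc)
  have "dist (x l i) (x k j) \<le> dist (x l i) y + dist (x k j) y"
    by (metis dist_commute dist_triangle)
  then have near: "dist (x l i) (x k j) < 100 * rad l / 2" "dist (x l i) (x l i) < 100 * rad l / 2"
    using y rl rad_pos[of l] unfolding mem_ball by auto
  note cl = planes_close[OF coll_plane(1)[OF j] coll_plane(1)[OF i] coll_plane(3)[OF j] near(1)
      coll_plane(3)[OF i] near(2) h]
  have "norm (lproj (P k j) u - lproj (P l i) u) \<le> 2000 * t * norm u" for u
    using cl(1)[of u] mult_right_mono[OF _ norm_ge_zero[of u], of "8 * t" "2000 * t"] t
    by linarith
  moreover have "norm (closest_point (P k j) y - closest_point (P l i) y) \<le> 2000 * t * rad k"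
    if "y \<in> ball (x k j) (30 * rad k)" for y
  proof -
    have "norm (y - x k j) \<le> 30 * rad k" using that by (simp add: dist_norm norm_minus_commute)
    then have 1: "8 * t * norm (y - x k j) \<le> 8 * t * (30 * rad k)" using t by (intro mult_left_mono) auto
    have 2: "100 * rad l * t \<le> 1000 * rad k * t" using rl t by (intro mult_right_mono) auto
    have 3: "0 \<le> t * rad k" using t by simp
    have "norm (closest_point (P k j) y - closest_point (P l i) y) \<le> 1000 * rad k * t + 8 * t * (30 * rad k)"
      using cl(2)[of y] 1 2 by linarith
    also have "\<dots> \<le> 2000 * t * rad k" using 3 by (simp add: algebra_simps)
    finally show ?thesis .
  qed
  ultimately show ?thesis by (simp add: plane_gap_def)
qed

text \<open>Coherence compares \<open>P\<^sub>j\<^sub>,\<^sub>l\<^sub>+\<^sub>1\<close> only with planes of generation \<open>l\<close> whose centre is within \<open>2 r\<^sub>l\<close>. The plane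
of a centre \<open>m\<close> next to that of \<open>j\<close> is used as an intermediate step to \<open>P\<^sub>i\<^sub>,\<^sub>l\<close>.\<close>

lemma parent_generation_gap:
  assumes j: "j \<in> J (Suc l)" and i: "i \<in> J l"
    and y: "y \<in> ball (x (Suc l) j) (10 * rad (Suc l))" "y \<in> ball (x l i) (11 * rad l)"
  shows "plane_gap (2000 * \<epsilon>) (x (Suc l) j) (rad (Suc l)) (P (Suc l) j) (P l i)"
proof -
  obtain m where m: "m \<in> J l" "dist (x (Suc l) j) (x l m) < rad l" using coll_parent[OF j] by blast
  have dm: "dist (x l m) (x (Suc l) j) < 20 * rad l / 2" "dist (x l m) (x l m) < 20 * rad l / 2"
    using m(2) rad_pos[of l] by (auto simp: dist_commute)
  have "dist (x l m) (x (Suc l) j) \<le> 2 * rad l" using m(2) rad_pos[of l] by (simp add: dist_commute)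
  then have h1: "hdist (x l m) (20 * rad l) (P l m) (P (Suc l) j) \<le> \<epsilon>"
    using coll j m(1) unfolding coherent_collection_def by blast
  have "dist (x l m) (x l i) \<le> dist (x (Suc l) j) (x l m) + dist (x (Suc l) j) y + dist (x l i) y"
    by (smt (verit) dist_commute dist_triangle)
  then have di: "dist (x l m) (x l i) < 30 * rad l"
    using m(2) y rad_pos[of l] unfolding mem_ball rad_Suc by linarith
  then have dmi: "dist (x l i) (x l m) < 100 * rad l / 2" "dist (x l i) (x l i) < 100 * rad l / 2"
    using rad_pos[of l] by (auto simp: dist_commute)
  note c1 = planes_close[OF coll_plane(1)[OF m(1)] coll_plane(1)[OF j] coll_plane(3)[OF m(1)] dm(2)
      coll_plane(3)[OF j] dm(1) h1]
  note c2 = planes_close[OF coll_plane(1)[OF m(1)] coll_plane(1)[OF i] coll_plane(3)[OF m(1)] dmi(1)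
      coll_plane(3)[OF i] dmi(2) same_generation_gap[OF m(1) i di]]
  have "norm (lproj (P (Suc l) j) u - lproj (P l i) u) \<le> 2000 * \<epsilon> * norm u" for u
  proof -
    have "norm (lproj (P (Suc l) j) u - lproj (P l i) u)
      \<le> norm (lproj (P l m) u - lproj (P (Suc l) j) u) + norm (lproj (P l m) u - lproj (P l i) u)"
      by norm
    also have "\<dots> \<le> 8 * \<epsilon> * norm u + 8 * \<epsilon> * norm u" by (intro add_mono c1(1) c2(1))
    also have "\<dots> \<le> 2000 * \<epsilon> * norm u"
      using mult_right_mono[of "16 * \<epsilon>" "2000 * \<epsilon>" "norm u"] eps by (simp add: algebra_simps)
    finally show ?thesis .
  qed
  moreover have "norm (closest_point (P (Suc l) j) y - closest_point (P l i) y) \<le> 2000 * \<epsilon> * rad (Suc l)"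
    if y: "y \<in> ball (x (Suc l) j) (30 * rad (Suc l))" for y
  proof -
    have "norm (y - x l m) \<le> dist (x (Suc l) j) y + dist (x (Suc l) j) (x l m)"
      by (metis dist_commute dist_norm dist_triangle)
    then have "norm (y - x l m) \<le> 4 * rad l"
      using y m(2) unfolding mem_ball rad_Suc by linarith
    then have 4: "8 * \<epsilon> * norm (y - x l m) \<le> 8 * \<epsilon> * (4 * rad l)" using eps by (intro mult_left_mono) auto
    have "norm (closest_point (P (Suc l) j) y - closest_point (P l i) y)
      \<le> norm (closest_point (P l m) y - closest_point (P (Suc l) j) y)
        + norm (closest_point (P l m) y - closest_point (P l i) y)"
      by norm
    also have "\<dots> \<le> (20 * rad l * \<epsilon> + 8 * \<epsilon> * (4 * rad l)) + (100 * rad l * \<epsilon> + 8 * \<epsilon> * (4 * rad l))"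
      using c1(2)[of y] c2(2)[of y] 4 by linarith
    also have "\<dots> \<le> 2000 * \<epsilon> * rad (Suc l)"
      using mult_nonneg_nonneg[OF less_imp_le[OF eps(1)] rad_nonneg[of l]] by (simp add: rad_Suc algebra_simps)
    finally show ?thesis .
  qed
  ultimately show ?thesis by (simp add: plane_gap_def)
qed

lemma adjacent_gap:
  assumes j: "j \<in> J k" and l: "l = k \<or> Suc l = k" and i: "i \<in> J l"
    and y: "y \<in> ball (x k j) (10 * rad k)" "y \<in> ball (x l i) (11 * rad l)"
  shows "plane_gap (2000 * \<epsilon>) (x k j) (rad k) (P k j) (P l i)"
  using l
proof
  assume l: "l = k"
  have "dist (x k j) (x k i) \<le> dist (x k j) y + dist (x k i) y"
    by (metis dist_commute dist_triangle)
  then have "dist (x k j) (x k i) < 30 * rad k"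
    using y rad_pos[of k] unfolding mem_ball l by linarith
  then show ?thesis
    using same_generation_gap[OF j i[unfolded l]] eps i y(2)
    unfolding l by (intro gap_from_hdist[OF j _ _ y(1)]) auto
next
  assume l: "Suc l = k"
  show ?thesis using parent_generation_gap[OF j[folded l] i y(1)[folded l] y(2)] by (simp add: l)
qed

text \<open>Every gap between planes is bounded both by coherence, with \<open>\<epsilon>\<close>, and by the numbers \<open>\<epsilon>\<^sub>k(f\<^sub>k(z))\<close>, with
\<open>r\<^sub>k\<^sup>\<alpha>\<close>. Taking the minimum yields one sequence that is small independently of \<open>M\<close> and decays.\<close>

lemma coherent_tower:
  assumes E: "bounded E" and cut: "cutoffs C J x \<theta> \<psi>"
    and N: "1 \<le> N" "\<forall>(S :: 'a set) y r. 0 < r \<and> S \<subseteq> ball y (10 * r)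
       \<and> (\<forall>a\<in>S. \<forall>b\<in>S. a \<noteq> b \<longrightarrow> r \<le> dist a b) \<longrightarrow> finite S \<and> card S \<le> N"
    and A: "1 \<le> A" "C 0 \<le> A" "C 1 \<le> A" "C 2 \<le> A"
    and small: "16000000 * (real N * A)\<^sup>2 * \<epsilon> \<le> 1"
    and alpha: "0 < \<alpha>" "\<alpha> < 1" and M: "0 < M"
    and sums: "\<forall>z\<in>\<Sigma>\<^sub>0.
             summable (\<lambda>k. (eps J x P k (dt_iter J P \<theta> \<psi> k z))\<^sup>2 / rad k powr (2 * \<alpha>)) \<and>
             (\<Sum>k. (eps J x P k (dt_iter J P \<theta> \<psi> k z))\<^sup>2 / rad k powr (2 * \<alpha>)) \<le> M"
  shows "holder_tower J x P \<Sigma>\<^sub>0 \<theta> (\<lambda>k j y. frechet_derivative (\<theta> k j) (at y)) \<psi> (real N) A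
    (\<lambda>k. 2000 * min \<epsilon> ((sqrt M + 1) * rad k powr \<alpha>)) \<alpha> (2000 * (sqrt M + 1))"
proof -
  define Q where "Q = sqrt M + 1"
  have Q: "1 \<le> Q" using M by (simp add: Q_def)
  have sep: "rad k \<le> dist (x k i) (x k j)" if "i \<in> J k" "j \<in> J k" "i \<noteq> j" for k i j
    using coll that unfolding coherent_collection_def by blast
  have inE: "x k ` J k \<subseteq> E" for k
    using coll unfolding coherent_collection_def by blast
  have fin: "finite (J k)" for k
    using separated_points(2)[of "rad k" "J k" "x k"] sep rad_pos bounded_subset[OF E inE] by blast
  have th: "smooth (\<theta> k j)" "0 \<le> \<theta> k j y" "closure {y. \<theta> k j y \<noteq> 0} \<subseteq> ball (x k j) (10 * rad k)"
      "nabla_bound m (\<theta> k j) (C m / rad k ^ m)" if "j \<in> J k" for k j y m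
    using cut that unfolding cutoffs_def by blast+
  have A_bound: "nabla_bound 0 (\<theta> k j) A" "nabla_bound 1 (\<theta> k j) (A / rad k)"
      "nabla_bound 2 (\<theta> k j) (A / (rad k)\<^sup>2)" if j: "j \<in> J k" for k j
  proof -
    have "C 1 / rad k \<le> A / rad k" "C 2 / (rad k)\<^sup>2 \<le> A / (rad k)\<^sup>2"
      using A by (auto intro!: divide_right_mono)
    then show "nabla_bound 0 (\<theta> k j) A" "nabla_bound 1 (\<theta> k j) (A / rad k)"
      "nabla_bound 2 (\<theta> k j) (A / (rad k)\<^sup>2)"
      using th(4)[OF j, of 0] th(4)[OF j, of 1] th(4)[OF j, of 2] A(2)
      unfolding nabla_bound_def power_0 power_one_right div_by_1 by (meson order_trans)+
  qed
  have gap: "plane_gap (2000 * min \<epsilon> (Q * rad k powr \<alpha>)) (x k j) (rad k) (P k j) (P l i)"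
    if "z \<in> \<Sigma>\<^sub>0" "j \<in> J k" "l = k \<or> Suc l = k" "i \<in> J l"
      "dt_iter J P \<theta> \<psi> k z \<in> ball (x k j) (10 * rad k)"
      "dt_iter J P \<theta> \<psi> k z \<in> ball (x l i) (11 * rad l)" for z k j l i
  proof (cases "\<epsilon> \<le> Q * rad k powr \<alpha>")
    case True
    then show ?thesis using adjacent_gap[OF that(2-6)] by (simp add: min_def)
  next
    case False
    have "hdist (x l i) (100 * rad l) (P k j) (P l i) \<le> eps J x P k (dt_iter J P \<theta> \<psi> k z)"
      using eps_upper[OF fin that(2-6)] .
    also have "\<dots> \<le> Q * rad k powr \<alpha>"
      unfolding Q_def using sums that(1)
      by (intro summand_le_imp[where e = "\<lambda>k. eps J x P k (dt_iter J P \<theta> \<psi> k z)"]) auto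
    finally have "plane_gap (2000 * (Q * rad k powr \<alpha>)) (x k j) (rad k) (P k j) (P l i)"
      using Q by (intro gap_from_hdist[OF that(2-6)]) auto
    then show ?thesis using False by (simp add: min_def)
  qed
  \<comment> \<open>At scale \<open>1\<close> the gap to the base plane is only known to be \<open>O(\<epsilon>)\<close>, and \<open>\<epsilon> \<le> 1 \<le> Q\<close>.\<close>
  have lam0: "min \<epsilon> (Q * rad 0 powr \<alpha>) = \<epsilon>"
    using eps Q by (simp add: rad_def)
  show ?thesis
    unfolding Q_def[symmetric]
  proof unfold_locales
    show "1 \<le> real N" using N(1) by simp
    show "1 \<le> A" by (rule A(1))
    show "finite (J k)" for k by (rule fin)
    show "real (card {j \<in> J k. y \<in> ball (x k j) (10 * rad k)}) \<le> real N" for k y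
    proof -
      let ?I = "{j \<in> J k. y \<in> ball (x k j) (10 * rad k)}"
      have "x k ` ?I \<subseteq> ball y (10 * rad k)" by (auto simp: dist_commute)
      moreover have "\<forall>a\<in>x k ` ?I. \<forall>b\<in>x k ` ?I. a \<noteq> b \<longrightarrow> rad k \<le> dist a b"
        using sep by blast
      ultimately have "card (x k ` ?I) \<le> N"
        using N(2) rad_pos[of k] by blast
      moreover have "inj_on (x k) ?I"
        using separated_points(1)[OF rad_pos, of ?I k "x k"] sep by blast
      ultimately show ?thesis by (simp add: card_image)
    qed
    show "\<exists>i\<in>J k. dist (x (Suc k) j) (x k i) < rad k" if "j \<in> J (Suc k)" for k j
      by (rule coll_parent[OF that])
    show "affine (P k j)" "P k j \<noteq> {}" if "j \<in> J k" for k j using coll_plane that by auto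
    show "affine \<Sigma>\<^sub>0" "\<Sigma>\<^sub>0 \<noteq> {}" by (rule coll_base)+
    show "0 \<le> \<theta> k j y" if "j \<in> J k" for k j y by (rule th(2)[OF that])
    show "\<theta> k j y \<le> A" if "j \<in> J k" for k j y
      using A_bound(1)[OF that, unfolded nabla_bound_def, rule_format, of "[]" y] by simp
    show "\<theta> k j y = 0" if "j \<in> J k" "y \<notin> ball (x k j) (10 * rad k)" for k j y
      by (rule outside_support(1)[OF th(3)[OF that(1)] that(2)])
    show "(\<theta> k j has_derivative frechet_derivative (\<theta> k j) (at y)) (at y)" if "j \<in> J k" for k j y
      using smooth_has_derivative[OF th(1)[OF that], of "[]" y] by simp
    show "\<bar>frechet_derivative (\<theta> k j) (at y) u\<bar> \<le> A / rad k * norm u" if "j \<in> J k" for k j y u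
      by (rule nabla_bound_first[OF th(1)[OF that] A_bound(2)[OF that]])
    show "\<bar>frechet_derivative (\<theta> k j) (at y) u - frechet_derivative (\<theta> k j) (at y') u\<bar>
        \<le> A / (rad k)\<^sup>2 * norm (y - y') * norm u" if "j \<in> J k" for k j y u y'
      by (rule nabla_bound_second[OF th(1)[OF that] A_bound(3)[OF that]])
    show "frechet_derivative (\<theta> k j) (at y) u = 0" if "j \<in> J k" "y \<notin> ball (x k j) (10 * rad k)" for k j y u
      by (rule outside_support(2)[OF th(3)[OF that(1)] that(2)])
    show "\<psi> k y + (\<Sum>j\<in>J k. \<theta> k j y) = 1" for k y
      using cut unfolding cutoffs_def by blast
    show "\<psi> k y = 0" if "y \<in> V J x k 8" for k y
      using cut that unfolding cutoffs_def by blast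
    show "norm (lproj (P 0 j) u - lproj \<Sigma>\<^sub>0 u) \<le> 2000 * min \<epsilon> (Q * rad 0 powr \<alpha>) * norm u"
      if "j \<in> J 0" for j u
      using base_gap[OF that] unfolding lam0 plane_gap_def by blast
    show "norm (closest_point (P 0 j) y - closest_point \<Sigma>\<^sub>0 y) \<le> 2000 * min \<epsilon> (Q * rad 0 powr \<alpha>)"
      if "j \<in> J 0" "y \<in> ball (x 0 j) 30" for j y
      using base_gap[OF that(1)] that(2) unfolding lam0 plane_gap_def by simp
    show "norm (lproj (P k j) u - lproj (P l i) u) \<le> 2000 * min \<epsilon> (Q * rad k powr \<alpha>) * norm u"
      if "z \<in> \<Sigma>\<^sub>0" "j \<in> J k" "l = k \<or> Suc l = k" "i \<in> J l"
      "dt_iter J P \<theta> \<psi> k z \<in> ball (x k j) (10 * rad k)"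
      "dt_iter J P \<theta> \<psi> k z \<in> ball (x l i) (11 * rad l)" for z j k l i u
      using gap[OF that] unfolding plane_gap_def by blast
    show "norm (closest_point (P k j) y - closest_point (P l i) y) \<le> 2000 * min \<epsilon> (Q * rad k powr \<alpha>) * rad k"
      if "z \<in> \<Sigma>\<^sub>0" "j \<in> J k" "l = k \<or> Suc l = k" "i \<in> J l"
      "dt_iter J P \<theta> \<psi> k z \<in> ball (x k j) (10 * rad k)"
      "dt_iter J P \<theta> \<psi> k z \<in> ball (x l i) (11 * rad l)" "y \<in> ball (x k j) (30 * rad k)" for z j k l i y
      using gap[OF that(1-6)] that(7) unfolding plane_gap_def by blast
    show "0 \<le> 2000 * min \<epsilon> (Q * rad k powr \<alpha>)" for k using eps Q by simp
    show "8000 * (real N * A)\<^sup>2 * (2000 * min \<epsilon> (Q * rad k powr \<alpha>)) \<le> 1" for k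
    proof -
      have "8000 * (real N * A)\<^sup>2 * (2000 * min \<epsilon> (Q * rad k powr \<alpha>)) \<le> 8000 * (real N * A)\<^sup>2 * (2000 * \<epsilon>)"
        by (intro mult_left_mono) auto
      also have "\<dots> \<le> 1" using small by simp
      finally show ?thesis .
    qed
    show "2000 * min \<epsilon> (Q * rad k powr \<alpha>) \<le> 10 * (2000 * min \<epsilon> (Q * rad (Suc k) powr \<alpha>))" for k
    proof -
      note q = ratio_bounds[OF alpha]
      have "1 * ratio \<alpha> ^ k \<le> (10 * ratio \<alpha>) * ratio \<alpha> ^ k" using q by (intro mult_right_mono) auto
      then have "Q * (1 * ratio \<alpha> ^ k) \<le> Q * ((10 * ratio \<alpha>) * ratio \<alpha> ^ k)"
        using Q by (intro mult_left_mono) auto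
      then have "Q * rad k powr \<alpha> \<le> 10 * (Q * rad (Suc k) powr \<alpha>)"
        by (simp add: rad_powr mult_ac)
      then show ?thesis using eps by (auto simp: min_def)
    qed
    show "0 < \<alpha>" "\<alpha> < 1" by (rule alpha)+
    show "0 \<le> 2000 * Q" using Q by simp
    show "2000 * min \<epsilon> (Q * rad k powr \<alpha>) \<le> 2000 * Q * rad k powr \<alpha>" for k by simp
  qed
qed

end

lemma holder_dir_derivs_plane_mono:
  assumes "holder_dir_derivs_plane a K h P" "K \<le> K'"
  shows "holder_dir_derivs_plane a K' h P"
proof -
  have "K * dist x y powr a \<le> K' * dist x y powr a" for x y :: 'a
    using assms(2) by (intro mult_right_mono) auto
  then show ?thesis
    using assms(1) order_trans unfolding holder_dir_derivs_plane_def by blast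
qed

lemma holder_tangent_derivs_mono:
  assumes "holder_tangent_derivs a K h S" "K \<le> K'"
  shows "holder_tangent_derivs a K' h S"
proof -
  have "K * dist x y powr a \<le> K' * dist x y powr a" for x y :: 'a
    using assms(2) by (intro mult_right_mono) auto
  then show ?thesis
    using assms(1) order_trans unfolding holder_tangent_derivs_def by blast
qed

context holder_tower
begin

lemma holder_const_nonneg: "0 \<le> holder_const B Q \<alpha>"
  unfolding holder_const_def using tail_nonneg variation_nonneg S_ge_1
  by (intro mult_nonneg_nonneg) auto

section \<open>Regularity of the David-Toro map\<close>

lemma limit_regular:
  defines "K \<equiv> max (holder_const B Q \<alpha>)
      (2 * holder_const B Q \<alpha> / (expansion B Q \<alpha>)\<^sup>2 / expansion B Q \<alpha> powr \<alpha>)"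
  shows "inj_on D \<Sigma>\<^sub>0" "D differentiable_on \<Sigma>\<^sub>0" "inv_into \<Sigma>\<^sub>0 D differentiable_on (D ` \<Sigma>\<^sub>0)"
    "holder_dir_derivs_plane \<alpha> K D \<Sigma>\<^sub>0" "holder_tangent_derivs \<alpha> K (inv_into \<Sigma>\<^sub>0 D) (D ` \<Sigma>\<^sub>0)"
    "C1_on D \<Sigma>\<^sub>0"
proof -
  interpret X: expanding_embedding D \<Sigma>\<^sub>0 G "expansion B Q \<alpha>"
    by unfold_locales (fact base_plane D_has_derivative expansion_pos D_expanding)+
  show "inj_on D \<Sigma>\<^sub>0" by (rule X.inj)
  show "D differentiable_on \<Sigma>\<^sub>0"
    unfolding differentiable_on_def differentiable_def using D_has_derivative by blast
  show "inv_into \<Sigma>\<^sub>0 D differentiable_on (D ` \<Sigma>\<^sub>0)" by (rule X.inverse_differentiable)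
  show "holder_dir_derivs_plane \<alpha> K D \<Sigma>\<^sub>0"
    by (rule holder_dir_derivs_plane_mono[OF X.holder_derivs[OF G_holder]]) (auto simp: K_def)
  show "holder_tangent_derivs \<alpha> K (inv_into \<Sigma>\<^sub>0 D) (D ` \<Sigma>\<^sub>0)"
    using alpha by (intro holder_tangent_derivs_mono[OF X.holder_inverse[OF holder_const_nonneg _ G_holder]])
      (auto simp: K_def)
  show "C1_on D \<Sigma>\<^sub>0"
    by (rule X.C1[OF holder_const_nonneg alpha(1) G_holder])
qed

end

theorem theorem3p4:
  fixes d :: nat and C :: "nat \<Rightarrow> real"
  assumes "0 < d" and "d < CARD('n)"
  shows
    "\<exists>\<epsilon>\<^sub>0>0. \<forall>\<alpha> M. 0 < \<alpha> \<and> \<alpha> < 1 \<and> 0 < M \<longrightarrow>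
       (\<exists>K. \<forall>\<epsilon> (E :: (real ^ 'n) set) J x P \<Sigma>\<^sub>0 \<theta> \<psi>.
          0 < \<epsilon> \<and> \<epsilon> \<le> \<epsilon>\<^sub>0 \<and>
          E \<subseteq> ball 0 1 \<and>
          one_sided_reifenberg_flat \<epsilon> d E \<and>
          coherent_collection \<epsilon> d E J x P \<Sigma>\<^sub>0 \<and>
          cutoffs C J x \<theta> \<psi> \<and>
          (\<forall>z\<in>\<Sigma>\<^sub>0.
             summable (\<lambda>k. (eps J x P k (dt_iter J P \<theta> \<psi> k z))\<^sup>2 / rad k powr (2 * \<alpha>)) \<and>
             (\<Sum>k. (eps J x P k (dt_iter J P \<theta> \<psi> k z))\<^sup>2 / rad k powr (2 * \<alpha>)) \<le> M)
          \<longrightarrow>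
          (let f = david_toro J P \<theta> \<psi>; \<Sigma> = f ` \<Sigma>\<^sub>0; g = inv_into \<Sigma>\<^sub>0 f in
             inj_on f \<Sigma>\<^sub>0 \<and>
             f differentiable_on \<Sigma>\<^sub>0 \<and>
             g differentiable_on \<Sigma> \<and>
             holder_dir_derivs_plane \<alpha> K f \<Sigma>\<^sub>0 \<and>
             holder_tangent_derivs \<alpha> K g \<Sigma> \<and>
             C1_on f \<Sigma>\<^sub>0))"
proof -
  obtain N where N: "1 \<le> N" "\<forall>(S :: (real ^ 'n) set) y r. 0 < r \<and> S \<subseteq> ball y (10 * r)
       \<and> (\<forall>a\<in>S. \<forall>b\<in>S. a \<noteq> b \<longrightarrow> r \<le> dist a b) \<longrightarrow> finite S \<and> card S \<le> N"
    using separated_overlap_bound[where 'a = "real ^ 'n"] by blast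
  define A where "A = Max {1, C 0, C 1, C 2}"
  have A: "1 \<le> A" "C 0 \<le> A" "C 1 \<le> A" "C 2 \<le> A" by (auto simp: A_def)
  define B where "B = real N * A"
  have B: "1 \<le> B" unfolding B_def using N(1) A(1) mult_mono[of 1 "real N" 1 A] by simp
  \<comment> \<open>The factor is \<open>8000 * 2000\<close>: the smallness condition of \<^locale>\<open>tower\<close> for gaps \<open>2000 * \<epsilon>\<close>.\<close>
  define \<epsilon>\<^sub>0 where "\<epsilon>\<^sub>0 = 1 / (16000000 * B\<^sup>2)"
  have \<epsilon>\<^sub>0: "0 < \<epsilon>\<^sub>0" "\<epsilon>\<^sub>0 \<le> 1" "16000000 * B\<^sup>2 * \<epsilon>\<^sub>0 = 1"
  proof -
    have "1 \<le> B\<^sup>2" using B by (rule one_le_power)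
    then have "1 \<le> 16000000 * B\<^sup>2" by linarith
    then show "0 < \<epsilon>\<^sub>0" "\<epsilon>\<^sub>0 \<le> 1" "16000000 * B\<^sup>2 * \<epsilon>\<^sub>0 = 1"
      unfolding \<epsilon>\<^sub>0_def using B by simp_all
  qed
  show ?thesis
  proof (rule exI[of _ \<epsilon>\<^sub>0], intro conjI allI impI)
    show "0 < \<epsilon>\<^sub>0" by (rule \<epsilon>\<^sub>0(1))
    fix \<alpha> M :: real assume aM: "0 < \<alpha> \<and> \<alpha> < 1 \<and> 0 < M"
    define Q where "Q = 2000 * (sqrt M + 1)"
    define K where "K = max (holder_const B Q \<alpha>)
      (2 * holder_const B Q \<alpha> / (expansion B Q \<alpha>)\<^sup>2 / expansion B Q \<alpha> powr \<alpha>)"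
    show "\<exists>K. \<forall>\<epsilon> (E :: (real ^ 'n) set) J x P \<Sigma>\<^sub>0 \<theta> \<psi>.
          0 < \<epsilon> \<and> \<epsilon> \<le> \<epsilon>\<^sub>0 \<and>
          E \<subseteq> ball 0 1 \<and>
          one_sided_reifenberg_flat \<epsilon> d E \<and>
          coherent_collection \<epsilon> d E J x P \<Sigma>\<^sub>0 \<and>
          cutoffs C J x \<theta> \<psi> \<and>
          (\<forall>z\<in>\<Sigma>\<^sub>0.
             summable (\<lambda>k. (eps J x P k (dt_iter J P \<theta> \<psi> k z))\<^sup>2 / rad k powr (2 * \<alpha>)) \<and>
             (\<Sum>k. (eps J x P k (dt_iter J P \<theta> \<psi> k z))\<^sup>2 / rad k powr (2 * \<alpha>)) \<le> M)
          \<longrightarrow>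
          (let f = david_toro J P \<theta> \<psi>; \<Sigma> = f ` \<Sigma>\<^sub>0; g = inv_into \<Sigma>\<^sub>0 f in
             inj_on f \<Sigma>\<^sub>0 \<and>
             f differentiable_on \<Sigma>\<^sub>0 \<and>
             g differentiable_on \<Sigma> \<and>
             holder_dir_derivs_plane \<alpha> K f \<Sigma>\<^sub>0 \<and>
             holder_tangent_derivs \<alpha> K g \<Sigma> \<and>
             C1_on f \<Sigma>\<^sub>0)"
    proof (rule exI[of _ K], intro allI impI, elim conjE)
      fix \<epsilon> and E \<Sigma>\<^sub>0 :: "(real ^ 'n) set" and J x P \<theta> \<psi>
      assume eps: "0 < \<epsilon>" "\<epsilon> \<le> \<epsilon>\<^sub>0" and E: "E \<subseteq> ball 0 1"
        and coll: "coherent_collection \<epsilon> d E J x P \<Sigma>\<^sub>0" and cut: "cutoffs C J x \<theta> \<psi>"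
        and sums: "\<forall>z\<in>\<Sigma>\<^sub>0.
             summable (\<lambda>k. (eps J x P k (dt_iter J P \<theta> \<psi> k z))\<^sup>2 / rad k powr (2 * \<alpha>)) \<and>
             (\<Sum>k. (eps J x P k (dt_iter J P \<theta> \<psi> k z))\<^sup>2 / rad k powr (2 * \<alpha>)) \<le> M"
      have "16000000 * (real N * A)\<^sup>2 * \<epsilon> \<le> 16000000 * B\<^sup>2 * \<epsilon>\<^sub>0"
        unfolding B_def using eps by (intro mult_left_mono) auto
      then have small: "16000000 * (real N * A)\<^sup>2 * \<epsilon> \<le> 1" using \<epsilon>\<^sub>0(3) by simp
      have "\<epsilon> \<le> 1" using eps \<epsilon>\<^sub>0(2) by simp
      interpret H: holder_tower J x P \<Sigma>\<^sub>0 \<theta> "\<lambda>k j y. frechet_derivative (\<theta> k j) (at y)" \<psi> "real N" A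
        "\<lambda>k. 2000 * min \<epsilon> ((sqrt M + 1) * rad k powr \<alpha>)" \<alpha> Q
        unfolding Q_def
        using coherent_tower[OF coll eps(1) \<open>\<epsilon> \<le> 1\<close> bounded_subset[OF bounded_ball E] cut N A small
            _ _ _ sums] aM by blast
      have "H.B = B" by (simp add: H.B_def B_def)
      then show "let f = david_toro J P \<theta> \<psi>; \<Sigma> = f ` \<Sigma>\<^sub>0; g = inv_into \<Sigma>\<^sub>0 f in
             inj_on f \<Sigma>\<^sub>0 \<and> f differentiable_on \<Sigma>\<^sub>0 \<and> g differentiable_on \<Sigma> \<and>
             holder_dir_derivs_plane \<alpha> K f \<Sigma>\<^sub>0 \<and> holder_tangent_derivs \<alpha> K g \<Sigma> \<and> C1_on f \<Sigma>\<^sub>0"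
        using H.limit_regular unfolding Let_def K_def by simp
    qed
  qed
qed

end
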